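(* The functions $$f^{(1)}_{l,m,n}(Z)=\begin{pmatrix}t^l_{n-\frac12\,\underline m}(Z)\\-t^l_{n+\frac12\,\underline m}(Z)\end{pmatrix},\quad m=-l,-l+1,\dots,l,\ \ n=-l-\tfrac12,-l+\tfrac12,\dots,l+\tfrac12,$$ $$f^{(2)}_{l,m,n}(Z)=\begin{pmatrix}(l-n+\frac12)\,t^l_{n-\frac12\,\underline m}(Z)\\(l+n+\frac12)\,t^l_{n+\frac12\,\underline m}(Z)\end{pmatrix},\quad m=-l,\dots,l,\ \ n=-l+\tfrac12,-l+\tfrac32,\dots,l-\tfrac12,$$ $$f^{(3)}_{l,m,n}(Z)=\begin{pmatrix}N(Z)\,t^{l-1}_{n-\frac12\,\underline m}(Z)\\-N(Z)\,t^{l-1}_{n+\frac12\,\underline m}(Z)\end{pmatrix},\quad m=-l+1,\dots,l-1,\ \ n=-l+\tfrac12,\dots,l-\tfrac12,$$ span respectively the $V_{l+\frac12}\boxtimes V_l$, $V_{l-\frac12}\boxtimes V_l$ and $V_{l-\frac12}\boxtimes V_{l-1}$ components of ${\cal U}(2l)$, $l=0,\frac12,1,\frac32,\dots$. The functions $$g^{(1)}_{l,m,n}(Z)=\bigl((l+m+\tfrac12)t^l_{n\,\underline{m-\frac12}}(Z),\,-(l-m+\tfrac12)t^l_{n\,\underline{m+\frac12}}(Z)\bigr),\quad m=-l-\tfrac12,\dots,l+\tfrac12,\ \ n=-l,\dots,l,$$ $$g^{(2)}_{l,m,n}(Z)=\bigl(t^l_{n\,\underline{m-\frac12}}(Z),\,t^l_{n\,\underline{m+\frac12}}(Z)\bigr),\quad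 m=-l+\tfrac12,\dots,l-\tfrac12,\ \ n=-l,\dots,l,$$ $$g^{(3)}_{l,m,n}(Z)=N(Z)\bigl((l+m-\tfrac12)t^{l-1}_{n\,\underline{m-\frac12}}(Z),\,-(l-m-\tfrac12)t^{l-1}_{n\,\underline{m+\frac12}}(Z)\bigr),\quad m=-l+\tfrac12,\dots,l-\tfrac12,\ \ n=-l+1,\dots,l-1,$$ span respectively the $V_l\boxtimes V_{l+\frac12}$, $V_l\boxtimes V_{l-\frac12}$ and $V_{l-1}\boxtimes V_{l-\frac12}$ components of ${\cal U}'(2l)$, $l=0,\frac12,1,\frac32,\dots$.
   Context: $\mathbb H_{\mathbb C}=\mathbb C\otimes_{\mathbb R}\mathbb H$ is identified with $2\times2$ complex matrices $Z=\bigl(\begin{smallmatrix}z_{11}&z_{12}\\ z_{21}&z_{22}\end{smallmatrix}\bigr)=z^0e_0+z^1e_1+z^2e_2+z^3e_3$, with $e_0=1$, $e_1=\bigl(\begin{smallmatrix}0&-i\\-i&0\end{smallmatrix}\bigr)$, $e_2=\bigl(\begin{smallmatrix}0&-1\\1&0\end{smallmatrix}\bigr)$, $e_3=\bigl(\begin{smallmatrix}-i&0\\0&i\end{smallmatrix}\bigr)$; $N(Z)=\det Z$; $\operatorname{Re}A=\frac12\operatorname{Tr}A$. $\mathbb S$, $\mathbb S'$ are the spaces of complex $2$-columns and $2$-rows. For $l=0,\frac12,1,\dots$, $m,n\in\mathbb Z+l$, $-l\le m,n\le l$: $t^l_{n\,\underline m}(Z)=\frac1{2\pi i}\oint(sz_{11}+z_{21})^{l-m}(sz_{12}+z_{22})^{l+m}s^{-l+n}\frac{ds}s$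 (counterclockwise loop around $0$); $t^l_{n\,\underline m}=0$ when an index is out of range. $\nabla=e_0\partial_{z^0}-e_1\partial_{z^1}-e_2\partial_{z^2}-e_3\partial_{z^3}$, $\square=\sum_j\partial_{z^j}^2$, $g\overleftarrow\nabla$ is $\nabla$ acting from the right. ${\cal U}=\{f\in\mathbb C[z^0,z^1,z^2,z^3,N(Z)^{-1}]\otimes\mathbb S;\nabla\square f=0\}$, ${\cal U}'=\{g\in\mathbb C[z^0,z^1,z^2,z^3,N(Z)^{-1}]\otimes\mathbb S';(\square g)\overleftarrow\nabla=0\}$; ${\cal U}(d)$, ${\cal U}'(d)$ are their subspaces of functions homogeneous of degree $d$. $\mathfrak{gl}(2,\mathbb H_{\mathbb C})$ acts by differentiating $(\pi'_l(h)f)(Z)=\frac{a'-Zc'}{N(a'-Zc')}f\bigl((a'-Zc')^{-1}(-b'+Zd')\bigr)$ on ${\cal U}$ and $(\pi'_r(h)g)(Z)=g\bigl((aZ+b)(cZ+d)^{-1}\bigr)\frac{cZ+d}{N(cZ+d)}$ on ${\cal U}'$, $h=\bigl(\begin{smallmatrix}a'&b'\\ c'&d'\end{smallmatrix}\bigr)$, $h^{-1}=\bigl(\begin{smallmatrix}a&b\\ c&d\end{smallmatrix}\bigr)$. Under $\mathfrak{sl}(2,\mathbb C)\times\mathfrak{sl}(2,\mathbb C)=\{\bigl(\begin{smallmatrix}A&0\\0&D\end{smallmatrix}\bigr);\operatorname{Re}A=\operatorname{Re}D=0\}$ one has ${\cal U}(2l)=(V_{l+\frac12}\boxtimes V_l)\oplus(V_{l-\frac12}\boxtimes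 V_l)\oplus(V_{l-\frac12}\boxtimes V_{l-1})$ and ${\cal U}'(2l)=(V_l\boxtimes V_{l+\frac12})\oplus(V_l\boxtimes V_{l-\frac12})\oplus(V_{l-1}\boxtimes V_{l-\frac12})$, where $V_l$ is the irreducible $\mathfrak{sl}(2,\mathbb C)$-module of dimension $2l+1$ ($V_j=0$ for $j<0$), the first factor being acted on by $A$ and the second by $D$. *)

theory Defs
  imports
    "HOL-Complex_Analysis.Complex_Analysis"
    "HOL-Library.Function_Algebras"
begin

no_notation fps_nth (infixl \<open>$\<close> 75)

section \<open>Complexified quaternions\<close>

type_synonym quat = "complex^2^2"

abbreviation N :: "quat \<Rightarrow> complex"
  where "N \<equiv> det"

definition qRe :: "quat \<Rightarrow> complex"
  where "qRe A = trace A / 2"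

definition mscale :: "complex \<Rightarrow> complex^'n^'m \<Rightarrow> complex^'n^'m"
  where "mscale c A = (\<chi> i j. c * A $ i $ j)"

definition e0 :: quat where "e0 = mat 1"
definition e1 :: quat where "e1 = vector [vector [0, - \<i>], vector [- \<i>, 0]]"
definition e2 :: quat where "e2 = vector [vector [0, - 1], vector [1, 0]]"
definition e3 :: quat where "e3 = vector [vector [- \<i>, 0], vector [0, \<i>]]"

definition z0 :: "quat \<Rightarrow> complex" where "z0 Z = (Z$1$1 + Z$2$2) / 2"
definition z1 :: "quat \<Rightarrow> complex" where "z1 Z = \<i> * (Z$1$2 + Z$2$1) / 2"
definition z2 :: "quat \<Rightarrow> complex" where "z2 Z = (Z$2$1 - Z$1$2) / 2"
definition z3 :: "quat \<Rightarrow> complex" where "z3 Z = \<i> * (Z$1$1 - Z$2$2) / 2"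

lemma quat_coordinates:
  "Z = mscale (z0 Z) e0 + mscale (z1 Z) e1 + mscale (z2 Z) e2 + mscale (z3 Z) e3"
  by (simp add: vec_eq_iff forall_2 mscale_def z0_def z1_def z2_def z3_def
      e0_def e1_def e2_def e3_def mat_def field_simps)

lemma quat_coordinates_unique:
  assumes "Z = mscale a e0 + mscale b e1 + mscale c e2 + mscale d e3"
  shows "a = z0 Z" "b = z1 Z" "c = z2 Z" "d = z3 Z"
  by (simp_all add: assms mscale_def z0_def z1_def z2_def z3_def
      e0_def e1_def e2_def e3_def mat_def field_simps)


section \<open>Functions on the invertible elements\<close>

text \<open>
  The elements of \<open>\<complex>[z\<^sup>0, z\<^sup>1, z\<^sup>2, z\<^sup>3, N(Z)\<^sup>-\<^sup>1]\<close> are functions on \<open>{Z. N Z \<noteq> 0}\<close>.  Throughout, such a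
  function is represented by its extension by zero to all matrices, so that equality
  of HOL functions is equality on \<open>{Z. N Z \<noteq> 0}\<close>.
\<close>

definition on_inv :: "(quat \<Rightarrow> 'a::zero) \<Rightarrow> quat \<Rightarrow> 'a"
  where "on_inv f = (\<lambda>Z. if N Z = 0 then 0 else f Z)"

inductive_set laurent :: "(quat \<Rightarrow> complex) set" where
  const: "on_inv (\<lambda>_. c) \<in> laurent"
| coord: "u \<in> {z0, z1, z2, z3} \<Longrightarrow> on_inv u \<in> laurent"
| N_inverse: "on_inv (\<lambda>Z. inverse (N Z)) \<in> laurent"
| add: "f \<in> laurent \<Longrightarrow> g \<in> laurent \<Longrightarrow> (\<lambda>Z. f Z + g Z) \<in> laurent"
| mult: "f \<in> laurent \<Longrightarrow> g \<in> laurent \<Longrightarrow> (\<lambda>Z. f Z * g Z) \<in> laurent"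

text \<open>
  Vectors of type \<^typ>\<open>complex^2\<close> serve both as columns (acted on by \<open>*v\<close>)
  and as rows (acted on by \<open>v*\<close>).
\<close>

type_synonym qfun = "quat \<Rightarrow> complex^2"

definition fscale :: "complex \<Rightarrow> qfun \<Rightarrow> qfun"
  where "fscale c f = (\<lambda>Z. c *s f Z)"

global_interpretation qfun: vector_space fscale
  by standard
    (auto simp: fscale_def fun_eq_iff vec_eq_iff algebra_simps)

text \<open>The derivative in the direction \<open>e\<^sub>j\<close> is \<open>\<partial>/\<partial>z\<^sup>j\<close>.\<close>

definition pd :: "quat \<Rightarrow> qfun \<Rightarrow> qfun"
  where "pd e f Z = (\<chi> i. deriv (\<lambda>w. f (Z + mscale w e) $ i) 0)"

definition nabla_left :: "qfun \<Rightarrow> qfun"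
  where "nabla_left f Z =
    e0 *v pd e0 f Z - e1 *v pd e1 f Z - e2 *v pd e2 f Z - e3 *v pd e3 f Z"

definition nabla_right :: "qfun \<Rightarrow> qfun"
  where "nabla_right g Z =
    pd e0 g Z v* e0 - pd e1 g Z v* e1 - pd e2 g Z v* e2 - pd e3 g Z v* e3"

definition laplacian :: "qfun \<Rightarrow> qfun"
  where "laplacian f Z =
    pd e0 (pd e0 f) Z + pd e1 (pd e1 f) Z + pd e2 (pd e2 f) Z + pd e3 (pd e3 f) Z"

definition \<U> :: "qfun set"
  where "\<U> = {f. (\<forall>i. (\<lambda>Z. f Z $ i) \<in> laurent) \<and>
    (\<forall>Z. N Z \<noteq> 0 \<longrightarrow> nabla_left (laplacian f) Z = 0)}"

definition \<U>' :: "qfun set"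
  where "\<U>' = {g. (\<forall>i. (\<lambda>Z. g Z $ i) \<in> laurent) \<and>
    (\<forall>Z. N Z \<noteq> 0 \<longrightarrow> nabla_right (laplacian g) Z = 0)}"

definition homogeneous :: "int \<Rightarrow> qfun \<Rightarrow> bool"
  where "homogeneous d f \<longleftrightarrow>
    (\<forall>c Z. c \<noteq> 0 \<longrightarrow> N Z \<noteq> 0 \<longrightarrow> f (mscale c Z) = (c powi d) *s f Z)"

definition \<U>_deg :: "int \<Rightarrow> qfun set"
  where "\<U>_deg d = {f \<in> \<U>. homogeneous d f}"

definition \<U>'_deg :: "int \<Rightarrow> qfun set"
  where "\<U>'_deg d = {g \<in> \<U>'. homogeneous d g}"


section \<open>The actions of \<open>gl(2, H\<^sub>C)\<close>\<close>

text \<open>\<open>2 \<times> 2\<close> matrices over \<open>H\<^sub>C\<close> are \<open>4 \<times> 4\<close> complex matrices in block form.\<close>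

type_synonym quat2 = "complex^(2+2)^(2+2)"

definition block11 :: "quat2 \<Rightarrow> quat" where "block11 h = (\<chi> i j. h $ Inl i $ Inl j)"
definition block12 :: "quat2 \<Rightarrow> quat" where "block12 h = (\<chi> i j. h $ Inl i $ Inr j)"
definition block21 :: "quat2 \<Rightarrow> quat" where "block21 h = (\<chi> i j. h $ Inr i $ Inl j)"
definition block22 :: "quat2 \<Rightarrow> quat" where "block22 h = (\<chi> i j. h $ Inr i $ Inr j)"

definition block_diag :: "quat \<Rightarrow> quat \<Rightarrow> quat2"
  where "block_diag A D = (\<chi> i j. case (i, j) of
      (Inl p, Inl q) \<Rightarrow> A $ p $ q
    | (Inr p, Inr q) \<Rightarrow> D $ p $ q
    | _ \<Rightarrow> 0)"

definition \<pi>\<^sub>l :: "quat2 \<Rightarrow> qfun \<Rightarrow> qfun"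
  where "\<pi>\<^sub>l h f Z =
    (let a' = block11 h; b' = block12 h; c' = block21 h; d' = block22 h; q = a' - Z ** c'
     in mscale (1 / N q) q *v f (matrix_inv q ** (- b' + Z ** d')))"

definition \<pi>\<^sub>r :: "quat2 \<Rightarrow> qfun \<Rightarrow> qfun"
  where "\<pi>\<^sub>r h g Z =
    (let k = matrix_inv h; a = block11 k; b = block12 k; c = block21 k; d = block22 k;
         q = c ** Z + d
     in g ((a ** Z + b) ** matrix_inv q) v* mscale (1 / N q) q)"

text \<open>
  For fixed \<open>Z\<close> with \<open>N Z \<noteq> 0\<close>, the differential of \<open>h \<mapsto> (\<pi> h f) Z\<close> at \<open>h = 1\<close>
  is evaluated at \<open>X\<close> along the line \<open>1 + w X\<close>.
\<close>

definition differentiated :: "(quat2 \<Rightarrow> qfun \<Rightarrow> qfun) \<Rightarrow> quat2 \<Rightarrow> qfun \<Rightarrow> qfun"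
  where "differentiated \<pi> X f =
    on_inv (\<lambda>Z. \<chi> i. deriv (\<lambda>w. \<pi> (mat 1 + mscale w X) f Z $ i) 0)"

definition sl2 :: "quat set"
  where "sl2 = {A. qRe A = 0}"

definition submodule :: "(quat2 \<Rightarrow> qfun \<Rightarrow> qfun) \<Rightarrow> qfun set \<Rightarrow> bool"
  where "submodule \<rho> W \<longleftrightarrow> qfun.subspace W \<and>
    (\<forall>A\<in>sl2. \<forall>D\<in>sl2. \<forall>f\<in>W. \<rho> (block_diag A D) f \<in> W)"


section \<open>The irreducible modules \<open>V\<^sub>l\<close>\<close>

text \<open>
  \<open>V\<^sub>l\<close> is realised as the \<open>2l\<close>-th symmetric power of the standard representation: \<open>c\<close>
  stands for the binary form \<open>\<Sum>k. c k x\<^sup>2\<^sup>l\<^sup>-\<^sup>k y\<^sup>k\<close>, and \<open>A\<close> acts as the derivation with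
  \<open>x \<mapsto> A\<^sub>1\<^sub>1 x + A\<^sub>2\<^sub>1 y\<close> and \<open>y \<mapsto> A\<^sub>1\<^sub>2 x + A\<^sub>2\<^sub>2 y\<close>.  For \<open>l < 0\<close> this is the zero module.
  The lemmas below show that for \<open>2l \<in> \<nat>\<close> it is irreducible of dimension \<open>2l + 1\<close>.
\<close>

definition V :: "real \<Rightarrow> (nat \<Rightarrow> complex) set"
  where "V l = {c. \<forall>k. real k > 2 * l \<longrightarrow> c k = 0}"

definition V_act :: "real \<Rightarrow> quat \<Rightarrow> (nat \<Rightarrow> complex) \<Rightarrow> nat \<Rightarrow> complex"
  where "V_act l A c k =
    (of_real (2 * l - real k) * A$1$1 + of_nat k * A$2$2) * c k
    + (if k = 0 then 0 else of_real (2 * l - real k + 1) * A$2$1 * c (k - 1))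
    + of_nat (k + 1) * A$1$2 * c (k + 1)"

definition cscale :: "complex \<Rightarrow> (nat \<Rightarrow> complex) \<Rightarrow> nat \<Rightarrow> complex"
  where "cscale a c = (\<lambda>k. a * c k)"

global_interpretation cfun: vector_space cscale
  by standard (auto simp: cscale_def fun_eq_iff algebra_simps)

lemma V_negative: "l < 0 \<Longrightarrow> V l = {0}"
  by (auto simp: V_def fun_eq_iff)

lemma V_subspace: "cfun.subspace (V l)"
  by (auto simp: cfun.subspace_def V_def cscale_def)

lemma V_act_closed:
  assumes "2 * l \<in> \<nat>" "c \<in> V l"
  shows "V_act l A c \<in> V l"
proof -
  obtain L where L: "2 * l = real L" using assms(1) by (auto elim: Nats_cases)
  have c: "c k = 0" if "k > L" for k using assms(2) that by (auto simp: V_def L)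
  have "V_act l A c k = 0" if "k > L" for k
  proof (cases "k = L + 1")
    case True
    then show ?thesis by (simp add: V_act_def c L)
  next
    case False
    with that have "k - 1 > L" by simp
    then show ?thesis using that by (simp add: V_act_def c)
  qed
  then show ?thesis by (simp add: V_def L)
qed

lemma V_act_linear:
  "V_act l A (c + d) = V_act l A c + V_act l A d"
  "V_act l A (cscale a c) = cscale a (V_act l A c)"
  "V_act l (A + B) c = V_act l A c + V_act l B c"
  "V_act l (mscale a A) c = cscale a (V_act l A c)"
  by (auto simp: V_act_def fun_eq_iff cscale_def mscale_def algebra_simps)

lemma V_act_bracket:
  "V_act l (A ** B - B ** A) c = V_act l A (V_act l B c) - V_act l B (V_act l A c)"
proof
  fix k :: nat
  have [simp]: "(\<Sum>i\<in>UNIV. f i) = f 1 + f 2" for f :: "2 \<Rightarrow> complex" by (rule sum_2)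
  consider "k = 0" | "k = 1" | j where "k = j + 2"
    by (cases k; cases "k - 1") auto
  then show "V_act l (A ** B - B ** A) c k = (V_act l A (V_act l B c) - V_act l B (V_act l A c)) k"
    by cases (simp_all add: V_act_def matrix_matrix_mult_def algebra_simps)
qed

definition V_basis :: "nat \<Rightarrow> nat \<Rightarrow> complex"
  where "V_basis i = (\<lambda>k. if k = i then 1 else 0)"

lemma V_basis_expansion:
  assumes "\<And>k. k > L \<Longrightarrow> c k = 0"
  shows "c = (\<Sum>i\<le>L. cscale (c i) (V_basis i))"
proof -
  have *: "(\<Sum>i\<in>S. cscale (c i) (V_basis i)) k = (if k \<in> S then c k else 0)"
    if "finite S" for S k
    using that by (induction S) (auto simp: cscale_def V_basis_def)
  show ?thesis
    by (rule ext) (use assms in \<open>auto simp: *\<close>)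
qed

lemma V_dim:
  assumes L: "2 * l = real L"
  shows "cfun.dim (V l) = L + 1"
proof -
  have inj: "inj V_basis"
    by (rule injI) (metis V_basis_def zero_neq_one)
  have sub: "V_basis ` {..L} \<subseteq> V l"
    by (auto simp: V_basis_def V_def L)
  have *: "(\<Sum>i\<in>S. cscale (u i) (V_basis i)) k = (if k \<in> S then u k else 0)"
    if "finite S" for S u k
    using that by (induction S) (auto simp: cscale_def V_basis_def)
  have indep: "cfun.independent (V_basis ` {..L})"
  proof (rule cfun.independent_if_scalars_zero)
    fix f x
    assume s: "(\<Sum>x\<in>V_basis ` {..L}. cscale (f x) x) = 0" and x: "x \<in> V_basis ` {..L}"
    from x obtain k where k: "k \<le> L" "x = V_basis k" by auto
    have "(\<Sum>i\<le>L. cscale (f (V_basis i)) (V_basis i)) = 0"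
      using s by (simp add: sum.reindex inj_on_subset[OF inj])
    then have "(\<Sum>i\<in>{..L}. cscale (f (V_basis i)) (V_basis i)) k = 0"
      by simp
    then show "f x = 0" using k by (subst (asm) *) auto
  qed simp
  have "V l \<subseteq> cfun.span (V_basis ` {..L})"
  proof
    fix c assume "c \<in> V l"
    then have "c = (\<Sum>i\<le>L. cscale (c i) (V_basis i))"
      by (intro V_basis_expansion) (auto simp: V_def L)
    moreover have "(\<Sum>i\<le>L. cscale (c i) (V_basis i)) \<in> cfun.span (V_basis ` {..L})"
      by (intro cfun.span_sum cfun.span_scale cfun.span_base) auto
    ultimately show "c \<in> cfun.span (V_basis ` {..L})" by simp
  qed
  then have "cfun.dim (V l) = card (V_basis ` {..L})"
    using sub indep cfun.dim_unique by blast
  then show ?thesis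
    by (simp add: card_image inj_on_subset[OF inj])
qed

lemma V_irreducible:
  assumes "2 * l \<in> \<nat>" and W: "cfun.subspace W" "W \<subseteq> V l"
    and inv: "\<And>A c. A \<in> sl2 \<Longrightarrow> c \<in> W \<Longrightarrow> V_act l A c \<in> W"
  shows "W = {0} \<or> W = V l"
proof (cases "W \<subseteq> {0}")
  case True
  then show ?thesis using cfun.subspace_0[OF W(1)] by auto
next
  case False
  obtain L where L: "2 * l = real L" using assms(1) by (auto elim: Nats_cases)
  define E F :: quat
    where "E = vector [vector [0, 1], vector [0, 0]]"
      and "F = vector [vector [0, 0], vector [1, 0]]"
  have EF: "E \<in> sl2" "F \<in> sl2"
    by (simp_all add: sl2_def qRe_def trace_def sum_2 E_def F_def)
  have E_act: "V_act l E c k = of_nat (k + 1) * c (k + 1)" for c k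
    by (simp add: V_act_def E_def)
  have F_act: "V_act l F c k = (if k = 0 then 0 else of_real (2 * l - real k + 1) * c (k - 1))" for c k
    by (simp add: V_act_def F_def)
  have unscale: "d \<in> W" if "cscale a d \<in> W" "a \<noteq> 0" for a d
    using cfun.subspace_scale[OF W(1) that(1), of "inverse a"] that(2)
    by simp
  have low: "V_basis 0 \<in> W" if "c \<in> W" "c K \<noteq> 0" "\<And>k. k > K \<Longrightarrow> c k = 0" for c K
    using that
  proof (induction K arbitrary: c)
    case 0
    then have "c = cscale (c 0) (V_basis 0)"
      by (auto simp: fun_eq_iff cscale_def V_basis_def)
    then show ?case using 0 unscale by metis
  next
    case (Suc K)
    show ?case
    proof (rule Suc.IH)
      show "V_act l E c \<in> W" using inv EF Suc.prems by blast
      show "V_act l E c K \<noteq> 0" using Suc.prems(2) of_nat_neq_0[where 'a = complex, of K]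
        by (simp add: E_act)
      show "V_act l E c k = 0" if "k > K" for k using Suc.prems(3) that by (simp add: E_act)
    qed
  qed
  from False obtain c where c: "c \<in> W" "c \<noteq> 0" by auto
  then obtain k0 where k0: "c k0 \<noteq> 0" by (auto simp: fun_eq_iff)
  have bd: "k \<le> L" if "c k \<noteq> 0" for k
  proof (rule ccontr)
    assume "\<not> k \<le> L"
    moreover have "c \<in> V l" using c(1) W(2) by blast
    ultimately show False using that by (simp add: V_def L)
  qed
  define K where "K = (GREATEST k. c k \<noteq> 0)"
  have "c K \<noteq> 0" unfolding K_def using k0 bd by (rule GreatestI_nat)
  moreover have "c k = 0" if "k > K" for k
    using Greatest_le_nat[of "\<lambda>k. c k \<noteq> 0" k L] bd that K_def by force
  ultimately have b0: "V_basis 0 \<in> W" using low c(1) by blast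
  have b: "V_basis k \<in> W" if "k \<le> L" for k
    using that
  proof (induction k)
    case 0 then show ?case using b0 by simp
  next
    case (Suc k)
    have "V_act l F (V_basis k) = cscale (of_real (real L - real k)) (V_basis (Suc k))"
      by (auto simp: fun_eq_iff F_act L cscale_def V_basis_def)
    moreover have "V_act l F (V_basis k) \<in> W" using inv EF Suc by simp
    moreover have "complex_of_real (real L - real k) \<noteq> 0" using Suc.prems by simp
    ultimately show ?case using unscale by metis
  qed
  have "d \<in> W" if "d \<in> V l" for d
  proof -
    have "d = (\<Sum>i\<le>L. cscale (d i) (V_basis i))"
      using that by (intro V_basis_expansion) (auto simp: V_def L)
    moreover have "(\<Sum>i\<le>L. cscale (d i) (V_basis i)) \<in> W"
      using b by (intro cfun.subspace_sum[OF W(1)] cfun.subspace_scale[OF W(1)]) auto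
    ultimately show ?thesis by simp
  qed
  then show ?thesis using W(2) by auto
qed

text \<open>
  \<open>V\<^sub>j \<boxtimes> V\<^sub>k\<close> consists of the coefficient arrays with respect to the products of the two
  monomial bases; \<open>A\<close> acts through the first index and \<open>D\<close> through the second.
\<close>

definition VV :: "real \<Rightarrow> real \<Rightarrow> (nat \<Rightarrow> nat \<Rightarrow> complex) set"
  where "VV j k = {c. (\<forall>q. (\<lambda>p. c p q) \<in> V j) \<and> (\<forall>p. (\<lambda>q. c p q) \<in> V k)}"

definition VV_act ::
    "real \<Rightarrow> real \<Rightarrow> quat \<Rightarrow> quat \<Rightarrow> (nat \<Rightarrow> nat \<Rightarrow> complex) \<Rightarrow> nat \<Rightarrow> nat \<Rightarrow> complex"
  where "VV_act j k A D c p q =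
    V_act j A (\<lambda>p'. c p' q) p + V_act k D (\<lambda>q'. c p q') q"

definition iso_VV :: "(quat2 \<Rightarrow> qfun \<Rightarrow> qfun) \<Rightarrow> qfun set \<Rightarrow> real \<Rightarrow> real \<Rightarrow> bool"
  where "iso_VV \<rho> W j k \<longleftrightarrow> (\<exists>\<phi>. bij_betw \<phi> (VV j k) W \<and>
    (\<forall>c\<in>VV j k. \<forall>d\<in>VV j k. \<phi> (c + d) = \<phi> c + \<phi> d) \<and>
    (\<forall>a. \<forall>c\<in>VV j k. \<phi> (\<lambda>p q. a * c p q) = fscale a (\<phi> c)) \<and>
    (\<forall>A\<in>sl2. \<forall>D\<in>sl2. \<forall>c\<in>VV j k. \<phi> (VV_act j k A D c) = \<rho> (block_diag A D) (\<phi> c)))"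

definition direct_sum3 :: "qfun set \<Rightarrow> qfun set \<Rightarrow> qfun set \<Rightarrow> qfun set \<Rightarrow> bool"
  where "direct_sum3 M W1 W2 W3 \<longleftrightarrow>
    M = {f + g + h | f g h. f \<in> W1 \<and> g \<in> W2 \<and> h \<in> W3} \<and>
    (\<forall>f\<in>W1. \<forall>g\<in>W2. \<forall>h\<in>W3. f + g + h = 0 \<longrightarrow> f = 0 \<and> g = 0 \<and> h = 0)"

text \<open>\<open>M\<close> is the direct sum of submodules \<open>W\<^sub>i \<cong> V\<^bsub>j\<^sub>i\<^esub> \<boxtimes> V\<^bsub>k\<^sub>i\<^esub>\<close>.\<close>

definition components3 :: "(quat2 \<Rightarrow> qfun \<Rightarrow> qfun) \<Rightarrow> qfun set \<Rightarrow>
    real \<times> real \<Rightarrow> real \<times> real \<Rightarrow> real \<times> real \<Rightarrow> qfun set \<Rightarrow> qfun set \<Rightarrow> qfun set \<Rightarrow> bool"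
  where "components3 \<rho> M = (\<lambda>(j1, k1) (j2, k2) (j3, k3) W1 W2 W3.
    submodule \<rho> W1 \<and> submodule \<rho> W2 \<and> submodule \<rho> W3 \<and>
    iso_VV \<rho> W1 j1 k1 \<and> iso_VV \<rho> W2 j2 k2 \<and> iso_VV \<rho> W3 j3 k3 \<and>
    direct_sum3 M W1 W2 W3)"


section \<open>Matrix coefficients and the spanning functions\<close>

text \<open>\<open>a, a + 1, \<dots>, b\<close>\<close>

definition steps :: "real \<Rightarrow> real \<Rightarrow> real set"
  where "steps a b = {x. x - a \<in> \<nat> \<and> x \<le> b}"

text \<open>
  The exponents are integers at half-integral \<open>l, m, n\<close> in range, so the floors are exact there.
\<close>

definition tcoef :: "real \<Rightarrow> real \<Rightarrow> real \<Rightarrow> quat \<Rightarrow> complex"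
  where "tcoef l n m Z =
    (if n \<in> steps (- l) l \<and> m \<in> steps (- l) l
     then 1 / (2 * of_real pi * \<i>) * contour_integral (circlepath 0 1)
       (\<lambda>s. (s * Z$1$1 + Z$2$1) ^ nat \<lfloor>l - m\<rfloor> * (s * Z$1$2 + Z$2$2) ^ nat \<lfloor>l + m\<rfloor>
            * s powi \<lfloor>- l + n\<rfloor> / s)
     else 0)"

definition f1 :: "real \<Rightarrow> real \<Rightarrow> real \<Rightarrow> qfun"
  where "f1 l m n = on_inv (\<lambda>Z. vector [tcoef l (n - 1/2) m Z, - tcoef l (n + 1/2) m Z])"

definition f2 :: "real \<Rightarrow> real \<Rightarrow> real \<Rightarrow> qfun"
  where "f2 l m n = on_inv (\<lambda>Z. vector
    [of_real (l - n + 1/2) * tcoef l (n - 1/2) m Z, of_real (l + n + 1/2) * tcoef l (n + 1/2) m Z])"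

definition f3 :: "real \<Rightarrow> real \<Rightarrow> real \<Rightarrow> qfun"
  where "f3 l m n = on_inv (\<lambda>Z. vector
    [N Z * tcoef (l - 1) (n - 1/2) m Z, - (N Z * tcoef (l - 1) (n + 1/2) m Z)])"

definition g1 :: "real \<Rightarrow> real \<Rightarrow> real \<Rightarrow> qfun"
  where "g1 l m n = on_inv (\<lambda>Z. vector
    [of_real (l + m + 1/2) * tcoef l n (m - 1/2) Z, - (of_real (l - m + 1/2) * tcoef l n (m + 1/2) Z)])"

definition g2 :: "real \<Rightarrow> real \<Rightarrow> real \<Rightarrow> qfun"
  where "g2 l m n = on_inv (\<lambda>Z. vector [tcoef l n (m - 1/2) Z, tcoef l n (m + 1/2) Z])"

definition g3 :: "real \<Rightarrow> real \<Rightarrow> real \<Rightarrow> qfun"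
  where "g3 l m n = on_inv (\<lambda>Z. N Z *s vector
    [of_real (l + m - 1/2) * tcoef (l - 1) n (m - 1/2) Z,
     - (of_real (l - m - 1/2) * tcoef (l - 1) n (m + 1/2) Z)])"

end

theory Submission
  imports Defs
begin

text \<open>
Put \<open>L = 2l\<close>. The function \<open>t\<^sup>l\<^sub>n\<^sub>m\<close> is the coefficient of \<open>s\<^sup>q\<close> in
\<open>(s z\<^sub>1\<^sub>1 + z\<^sub>2\<^sub>1)\<^sup>p (s z\<^sub>1\<^sub>2 + z\<^sub>2\<^sub>2)\<^sup>k\<close> with \<open>p = l - m\<close>, \<open>k = l + m\<close>, \<open>q = l - n\<close>
(\<open>tcoef_eq_tpoly\<close>); all computations are done with these polynomials \<open>tpoly p k q\<close>, of degree
\<open>p + k\<close>, in integral indices.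

The products \<open>N\<^sup>b tpoly p k q\<close> span \<open>\<complex>[z\<^sup>0, z\<^sup>1, z\<^sup>2, z\<^sup>3, N\<^sup>-\<^sup>1]\<close> (\<open>laurent_Nspan\<close>), because
multiplication by a matrix entry is a two-term relation of Clebsch-Gordan type. Hence \<open>\<complex>\<^sup>2\<close>-valued
functions are spanned by two kinds of explicit pairs: those annihilated by \<open>\<nabla>\<close> when \<open>b = 0\<close>, and
complementary ones. On each of these pairs both the dilation of \<open>Z\<close> and the operator
\<open>f \<mapsto> N(Z) Z \<nabla>\<box>f\<close> act by a scalar, and over invertible \<open>Z\<close> the kernel of the latter is \<open>\<U>\<close>. An
operator that is diagonal on a spanning set has its kernel spanned by the members of that set which
it annihilates (\<open>diagonal_kernel\<close>), so \<open>\<U>(2l)\<close> is spanned by the pairs with \<open>2b + deg = 2l\<close>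
and eigenvalue \<open>0\<close>. As \<open>2l \<ge> 0\<close>, these are precisely \<open>f\<^sup>(\<^sup>1\<^sup>)\<close>, \<open>f\<^sup>(\<^sup>2\<^sup>)\<close> (both with \<open>b = 0\<close>) and \<open>f\<^sup>(\<^sup>3\<^sup>)\<close>
(\<open>b = 1\<close>); see \<open>\<U>_deg_eq_span\<close>.

The differential of the group action is \<open>f \<mapsto> A f + X f\<close>, where \<open>X\<close> is the derivation with
\<open>X Z = Z D - A Z\<close>. On each of the three families it acts by ladder relations in the two indices, and
after rescaling by signed factorials these become the action on monomials of binary forms. The torus
weights separate the members of a family, so they are independent and the span of the family is
\<open>V\<^sub>j \<boxtimes> V\<^sub>k\<close> (\<open>family_iso_VV\<close>).

The sum of the two Casimir operators acts on a copy of \<open>V\<^sub>j \<boxtimes> V\<^sub>k\<close> by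
\<open>2j(j + 1) + 2k(k + 1)\<close>. These numbers differ for the nonzero components, which makes the sum of
the three spans direct and shows that any decomposition of the required type consists of the same
three subspaces (\<open>components3_span_iff\<close>). The argument for \<open>\<U>'\<close> is the same, with rows and columns
of \<open>Z\<close> exchanged.
\<close>

section \<open>Matrix coefficients as coefficients of a generating polynomial\<close>

text \<open>
Here \<open>q\<close> is an integer, with the convention that coefficients at negative exponents vanish, so that
the recursions below hold without boundary cases.
\<close>

definition tpoly :: "nat \<Rightarrow> nat \<Rightarrow> int \<Rightarrow> quat \<Rightarrow> complex" where
  "tpoly p k q Z = (if q < 0 then 0
     else coeff ([:Z$2$1, Z$1$1:] ^ p * [:Z$2$2, Z$1$2:] ^ k) (nat q))"

lemma coeff_linear_mult:
  fixes P :: "complex poly"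
    and q :: int
  shows "(if q < 0 then 0 else coeff ([:a, b:] * P) (nat q)) =
     a * (if q < 0 then 0 else coeff P (nat q)) +
     b * (if q - 1 < 0 then 0 else coeff P (nat (q - 1)))"
proof (cases "q \<le> 0")
  case True
  then show ?thesis by (cases "q = 0") auto
next
  case False
  then obtain n where "q = int (Suc n)" by (metis not_le zero_less_imp_eq_int gr0_implies_Suc)
  then show ?thesis by (simp add: nat_add_distrib)
qed

lemma tpoly_Suc1: "tpoly (Suc p) k q Z = Z$2$1 * tpoly p k q Z + Z$1$1 * tpoly p k (q - 1) Z"
  unfolding tpoly_def power_Suc mult.assoc by (rule coeff_linear_mult)

lemma tpoly_Suc2: "tpoly p (Suc k) q Z = Z$2$2 * tpoly p k q Z + Z$1$2 * tpoly p k (q - 1) Z"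
  unfolding tpoly_def power_Suc mult.left_commute[of "[:Z$2$1, Z$1$1:] ^ p"]
  by (rule coeff_linear_mult)

lemma tpoly_0: "tpoly 0 0 q Z = (if q = 0 then 1 else 0)"
  by (auto simp: tpoly_def one_pCons coeff_pCons split: nat.splits)

lemma tpoly_eq_0: "q < 0 \<or> q > int (p + k) \<Longrightarrow> tpoly p k q Z = 0"
proof -
  assume q: "q < 0 \<or> q > int (p + k)"
  have "degree ([:Z$2$1, Z$1$1:] ^ p * [:Z$2$2, Z$1$2:] ^ k) \<le> p + k"
    by (intro order.trans[OF degree_mult_le] add_mono order.trans[OF degree_power_le])
      (auto intro: order.trans[OF mult_le_mono1])
  then show ?thesis using q by (auto simp: tpoly_def intro!: coeff_eq_0)
qed

text \<open>
The recursions in \<open>p\<close> and in \<open>k\<close> generate every \<open>tpoly p k q\<close> from \<open>tpoly 0 0 q\<close>.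
\<close>

lemma tpoly_induct [case_names 0 1 2]:
  assumes "P 0 0" "\<And>p k. P p k \<Longrightarrow> P (Suc p) k" "\<And>k. P 0 k \<Longrightarrow> P 0 (Suc k)"
  shows "P p k"
proof (induction p)
  case 0 then show ?case using assms by (induction k) auto
qed (use assms in auto)

text \<open>
The recursions have no signs, so nothing cancels at a matrix with positive entries. This yields a
point at which no coefficient in range vanishes.
\<close>

lemma tpoly_positive:
  assumes Z: "\<And>i j. Z$i$j = of_real (a i j)" and a: "\<And>i j. (a i j :: real) > 0"
  shows "\<exists>r. tpoly p k q Z = of_real r \<and> 0 \<le> r \<and> (0 \<le> q \<and> q \<le> int (p + k) \<longrightarrow> 0 < r)"
proof (induction p k arbitrary: q rule: tpoly_induct)
  case 0
  show ?case by (rule exI[of _ "if q = 0 then 1 else 0"]) (auto simp: tpoly_0)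
next
  have step: "0 \<le> a i j * r + a i' j' * r' \<and> (0 \<le> q \<and> q \<le> int n + 1 \<longrightarrow> 0 < a i j * r + a i' j' * r')"
    if "0 \<le> r \<and> (0 \<le> q \<and> q \<le> int n \<longrightarrow> 0 < r)" "0 \<le> r' \<and> (0 \<le> q - 1 \<and> q - 1 \<le> int n \<longrightarrow> 0 < r')"
    for i j i' j' r r' q n
    using that a[of i j] a[of i' j']
    by (cases "q = 0") (auto intro: add_pos_nonneg add_nonneg_pos)
  {
    case (1 p k)
    obtain r r' where r: "tpoly p k q Z = of_real r" "0 \<le> r \<and> (0 \<le> q \<and> q \<le> int (p + k) \<longrightarrow> 0 < r)"
      and r': "tpoly p k (q - 1) Z = of_real r'" "0 \<le> r' \<and> (0 \<le> q - 1 \<and> q - 1 \<le> int (p + k) \<longrightarrow> 0 < r')"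
      using 1[of q] 1[of "q - 1"] by blast
    from step[OF r(2) r'(2), of 2 1 1 1] show ?case
      by (intro exI[of _ "a 2 1 * r + a 1 1 * r'"]) (simp add: tpoly_Suc1 Z r(1) r'(1) algebra_simps)
  next
    case (2 k)
    obtain r r' where r: "tpoly 0 k q Z = of_real r" "0 \<le> r \<and> (0 \<le> q \<and> q \<le> int (0 + k) \<longrightarrow> 0 < r)"
      and r': "tpoly 0 k (q - 1) Z = of_real r'" "0 \<le> r' \<and> (0 \<le> q - 1 \<and> q - 1 \<le> int (0 + k) \<longrightarrow> 0 < r')"
      using 2[of q] 2[of "q - 1"] by blast
    from step[OF r(2) r'(2), of 2 2 1 2] show ?case
      by (intro exI[of _ "a 2 2 * r + a 1 2 * r'"]) (simp add: tpoly_Suc2 Z r(1) r'(1) algebra_simps)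
  }
qed

text \<open>
Euler's relation for the first row: \<open>tpoly p k q\<close> is homogeneous of degree \<open>q\<close> in
\<open>(z\<^sub>1\<^sub>1, z\<^sub>1\<^sub>2)\<close>. Its partial derivatives with respect to \<open>z\<^sub>1\<^sub>1\<close> and \<open>z\<^sub>1\<^sub>2\<close> are the two factors on the
right.
\<close>

lemma tpoly_row1: 
  "of_int q * tpoly p k q Z = Z$1$1 * (of_nat p * tpoly (p - 1) k (q - 1) Z)
     + Z$1$2 * (of_nat k * tpoly p (k - 1) (q - 1) Z)"
proof (induction p k arbitrary: q rule: tpoly_induct)
  case 0
  then show ?case by (simp add: tpoly_0)
next
  case (1 p k)
  have *: "of_nat p * tpoly p k q' Z = of_nat p * (Z$2$1 * tpoly (p - 1) k q' Z + Z$1$1 * tpoly (p - 1) k (q' - 1) Z)" for q'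
    by (cases p) (simp_all add: tpoly_Suc1)
  have a: "of_int q * tpoly p k q Z = Z$1$1 * (of_nat p * tpoly (p - 1) k (q - 1) Z)
     + Z$1$2 * (of_nat k * tpoly p (k - 1) (q - 1) Z)" by (rule 1)
  have b: "of_int (q-1) * tpoly p k (q-1) Z = Z$1$1 * (of_nat p * tpoly (p - 1) k (q - 1 - 1) Z)
     + Z$1$2 * (of_nat k * tpoly p (k - 1) (q - 1 - 1) Z)" by (rule 1)
  have "of_int q * tpoly (Suc p) k q Z = Z$2$1 * (of_int q * tpoly p k q Z) + Z$1$1 * (of_int (q-1) * tpoly p k (q-1) Z)
     + Z$1$1 * tpoly p k (q-1) Z" by (simp add: tpoly_Suc1 algebra_simps)
  also have "\<dots> = Z$1$1 * (of_nat (Suc p) * tpoly p k (q - 1) Z)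
     + Z$1$2 * (of_nat k * tpoly (Suc p) (k - 1) (q - 1) Z)"
    unfolding a b using *[of "q-1"] by (simp add: tpoly_Suc1 algebra_simps)
  finally show ?case by simp
next
  case (2 k)
  have *: "of_nat k * tpoly 0 k q' Z = of_nat k * (Z$2$2 * tpoly 0 (k - 1) q' Z + Z$1$2 * tpoly 0 (k - 1) (q' - 1) Z)" for q'
    by (cases k) (simp_all add: tpoly_Suc2)
  have a: "of_int q * tpoly 0 k q Z = Z$1$2 * (of_nat k * tpoly 0 (k - 1) (q - 1) Z)" using 2 by simp
  have b: "of_int (q-1) * tpoly 0 k (q-1) Z = Z$1$2 * (of_nat k * tpoly 0 (k - 1) (q - 1 - 1) Z)" using 2[of "q-1"] by simp
  have "of_int q * tpoly 0 (Suc k) q Z = Z$2$2 * (of_int q * tpoly 0 k q Z) + Z$1$2 * (of_int (q-1) * tpoly 0 k (q-1) Z)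
     + Z$1$2 * tpoly 0 k (q-1) Z" by (simp add: tpoly_Suc2 algebra_simps)
  also have "\<dots> = Z$1$2 * (of_nat (Suc k) * tpoly 0 k (q - 1) Z)"
    unfolding a b using *[of "q-1"] by (simp add: tpoly_Suc2 algebra_simps)
  finally show ?case by simp
qed

text \<open>
The factor \<open>p\<close> makes the recursion valid for \<open>p = 0\<close> as well; this is Euler's relation for the
first column.
\<close>

lemma tpoly_col1: "of_nat p * tpoly p k q Z = of_nat p * (Z$2$1 * tpoly (p - 1) k q Z + Z$1$1 * tpoly (p - 1) k (q - 1) Z)"
  by (cases p) (simp_all add: tpoly_Suc1)

lemma tpoly_col2: "of_nat k * tpoly p k q Z = of_nat k * (Z$2$2 * tpoly p (k - 1) q Z + Z$1$2 * tpoly p (k - 1) (q - 1) Z)"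
  by (cases k) (simp_all add: tpoly_Suc2)

lemma tpoly_row2: 
  "of_int (int (p + k) - q) * tpoly p k q Z = Z$2$1 * (of_nat p * tpoly (p - 1) k q Z)
     + Z$2$2 * (of_nat k * tpoly p (k - 1) q Z)"
proof -
  have "of_int (int (p + k) - q) * tpoly p k q Z = of_nat p * tpoly p k q Z + of_nat k * tpoly p k q Z - of_int q * tpoly p k q Z"
    by (simp add: algebra_simps)
  also have "\<dots> = Z$2$1 * (of_nat p * tpoly (p - 1) k q Z) + Z$2$2 * (of_nat k * tpoly p (k - 1) q Z)"
    unfolding tpoly_row1 tpoly_col1[of p k] tpoly_col2[of k p] by (simp add: algebra_simps)
  finally show ?thesis .
qed

lemma N_eq: "N Z = Z$1$1 * Z$2$2 - Z$1$2 * Z$2$1"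
  by (rule det_2)

text \<open>
With \<open>2l = p + k\<close>, only the components \<open>V\<^sub>l\<^sub>+\<^sub>1\<^sub>/\<^sub>2 \<boxtimes> V\<^sub>l\<^sub>+\<^sub>1\<^sub>/\<^sub>2\<close> and \<open>V\<^sub>l\<^sub>-\<^sub>1\<^sub>/\<^sub>2 \<boxtimes> V\<^sub>l\<^sub>-\<^sub>1\<^sub>/\<^sub>2\<close> occur in the products of
matrix entries with the \<open>tpoly p k q\<close>; \<open>N\<close> makes up for the lower degree of the latter. Each formula combines Euler's relation for one row with the identities
\<open>N = z\<^sub>1\<^sub>1 y - z\<^sub>1\<^sub>2 x\<close> and \<open>s N = z\<^sub>2\<^sub>2 x - z\<^sub>2\<^sub>1 y\<close> for \<open>x = s z\<^sub>1\<^sub>1 + z\<^sub>2\<^sub>1\<close>, \<open>y = s z\<^sub>1\<^sub>2 + z\<^sub>2\<^sub>2\<close>.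
\<close>

lemma tpoly_mult_11:
  "of_nat (p + k + 1) * (Z$1$1 * tpoly p k q Z) =
     of_int (q + 1) * tpoly (Suc p) k (q + 1) Z + of_nat k * (N Z * tpoly p (k - 1) q Z)"
  unfolding tpoly_row1 N_eq by (cases k) (simp_all add: tpoly_Suc1 tpoly_Suc2 algebra_simps)

lemma tpoly_mult_12:
  "of_nat (p + k + 1) * (Z$1$2 * tpoly p k q Z) =
     of_int (q + 1) * tpoly p (Suc k) (q + 1) Z - of_nat p * (N Z * tpoly (p - 1) k q Z)"
  unfolding tpoly_row1 N_eq by (cases p) (simp_all add: tpoly_Suc1 tpoly_Suc2 algebra_simps)

lemma tpoly_mult_21:
  "of_nat (p + k + 1) * (Z$2$1 * tpoly p k q Z) =
     of_int (int (p + k + 1) - q) * tpoly (Suc p) k q Z - of_nat k * (N Z * tpoly p (k - 1) (q - 1) Z)"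
proof -
  have "of_int (int (p + k + 1) - q) * tpoly (Suc p) k q Z = of_int (int (Suc p + k) - q) * tpoly (Suc p) k q Z" by simp
  then show ?thesis
  unfolding tpoly_row2 N_eq by (cases k) (simp_all add: tpoly_Suc1 tpoly_Suc2 algebra_simps)
qed

lemma tpoly_mult_22:
  "of_nat (p + k + 1) * (Z$2$2 * tpoly p k q Z) =
     of_int (int (p + k + 1) - q) * tpoly p (Suc k) q Z + of_nat p * (N Z * tpoly (p - 1) k (q - 1) Z)"
proof -
  have "of_int (int (p + k + 1) - q) * tpoly p (Suc k) q Z = of_int (int (p + Suc k) - q) * tpoly p (Suc k) q Z" by simp
  then show ?thesis
  unfolding tpoly_row2 N_eq by (cases p) (simp_all add: tpoly_Suc1 tpoly_Suc2 algebra_simps)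
qed

section \<open>Gradients on the invertible matrices\<close>

text \<open>
Complex differentiability, tested on all curves through \<open>Z\<close>: straight lines give the partial
derivatives, and the orbits of the group action give the infinitesimal action.
\<close>

definition has_grad :: "(quat \<Rightarrow> complex) \<Rightarrow> quat \<Rightarrow> (2 \<Rightarrow> 2 \<Rightarrow> complex) \<Rightarrow> bool" where
  "has_grad F Z d \<longleftrightarrow> (\<forall>\<gamma> h. \<gamma> 0 = Z \<longrightarrow>
     (\<forall>i j. ((\<lambda>w. \<gamma> w $ i $ j) has_field_derivative h i j) (at 0)) \<longrightarrow>
     ((\<lambda>w. F (\<gamma> w)) has_field_derivative (\<Sum>i\<in>UNIV. \<Sum>j\<in>UNIV. h i j * d i j)) (at 0))"

lemma has_gradD:
  assumes "has_grad F Z d" "\<gamma> 0 = Z" "\<And>i j. ((\<lambda>w. \<gamma> w $ i $ j) has_field_derivative h i j) (at 0)"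
  shows "((\<lambda>w. F (\<gamma> w)) has_field_derivative (\<Sum>i\<in>UNIV. \<Sum>j\<in>UNIV. h i j * d i j)) (at 0)"
  using assms unfolding has_grad_def by blast

lemma has_grad_const: "has_grad (\<lambda>_. c) Z (\<lambda>_ _. 0)"
  by (auto simp: has_grad_def)

lemma has_grad_entry: "has_grad (\<lambda>Z. Z $ a $ b) Z (\<lambda>i j. if i = a \<and> j = b then 1 else 0)"
proof -
  have "(\<Sum>i\<in>UNIV. \<Sum>j\<in>UNIV. h i j * (if i = a \<and> j = b then 1 else 0)) = h a b" for h :: "2 \<Rightarrow> 2 \<Rightarrow> complex"
    by (simp add: sum_2) (metis exhaust_2)
  then show ?thesis by (simp add: has_grad_def)
qed

lemma has_grad_add:
  assumes "has_grad F Z d" "has_grad G Z e"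
  shows "has_grad (\<lambda>Z. F Z + G Z) Z (\<lambda>i j. d i j + e i j)"
  unfolding has_grad_def
proof (intro allI impI)
  fix \<gamma> and h :: "2 \<Rightarrow> 2 \<Rightarrow> complex"
  assume \<gamma>: "\<gamma> 0 = Z" "\<forall>i j. ((\<lambda>w. \<gamma> w $ i $ j) has_field_derivative h i j) (at 0)"
  show "((\<lambda>w. F (\<gamma> w) + G (\<gamma> w)) has_field_derivative
      (\<Sum>i\<in>UNIV. \<Sum>j\<in>UNIV. h i j * (d i j + e i j))) (at 0)"
    using DERIV_add[OF has_gradD[where \<gamma> = \<gamma> and h = h, OF assms(1) \<gamma>(1)]
      has_gradD[where \<gamma> = \<gamma> and h = h, OF assms(2) \<gamma>(1)]] \<gamma>(2)
    by (simp add: ring_distribs sum.distrib)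
qed

lemma has_grad_mult:
  assumes "has_grad F Z d" "has_grad G Z e"
  shows "has_grad (\<lambda>Z. F Z * G Z) Z (\<lambda>i j. d i j * G Z + F Z * e i j)"
  unfolding has_grad_def
proof (intro allI impI)
  fix \<gamma> and h :: "2 \<Rightarrow> 2 \<Rightarrow> complex"
  assume \<gamma>: "\<gamma> 0 = Z" "\<forall>i j. ((\<lambda>w. \<gamma> w $ i $ j) has_field_derivative h i j) (at 0)"
  have "(\<Sum>i\<in>UNIV. \<Sum>j\<in>UNIV. h i j * d i j) * G Z + (\<Sum>i\<in>UNIV. \<Sum>j\<in>UNIV. h i j * e i j) * F Z
     = (\<Sum>i\<in>UNIV. \<Sum>j\<in>UNIV. h i j * (d i j * G Z + F Z * e i j))"
    by (simp add: sum_2 algebra_simps)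
  with DERIV_mult[OF has_gradD[where \<gamma> = \<gamma> and h = h, OF assms(1) \<gamma>(1)]
      has_gradD[where \<gamma> = \<gamma> and h = h, OF assms(2) \<gamma>(1)]] \<gamma>
  show "((\<lambda>w. F (\<gamma> w) * G (\<gamma> w)) has_field_derivative
      (\<Sum>i\<in>UNIV. \<Sum>j\<in>UNIV. h i j * (d i j * G Z + F Z * e i j))) (at 0)"
    by simp
qed

lemma has_grad_cong:
  assumes "has_grad F Z d" "\<And>i j. d i j = e i j"
  shows "has_grad F Z e"
  using assms by (simp add: has_grad_def)

lemma has_grad_cmult: "has_grad F Z d \<Longrightarrow> has_grad (\<lambda>Z. c * F Z) Z (\<lambda>i j. c * d i j)"
  by (rule has_grad_cong[OF has_grad_mult[OF has_grad_const]]) auto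

text \<open>
The gradient of the determinant.
\<close>

definition cofactor :: "quat \<Rightarrow> 2 \<Rightarrow> 2 \<Rightarrow> complex" where
  "cofactor Z i j = (if i = 1 then (if j = 1 then Z$2$2 else - Z$2$1) else (if j = 1 then - Z$1$2 else Z$1$1))"

lemma has_grad_N: "has_grad N Z (cofactor Z)"
proof -
  have "has_grad (\<lambda>Z. Z$1$1 * Z$2$2 + (- 1) * (Z$1$2 * Z$2$1)) Z (cofactor Z)"
    by (rule has_grad_cong[OF has_grad_add[OF has_grad_mult[OF has_grad_entry has_grad_entry]
          has_grad_cmult[OF has_grad_mult[OF has_grad_entry has_grad_entry]]]])
      (use exhaust_2 in \<open>auto simp: cofactor_def\<close>)
  moreover have "(\<lambda>Z. Z$1$1 * Z$2$2 + (- 1) * (Z$1$2 * Z$2$1)) = N"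
    by (simp add: fun_eq_iff det_2)
  ultimately show ?thesis by metis
qed

text \<open>
A curve stays among the invertible matrices for small times, so values at singular matrices do not
affect derivatives.
\<close>

lemma eventually_invertible:
  fixes \<gamma> :: "complex \<Rightarrow> quat"
  assumes "N (\<gamma> 0) \<noteq> 0" "\<And>i j. ((\<lambda>w. \<gamma> w $ i $ j) has_field_derivative h i j) (at 0)"
  shows "eventually (\<lambda>w. N (\<gamma> w) \<noteq> 0) (nhds 0)"
proof -
  have "isCont (\<lambda>w. N (\<gamma> w)) 0"
    using has_gradD[OF has_grad_N refl assms(2)] by (rule DERIV_isCont)
  then have "((\<lambda>w. N (\<gamma> w)) \<longlongrightarrow> N (\<gamma> 0)) (nhds 0)"
    by (simp add: continuous_at tendsto_nhds_iff)
  then show ?thesis using assms(1) by (rule tendsto_imp_eventually_ne)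
qed

lemma has_grad_on_inv:
  assumes "has_grad F Z d" "N Z \<noteq> 0"
  shows "has_grad (on_inv F) Z d"
  unfolding has_grad_def
proof (intro allI impI)
  fix \<gamma> and h :: "2 \<Rightarrow> 2 \<Rightarrow> complex"
  assume \<gamma>: "\<gamma> 0 = Z" "\<forall>i j. ((\<lambda>w. \<gamma> w $ i $ j) has_field_derivative h i j) (at 0)"
  have "eventually (\<lambda>w. N (\<gamma> w) \<noteq> 0) (nhds 0)"
    by (rule eventually_invertible) (use \<gamma> assms in auto)
  then have ev: "eventually (\<lambda>w. on_inv F (\<gamma> w) = F (\<gamma> w)) (nhds 0)"
    by eventually_elim (simp add: on_inv_def)
  show "((\<lambda>w. on_inv F (\<gamma> w)) has_field_derivative (\<Sum>i\<in>UNIV. \<Sum>j\<in>UNIV. h i j * d i j)) (at 0)"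
    by (subst DERIV_cong_ev[OF refl ev refl]) (use has_gradD assms \<gamma> in blast)
qed

lemma has_grad_N_power:
  assumes "N Z \<noteq> 0"
  shows "has_grad (\<lambda>Z. N Z powi n) Z (\<lambda>i j. of_int n * N Z powi (n - 1) * cofactor Z i j)"
  unfolding has_grad_def
proof (intro allI impI)
  fix \<gamma> and h :: "2 \<Rightarrow> 2 \<Rightarrow> complex"
  assume \<gamma>: "\<gamma> 0 = Z" "\<forall>i j. ((\<lambda>w. \<gamma> w $ i $ j) has_field_derivative h i j) (at 0)"
  show "((\<lambda>w. N (\<gamma> w) powi n) has_field_derivative
      (\<Sum>i\<in>UNIV. \<Sum>j\<in>UNIV. h i j * (of_int n * N Z powi (n - 1) * cofactor Z i j))) (at 0)"
    using DERIV_power_int[OF has_gradD[where \<gamma> = \<gamma> and h = h, OF has_grad_N \<gamma>(1)], of n] \<gamma> assms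
    by (simp add: sum_2 algebra_simps)
qed

definition tpoly_grad :: "nat \<Rightarrow> nat \<Rightarrow> int \<Rightarrow> quat \<Rightarrow> 2 \<Rightarrow> 2 \<Rightarrow> complex" where
  "tpoly_grad p k q Z i j = (let q' = (if i = 1 then q - 1 else q) in
     if j = 1 then of_nat p * tpoly (p - 1) k q' Z else of_nat k * tpoly p (k - 1) q' Z)"

text \<open>
Both recursions are linear in the matrix entries, so the gradient follows by induction.
\<close>

lemma has_grad_tpoly: "has_grad (tpoly p k q) Z (tpoly_grad p k q Z)"
proof (induction p k arbitrary: q rule: tpoly_induct)
  case 0
  have "tpoly 0 0 q = (\<lambda>_. if q = 0 then 1 else 0)" by (auto simp: tpoly_0)
  then show ?case
    by (auto intro!: has_grad_cong[OF has_grad_const] simp: tpoly_grad_def)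
next
  case (1 p k)
  have e: "tpoly (Suc p) k q = (\<lambda>Z. Z$2$1 * tpoly p k q Z + Z$1$1 * tpoly p k (q - 1) Z)" for q
    by (simp add: fun_eq_iff tpoly_Suc1)
  show ?case unfolding e
  proof (rule has_grad_cong[OF has_grad_add[OF has_grad_mult[OF has_grad_entry 1]
          has_grad_mult[OF has_grad_entry 1]]])
    fix i j :: 2
    show "(if i = 2 \<and> j = 1 then 1 else 0) * tpoly p k q Z + Z $ 2 $ 1 * tpoly_grad p k q Z i j +
           ((if i = 1 \<and> j = 1 then 1 else 0) * tpoly p k (q - 1) Z + Z $ 1 $ 1 * tpoly_grad p k (q - 1) Z i j) =
           tpoly_grad (Suc p) k q Z i j"
      using exhaust_2[of i] exhaust_2[of j] tpoly_col1[of p k q Z] tpoly_col1[of p k "q-1" Z]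
      by (auto simp: tpoly_grad_def Let_def tpoly_Suc1 algebra_simps)
  qed
next
  case (2 k)
  have e: "tpoly 0 (Suc k) q = (\<lambda>Z. Z$2$2 * tpoly 0 k q Z + Z$1$2 * tpoly 0 k (q - 1) Z)" for q
    by (simp add: fun_eq_iff tpoly_Suc2)
  show ?case unfolding e
  proof (rule has_grad_cong[OF has_grad_add[OF has_grad_mult[OF has_grad_entry 2]
          has_grad_mult[OF has_grad_entry 2]]])
    fix i j :: 2
    show "(if i = 2 \<and> j = 2 then 1 else 0) * tpoly 0 k q Z + Z $ 2 $ 2 * tpoly_grad 0 k q Z i j +
           ((if i = 1 \<and> j = 2 then 1 else 0) * tpoly 0 k (q - 1) Z + Z $ 1 $ 2 * tpoly_grad 0 k (q - 1) Z i j) =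
           tpoly_grad 0 (Suc k) q Z i j"
      using exhaust_2[of i] exhaust_2[of j] tpoly_col2[of k 0 q Z] tpoly_col2[of k 0 "q-1" Z]
      by (auto simp: tpoly_grad_def Let_def tpoly_Suc2 algebra_simps)
  qed
qed

definition matrix_unit :: "2 \<Rightarrow> 2 \<Rightarrow> quat" where
  "matrix_unit a b = (\<chi> i j. if i = a \<and> j = b then 1 else 0)"

definition pdv :: "2 \<Rightarrow> 2 \<Rightarrow> (quat \<Rightarrow> complex) \<Rightarrow> quat \<Rightarrow> complex" where
  "pdv a b F = on_inv (\<lambda>Z. deriv (\<lambda>w. F (Z + mscale w (matrix_unit a b))) 0)"

lemma line_deriv:
  "((\<lambda>w. (Z + mscale w H) $ i $ j) has_field_derivative H $ i $ j) (at 0)"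
  by (auto simp: mscale_def intro!: derivative_eq_intros)

lemma line_0: "Z + mscale 0 H = Z"
  by (simp add: mscale_def vec_eq_iff)

lemma has_grad_line:
  assumes "has_grad F Z d"
  shows "deriv (\<lambda>w. F (Z + mscale w H)) 0 = (\<Sum>i\<in>UNIV. \<Sum>j\<in>UNIV. H $ i $ j * d i j)"
  by (rule DERIV_imp_deriv, rule has_gradD[OF assms, where \<gamma> = "\<lambda>w. Z + mscale w H"])
     (simp_all add: line_0 line_deriv del: vector_add_component)

lemma pdv_eq:
  assumes "has_grad F Z d" "N Z \<noteq> 0"
  shows "pdv a b F Z = d a b"
proof -
  have "(\<Sum>i\<in>UNIV. \<Sum>j\<in>UNIV. matrix_unit a b $ i $ j * d i j) = d a b"
    using exhaust_2[of a] exhaust_2[of b] by (auto simp: sum_2 matrix_unit_def)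
  then show ?thesis
    by (simp add: pdv_def on_inv_def assms has_grad_line[OF assms(1)])
qed

lemma pdv_outside: "N Z = 0 \<Longrightarrow> pdv a b F Z = 0"
  by (simp add: pdv_def on_inv_def)

lemma laurent_outside: "F \<in> laurent \<Longrightarrow> N Z = 0 \<Longrightarrow> F Z = 0"
  by (induction rule: laurent.induct) (auto simp: on_inv_def)

lemma laurent_cmult: "F \<in> laurent \<Longrightarrow> (\<lambda>Z. c * F Z) \<in> laurent"
proof -
  assume F: "F \<in> laurent"
  then have "(\<lambda>Z. on_inv (\<lambda>_. c) Z * F Z) \<in> laurent" by (intro laurent.mult laurent.const)
  also have "(\<lambda>Z. on_inv (\<lambda>_. c) Z * F Z) = (\<lambda>Z. c * F Z)"
    using laurent_outside[OF F] by (auto simp: fun_eq_iff on_inv_def)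
  finally show ?thesis .
qed

lemma laurent_entry: "on_inv (\<lambda>Z. Z $ a $ b) \<in> laurent"
proof -
  have *: "(\<lambda>Z. c * on_inv u Z + d * on_inv v Z) \<in> laurent"
    if "u \<in> {z0,z1,z2,z3}" "v \<in> {z0,z1,z2,z3}" for c d u v
    using that by (intro laurent.add laurent_cmult laurent.coord)
  have "on_inv (\<lambda>Z. Z $ 1 $ 1) = (\<lambda>Z. 1 * on_inv z0 Z + (- \<i>) * on_inv z3 Z)"
    "on_inv (\<lambda>Z. Z $ 2 $ 2) = (\<lambda>Z. 1 * on_inv z0 Z + \<i> * on_inv z3 Z)"
    "on_inv (\<lambda>Z. Z $ 1 $ 2) = (\<lambda>Z. (- \<i>) * on_inv z1 Z + (-1) * on_inv z2 Z)"
    "on_inv (\<lambda>Z. Z $ 2 $ 1) = (\<lambda>Z. (- \<i>) * on_inv z1 Z + 1 * on_inv z2 Z)"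
    by (auto simp: fun_eq_iff on_inv_def z0_def z1_def z2_def z3_def field_simps)
  moreover have "(a = 1 \<or> a = 2) \<and> (b = 1 \<or> b = 2)" using exhaust_2 by blast
  ultimately show ?thesis
    using *[of z0 z3 1 "- \<i>"] *[of z0 z3 1 \<i>] *[of z1 z2 "- \<i>" "-1"] *[of z1 z2 "- \<i>" 1]
    by (elim conjE disjE) (simp_all only: insert_iff simp_thms)
qed

lemma on_inv_add: "on_inv (\<lambda>Z. F Z + G Z) = (\<lambda>Z. on_inv F Z + on_inv G Z)" for F G :: "quat \<Rightarrow> complex"
  by (auto simp: on_inv_def)
lemma on_inv_mult: "on_inv (\<lambda>Z. F Z * G Z) = (\<lambda>Z. on_inv F Z * on_inv G Z)" for F G :: "quat \<Rightarrow> complex"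
  by (auto simp: on_inv_def)

lemma laurent_tpoly: "on_inv (tpoly p k q) \<in> laurent"
proof (induction p k arbitrary: q rule: tpoly_induct)
  case 0
  have "tpoly 0 0 q = (\<lambda>_. if q = 0 then 1 else 0)" by (auto simp: tpoly_0)
  then show ?case by (simp add: laurent.const)
next
  case (1 p k)
  have e: "tpoly (Suc p) k q = (\<lambda>Z. Z$2$1 * tpoly p k q Z + Z$1$1 * tpoly p k (q - 1) Z)"
    by (simp add: fun_eq_iff tpoly_Suc1)
  show ?case unfolding e on_inv_add on_inv_mult by (intro laurent.add laurent.mult laurent_entry 1)
next
  case (2 k)
  have e: "tpoly 0 (Suc k) q = (\<lambda>Z. Z$2$2 * tpoly 0 k q Z + Z$1$2 * tpoly 0 k (q - 1) Z)"
    by (simp add: fun_eq_iff tpoly_Suc2)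
  show ?case unfolding e on_inv_add on_inv_mult by (intro laurent.add laurent.mult laurent_entry 2)
qed

lemma laurent_N_power: "on_inv (\<lambda>Z. N Z powi n) \<in> laurent"
proof -
  have pow: "on_inv (\<lambda>Z. u Z ^ m) \<in> laurent" if "on_inv u \<in> laurent" for u and m
  proof (induction m)
    case (Suc m)
    then show ?case unfolding power_Suc on_inv_mult using that by (intro laurent.mult)
  qed (simp add: laurent.const)
  have "on_inv (\<lambda>Z. (Z$1$1 * Z$2$2) + (-1) * (Z$1$2 * Z$2$1)) \<in> laurent"
    unfolding on_inv_add on_inv_mult by (intro laurent.add laurent.mult laurent_entry laurent.const)
  moreover have "(\<lambda>Z::quat. (Z$1$1 * Z$2$2) + (-1) * (Z$1$2 * Z$2$1)) = N"
    by (simp add: fun_eq_iff det_2)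
  ultimately have "on_inv N \<in> laurent" by (simp only:)
  then show ?thesis
    using pow[of N "nat n"] pow[OF laurent.N_inverse, of "nat (-n)"]
    by (cases "n \<ge> 0") (simp_all add: power_int_def)
qed

text \<open>
Differentiability and closure under partial differentiation are proved together by induction over
the generation of Laurent polynomials.
\<close>

lemma laurent_has_grad_ex:
  "F \<in> laurent \<Longrightarrow> \<exists>D. (\<forall>i j. D i j \<in> laurent) \<and> (\<forall>Z. N Z \<noteq> 0 \<longrightarrow> has_grad F Z (\<lambda>i j. D i j Z))"
proof (induction rule: laurent.induct)
  case (const c)
  show ?case
    by (rule exI[of _ "\<lambda>i j. on_inv (\<lambda>_. 0)"])
      (use laurent.const[of 0] in \<open>auto intro!: has_grad_cong[OF has_grad_on_inv[OF has_grad_const]] simp: on_inv_def[of "\<lambda>_. 0"]\<close>)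
next
  case (coord u)
  have "\<exists>c. u = (\<lambda>Z. c (1::2) (1::2) * Z$1$1 + (c 1 2 * Z$1$2 + (c 2 1 * Z$2$1 + c 2 2 * Z$2$2)))"
  proof -
    have ex: "\<exists>c. u = (\<lambda>Z. c (1::2) (1::2) * Z$1$1 + (c 1 2 * Z$1$2 + (c 2 1 * Z$2$1 + c 2 2 * Z$2$2)))"
      if "\<And>Z. u Z = a * Z$1$1 + (b * Z$1$2 + (c' * Z$2$1 + d * Z$2$2))" for a b c' d
      by (rule exI[of _ "\<lambda>i j. if i = 1 then if j = 1 then a else b else if j = 1 then c' else d"])
        (simp add: that fun_eq_iff)
    have "u = z0 \<or> u = z1 \<or> u = z2 \<or> u = z3" using coord by simp
    then show ?thesis
    proof (elim disjE)
      assume "u = z0" then show ?thesis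
        by (intro ex[of "1/2" 0 0 "1/2"]) (simp add: z0_def field_simps)
    next
      assume "u = z1" then show ?thesis
        by (intro ex[of 0 "\<i>/2" "\<i>/2" 0]) (simp add: z1_def field_simps)
    next
      assume "u = z2" then show ?thesis
        by (intro ex[of 0 "-1/2" "1/2" 0]) (simp add: z2_def field_simps)
    next
      assume "u = z3" then show ?thesis
        by (intro ex[of "\<i>/2" 0 0 "-\<i>/2"]) (simp add: z3_def field_simps)
    qed
  qed
  then obtain c :: "2 \<Rightarrow> 2 \<Rightarrow> complex" where c: "u = (\<lambda>Z. c 1 1 * Z$1$1 + (c 1 2 * Z$1$2 + (c 2 1 * Z$2$1 + c 2 2 * Z$2$2)))" by blast
  have "has_grad u Z c" for Z
    unfolding c
    by (rule has_grad_cong, (rule has_grad_add has_grad_cmult has_grad_entry)+) (use exhaust_2 in auto)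
  then have "N Z \<noteq> 0 \<Longrightarrow> has_grad (on_inv u) Z (\<lambda>i j. on_inv (\<lambda>_. c i j) Z)" for Z
    by (intro has_grad_cong[OF has_grad_on_inv]) (auto simp: on_inv_def)
  then show ?case
    by (intro exI[of _ "\<lambda>i j. on_inv (\<lambda>_. c i j)"]) (auto intro: laurent.const)
next
  case N_inverse
  have *: "on_inv (\<lambda>Z. cofactor Z i j) \<in> laurent" for i j
  proof -
    have "on_inv (\<lambda>Z. (-1) * Z $ a $ b) \<in> laurent" for a b
      unfolding on_inv_mult by (intro laurent.mult laurent.const laurent_entry)
    then show ?thesis using laurent_entry
      by (cases "i = 1"; cases "j = 1") (simp_all add: cofactor_def)
  qed
  have "has_grad (on_inv (\<lambda>Z. inverse (N Z))) Z
      (\<lambda>i j. -1 * (on_inv (\<lambda>Z. N Z powi (-2)) Z * on_inv (\<lambda>Z. cofactor Z i j) Z))" if "N Z \<noteq> 0" for Z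
    using has_grad_on_inv[OF has_grad_N_power[OF that, of "-1"] that] that
    by (simp add: on_inv_def power_int_minus)
  then show ?case
    by (intro exI[of _ "\<lambda>i j Z. -1 * (on_inv (\<lambda>Z. N Z powi (-2)) Z * on_inv (\<lambda>Z. cofactor Z i j) Z)"] conjI allI
        laurent_cmult laurent.mult * laurent_N_power) auto
next
  case (add f g)
  then obtain D E where D: "\<And>i j. D i j \<in> laurent" "\<And>Z. N Z \<noteq> 0 \<Longrightarrow> has_grad f Z (\<lambda>i j. D i j Z)"
    and E: "\<And>i j. E i j \<in> laurent" "\<And>Z. N Z \<noteq> 0 \<Longrightarrow> has_grad g Z (\<lambda>i j. E i j Z)" by blast
  show ?case
    by (rule exI[of _ "\<lambda>i j Z. D i j Z + E i j Z"]) (auto intro!: laurent.add D E has_grad_add)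
next
  case (mult f g)
  then obtain D E where D: "\<And>i j. D i j \<in> laurent" "\<And>Z. N Z \<noteq> 0 \<Longrightarrow> has_grad f Z (\<lambda>i j. D i j Z)"
    and E: "\<And>i j. E i j \<in> laurent" "\<And>Z. N Z \<noteq> 0 \<Longrightarrow> has_grad g Z (\<lambda>i j. E i j Z)" by blast
  show ?case
    by (rule exI[of _ "\<lambda>i j Z. D i j Z * g Z + f Z * E i j Z"])
      (auto intro!: laurent.add laurent.mult D E has_grad_mult mult.hyps)
qed

text \<open>
Gradients are unique, so the partial derivatives are the components found above.
\<close>

lemma laurent_has_grad:
  assumes "F \<in> laurent" "N Z \<noteq> 0"
  shows "has_grad F Z (\<lambda>i j. pdv i j F Z)"
proof -
  obtain D where D: "has_grad F Z D" using laurent_has_grad_ex[OF assms(1)] assms(2) by blast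
  then show ?thesis using pdv_eq[OF D assms(2)] by simp
qed

lemma laurent_pdv:
  assumes "F \<in> laurent" shows "pdv a b F \<in> laurent"
proof -
  obtain D where D: "\<And>i j. D i j \<in> laurent" "\<And>Z. N Z \<noteq> 0 \<Longrightarrow> has_grad F Z (\<lambda>i j. D i j Z)"
    using laurent_has_grad_ex[OF assms(1)] by blast
  have "pdv a b F = D a b"
  proof
    fix Z show "pdv a b F Z = D a b Z"
      by (cases "N Z = 0") (simp_all add: pdv_outside laurent_outside[OF D(1)] pdv_eq[OF D(2)])
  qed
  then show ?thesis using D by simp
qed

lemma pdv_add:
  assumes "F \<in> laurent" "G \<in> laurent"
  shows "pdv a b (\<lambda>Z. F Z + G Z) = (\<lambda>Z. pdv a b F Z + pdv a b G Z)"
proof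
  fix Z show "pdv a b (\<lambda>Z. F Z + G Z) Z = pdv a b F Z + pdv a b G Z"
    by (cases "N Z = 0")
      (simp_all add: pdv_outside pdv_eq[OF has_grad_add[OF laurent_has_grad laurent_has_grad]] assms)
qed

lemma pdv_mult:
  assumes "F \<in> laurent" "G \<in> laurent"
  shows "pdv a b (\<lambda>Z. F Z * G Z) = (\<lambda>Z. pdv a b F Z * G Z + F Z * pdv a b G Z)"
proof
  fix Z show "pdv a b (\<lambda>Z. F Z * G Z) Z = pdv a b F Z * G Z + F Z * pdv a b G Z"
    by (cases "N Z = 0")
      (simp_all add: pdv_outside pdv_eq[OF has_grad_mult[OF laurent_has_grad laurent_has_grad]] assms)
qed

lemma pdv_cmult:
  assumes "F \<in> laurent"
  shows "pdv a b (\<lambda>Z. c * F Z) = (\<lambda>Z. c * pdv a b F Z)"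
proof
  fix Z show "pdv a b (\<lambda>Z. c * F Z) Z = c * pdv a b F Z"
    by (cases "N Z = 0")
      (simp_all add: pdv_outside pdv_eq[OF has_grad_cmult[OF laurent_has_grad]] assms)
qed

section \<open>Row and column operators\<close>

text \<open>
The building blocks \<open>N\<^sup>b tpoly p k q\<close> of the Peter-Weyl decomposition.
\<close>

definition Ntpoly :: "int \<Rightarrow> nat \<Rightarrow> nat \<Rightarrow> int \<Rightarrow> quat \<Rightarrow> complex" where
  "Ntpoly b p k q = on_inv (\<lambda>Z. N Z powi b * tpoly p k q Z)"

lemma on_inv_apply: "on_inv F Z = (if N Z = 0 then 0 else F Z)"
  by (simp add: on_inv_def)

lemma laurent_Ntpoly: "Ntpoly b p k q \<in> laurent"
  unfolding Ntpoly_def on_inv_mult by (intro laurent.mult laurent_N_power laurent_tpoly)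

lemma Ntpoly_outside: "N Z = 0 \<Longrightarrow> Ntpoly b p k q Z = 0"
  by (simp add: Ntpoly_def on_inv_def)

lemma Ntpoly_apply: "Ntpoly b p k q Z = (if N Z = 0 then 0 else N Z powi b * tpoly p k q Z)"
  by (simp add: Ntpoly_def on_inv_def)

lemma pdv_Ntpoly: "N Z \<noteq> 0 \<Longrightarrow> pdv i j (Ntpoly b p k q) Z =
   of_int b * N Z powi (b - 1) * cofactor Z i j * tpoly p k q Z + N Z powi b * tpoly_grad p k q Z i j"
  unfolding Ntpoly_def
  by (subst pdv_eq[OF has_grad_on_inv[OF has_grad_mult[OF has_grad_N_power has_grad_tpoly]]]) auto

text \<open>
\<open>rowop c a\<close> is the vector field \<open>\<Sum>\<^sub>j z\<^sub>c\<^sub>j \<partial>\<^sub>a\<^sub>j\<close>, the infinitesimal left multiplication by a matrix unit;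
\<open>colop c a\<close> below is \<open>\<Sum>\<^sub>i z\<^sub>i\<^sub>c \<partial>\<^sub>i\<^sub>a\<close>. Both the group actions and the products of \<open>Z\<close> with \<open>\<nabla>f\<close>
are combinations of them.
\<close>

definition rowop :: "2 \<Rightarrow> 2 \<Rightarrow> (quat \<Rightarrow> complex) \<Rightarrow> quat \<Rightarrow> complex" where
  "rowop c a F Z = Z $ c $ 1 * pdv a 1 F Z + Z $ c $ 2 * pdv a 2 F Z"

definition colop :: "2 \<Rightarrow> 2 \<Rightarrow> (quat \<Rightarrow> complex) \<Rightarrow> quat \<Rightarrow> complex" where
  "colop c a F Z = Z $ 1 $ c * pdv 1 a F Z + Z $ 2 $ c * pdv 2 a F Z"

lemma rowop_outside: "N Z = 0 \<Longrightarrow> rowop c a F Z = 0"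
  by (simp add: rowop_def pdv_outside)

lemma colop_outside: "N Z = 0 \<Longrightarrow> colop c a F Z = 0"
  by (simp add: colop_def pdv_outside)

text \<open>
Laplace expansion: this is how the vector field \<open>rowop c a\<close> acts on the determinant.
\<close>

lemma row_cofactor: "Z $ c $ 1 * cofactor Z a 1 + Z $ c $ 2 * cofactor Z a 2 = (if c = a then N Z else 0)"
  using exhaust_2[of a] exhaust_2[of c] by (auto simp: cofactor_def N_eq algebra_simps)

lemma col_cofactor: "Z $ 1 $ c * cofactor Z 1 a + Z $ 2 $ c * cofactor Z 2 a = (if c = a then N Z else 0)"
  using exhaust_2[of a] exhaust_2[of c] by (auto simp: cofactor_def N_eq algebra_simps)

lemma N_powi_minus_1: "N Z \<noteq> 0 \<Longrightarrow> N Z powi (b - 1) * N Z = N Z powi b"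
  by (simp add: power_int_diff)

lemma rowop_Ntpoly:
  "rowop c a (Ntpoly b p k q) = (\<lambda>Z. (if c = a then of_int b else 0) * Ntpoly b p k q Z +
     on_inv (\<lambda>Z. N Z powi b * (Z $ c $ 1 * tpoly_grad p k q Z a 1 + Z $ c $ 2 * tpoly_grad p k q Z a 2)) Z)"
proof
  fix Z
  show "rowop c a (Ntpoly b p k q) Z = (if c = a then of_int b else 0) * Ntpoly b p k q Z +
     on_inv (\<lambda>Z. N Z powi b * (Z $ c $ 1 * tpoly_grad p k q Z a 1 + Z $ c $ 2 * tpoly_grad p k q Z a 2)) Z"
  proof (cases "N Z = 0")
    case True then show ?thesis by (simp add: rowop_outside Ntpoly_outside on_inv_def)
  next
    case False
    have "rowop c a (Ntpoly b p k q) Z = of_int b * N Z powi (b - 1) * tpoly p k q Z *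
        (Z $ c $ 1 * cofactor Z a 1 + Z $ c $ 2 * cofactor Z a 2)
        + N Z powi b * (Z $ c $ 1 * tpoly_grad p k q Z a 1 + Z $ c $ 2 * tpoly_grad p k q Z a 2)"
      by (simp add: rowop_def pdv_Ntpoly[OF False] algebra_simps)
    also have "of_int b * N Z powi (b - 1) * tpoly p k q Z * (Z $ c $ 1 * cofactor Z a 1 + Z $ c $ 2 * cofactor Z a 2)
       = (if c = a then of_int b else 0) * Ntpoly b p k q Z"
      using False by (simp add: row_cofactor Ntpoly_def on_inv_def N_powi_minus_1[OF False, of b, symmetric])
    finally show ?thesis using False by (simp add: on_inv_def)
  qed
qed

lemma colop_Ntpoly:
  "colop c a (Ntpoly b p k q) = (\<lambda>Z. (if c = a then of_int b else 0) * Ntpoly b p k q Z +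
     on_inv (\<lambda>Z. N Z powi b * (Z $ 1 $ c * tpoly_grad p k q Z 1 a + Z $ 2 $ c * tpoly_grad p k q Z 2 a)) Z)"
proof
  fix Z
  show "colop c a (Ntpoly b p k q) Z = (if c = a then of_int b else 0) * Ntpoly b p k q Z +
     on_inv (\<lambda>Z. N Z powi b * (Z $ 1 $ c * tpoly_grad p k q Z 1 a + Z $ 2 $ c * tpoly_grad p k q Z 2 a)) Z"
  proof (cases "N Z = 0")
    case True then show ?thesis by (simp add: colop_outside Ntpoly_outside on_inv_def)
  next
    case False
    have "colop c a (Ntpoly b p k q) Z = of_int b * N Z powi (b - 1) * tpoly p k q Z *
        (Z $ 1 $ c * cofactor Z 1 a + Z $ 2 $ c * cofactor Z 2 a)
        + N Z powi b * (Z $ 1 $ c * tpoly_grad p k q Z 1 a + Z $ 2 $ c * tpoly_grad p k q Z 2 a)"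
      by (simp add: colop_def pdv_Ntpoly[OF False] algebra_simps)
    also have "of_int b * N Z powi (b - 1) * tpoly p k q Z * (Z $ 1 $ c * cofactor Z 1 a + Z $ 2 $ c * cofactor Z 2 a)
       = (if c = a then of_int b else 0) * Ntpoly b p k q Z"
      using False by (simp add: col_cofactor Ntpoly_def on_inv_def N_powi_minus_1[OF False, of b, symmetric])
    finally show ?thesis using False by (simp add: on_inv_def)
  qed
qed

text \<open>
The row operators shift only the index \<open>q\<close>, the column operators only \<open>p\<close> and \<open>k\<close>.
\<close>

lemma rowop_Ntpoly_values:
  "rowop 1 1 (Ntpoly b p k q) = (\<lambda>Z. of_int (b + q) * Ntpoly b p k q Z)"
  "rowop 1 2 (Ntpoly b p k q) = (\<lambda>Z. of_int (q + 1) * Ntpoly b p k (q + 1) Z)"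
  "rowop 2 1 (Ntpoly b p k q) = (\<lambda>Z. of_int (int (p + k) - q + 1) * Ntpoly b p k (q - 1) Z)"
  "rowop 2 2 (Ntpoly b p k q) = (\<lambda>Z. of_int (b + int (p + k) - q) * Ntpoly b p k q Z)"
proof -
  show "rowop 1 1 (Ntpoly b p k q) = (\<lambda>Z. of_int (b + q) * Ntpoly b p k q Z)"
  proof
    fix Z show "rowop 1 1 (Ntpoly b p k q) Z = of_int (b + q) * Ntpoly b p k q Z"
      using arg_cong[OF tpoly_row1[of q p k Z], of "\<lambda>x. N Z powi b * x"]
      unfolding rowop_Ntpoly by (simp add: tpoly_grad_def Ntpoly_apply on_inv_def algebra_simps)
  qed
  show "rowop 1 2 (Ntpoly b p k q) = (\<lambda>Z. of_int (q + 1) * Ntpoly b p k (q + 1) Z)"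
  proof
    fix Z show "rowop 1 2 (Ntpoly b p k q) Z = of_int (q + 1) * Ntpoly b p k (q + 1) Z"
      using arg_cong[OF tpoly_row1[of "q+1" p k Z], of "\<lambda>x. N Z powi b * x"]
      unfolding rowop_Ntpoly by (simp add: tpoly_grad_def Ntpoly_apply on_inv_def algebra_simps)
  qed
  show "rowop 2 1 (Ntpoly b p k q) = (\<lambda>Z. of_int (int (p + k) - q + 1) * Ntpoly b p k (q - 1) Z)"
  proof
    fix Z show "rowop 2 1 (Ntpoly b p k q) Z = of_int (int (p + k) - q + 1) * Ntpoly b p k (q - 1) Z"
      using arg_cong[OF tpoly_row2[of p k "q-1" Z], of "\<lambda>x. N Z powi b * x"]
      unfolding rowop_Ntpoly by (simp add: tpoly_grad_def Ntpoly_apply on_inv_def algebra_simps)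
  qed
  show "rowop 2 2 (Ntpoly b p k q) = (\<lambda>Z. of_int (b + int (p + k) - q) * Ntpoly b p k q Z)"
  proof
    fix Z show "rowop 2 2 (Ntpoly b p k q) Z = of_int (b + int (p + k) - q) * Ntpoly b p k q Z"
      using arg_cong[OF tpoly_row2[of p k "q" Z], of "\<lambda>x. N Z powi b * x"]
      unfolding rowop_Ntpoly by (simp add: tpoly_grad_def Ntpoly_apply on_inv_def algebra_simps)
  qed
qed

lemma colop_Ntpoly_values:
  "colop 1 1 (Ntpoly b p k q) = (\<lambda>Z. of_int (b + int p) * Ntpoly b p k q Z)"
  "colop 1 2 (Ntpoly b p k q) = (\<lambda>Z. of_nat k * Ntpoly b (Suc p) (k - 1) q Z)"
  "colop 2 1 (Ntpoly b p k q) = (\<lambda>Z. of_nat p * Ntpoly b (p - 1) (Suc k) q Z)"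
  "colop 2 2 (Ntpoly b p k q) = (\<lambda>Z. of_int (b + int k) * Ntpoly b p k q Z)"
proof -
  show "colop 1 1 (Ntpoly b p k q) = (\<lambda>Z. of_int (b + int p) * Ntpoly b p k q Z)"
  proof
    fix Z show "colop 1 1 (Ntpoly b p k q) Z = of_int (b + int p) * Ntpoly b p k q Z"
      using arg_cong[OF tpoly_col1[of p k q Z], of "\<lambda>x. N Z powi b * x"]
      unfolding colop_Ntpoly by (simp add: tpoly_grad_def Ntpoly_apply on_inv_def algebra_simps)
  qed
  show "colop 1 2 (Ntpoly b p k q) = (\<lambda>Z. of_nat k * Ntpoly b (Suc p) (k - 1) q Z)"
    unfolding colop_Ntpoly by (cases k) (simp_all add: fun_eq_iff tpoly_grad_def Let_def Ntpoly_apply on_inv_def tpoly_Suc1 algebra_simps)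
  show "colop 2 1 (Ntpoly b p k q) = (\<lambda>Z. of_nat p * Ntpoly b (p - 1) (Suc k) q Z)"
    unfolding colop_Ntpoly by (cases p) (simp_all add: fun_eq_iff tpoly_grad_def Let_def Ntpoly_apply on_inv_def tpoly_Suc2 algebra_simps)
  show "colop 2 2 (Ntpoly b p k q) = (\<lambda>Z. of_int (b + int k) * Ntpoly b p k q Z)"
  proof
    fix Z show "colop 2 2 (Ntpoly b p k q) Z = of_int (b + int k) * Ntpoly b p k q Z"
      using arg_cong[OF tpoly_col2[of k p q Z], of "\<lambda>x. N Z powi b * x"]
      unfolding colop_Ntpoly by (simp add: tpoly_grad_def Ntpoly_apply on_inv_def algebra_simps)
  qed
qed

section \<open>The Laplacian\<close>

text \<open>
Half of \<open>\<box>\<close>, in the matrix entries. Symmetrizing the mixed derivatives avoids an appeal to their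
equality.
\<close>

definition half_box :: "(quat \<Rightarrow> complex) \<Rightarrow> quat \<Rightarrow> complex" where
  "half_box F Z = pdv 1 1 (pdv 2 2 F) Z + pdv 2 2 (pdv 1 1 F) Z
           - pdv 1 2 (pdv 2 1 F) Z - pdv 2 1 (pdv 1 2 F) Z"

lemma laurent_minus: "F \<in> laurent \<Longrightarrow> G \<in> laurent \<Longrightarrow> (\<lambda>Z. F Z - G Z) \<in> laurent"
  using laurent.add[of F "\<lambda>Z. -1 * G Z"] laurent_cmult[of G "-1"] by simp

lemma laurent_half_box: "F \<in> laurent \<Longrightarrow> half_box F \<in> laurent"
  unfolding half_box_def[abs_def] by (intro laurent_minus laurent.add laurent_pdv)

lemma half_box_add:
  assumes "F \<in> laurent" "G \<in> laurent"
  shows "half_box (\<lambda>Z. F Z + G Z) = (\<lambda>Z. half_box F Z + half_box G Z)"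
  by (simp add: half_box_def fun_eq_iff pdv_add laurent_pdv assms)

lemma half_box_cmult:
  assumes "F \<in> laurent"
  shows "half_box (\<lambda>Z. c * F Z) = (\<lambda>Z. c * half_box F Z)"
  by (simp add: half_box_def fun_eq_iff pdv_cmult laurent_pdv assms algebra_simps)

lemma half_box_mult:
  assumes "F \<in> laurent" "G \<in> laurent"
  shows "half_box (\<lambda>Z. F Z * G Z) = (\<lambda>Z. half_box F Z * G Z + F Z * half_box G Z + 2 *
     (pdv 1 1 F Z * pdv 2 2 G Z + pdv 2 2 F Z * pdv 1 1 G Z
      - pdv 1 2 F Z * pdv 2 1 G Z - pdv 2 1 F Z * pdv 1 2 G Z))"
  by (simp add: half_box_def fun_eq_iff pdv_mult pdv_add laurent.mult laurent_pdv assms algebra_simps)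

lemma pdv_N_power:
  "pdv i j (on_inv (\<lambda>Z. N Z powi b)) = 
     (\<lambda>Z. of_int b * (on_inv (\<lambda>Z. N Z powi (b - 1)) Z * on_inv (\<lambda>Z. cofactor Z i j) Z))"
proof
  fix Z
  show "pdv i j (on_inv (\<lambda>Z. N Z powi b)) Z = 
     of_int b * (on_inv (\<lambda>Z. N Z powi (b - 1)) Z * on_inv (\<lambda>Z. cofactor Z i j) Z)"
    by (cases "N Z = 0")
      (simp_all add: pdv_outside pdv_eq[OF has_grad_on_inv[OF has_grad_N_power]] on_inv_apply)
qed

lemma laurent_cofactor: "on_inv (\<lambda>Z. cofactor Z i j) \<in> laurent"
proof -
  have "on_inv (\<lambda>Z. (-1) * Z $ a $ b) \<in> laurent" for a b
    unfolding on_inv_mult by (intro laurent.mult laurent.const laurent_entry)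
  then show ?thesis using laurent_entry
    by (cases "i = 1"; cases "j = 1") (simp_all add: cofactor_def)
qed

lemma pdv_cofactor:
  assumes "N Z \<noteq> 0"
  shows "pdv 1 1 (on_inv (\<lambda>Z. cofactor Z 2 2)) Z = 1" "pdv 2 2 (on_inv (\<lambda>Z. cofactor Z 1 1)) Z = 1"
    "pdv 1 2 (on_inv (\<lambda>Z. cofactor Z 2 1)) Z = -1" "pdv 2 1 (on_inv (\<lambda>Z. cofactor Z 1 2)) Z = -1"
  using assms
    pdv_eq[OF has_grad_on_inv[OF has_grad_cmult[OF has_grad_entry[of 1 2], where c = "-1"] assms] assms]
    pdv_eq[OF has_grad_on_inv[OF has_grad_cmult[OF has_grad_entry[of 2 1], where c = "-1"] assms] assms]
  by (simp_all add: cofactor_def pdv_eq[OF has_grad_on_inv[OF has_grad_entry]])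

lemma half_box_N_power:
  assumes Z: "N Z \<noteq> 0"
  shows "half_box (on_inv (\<lambda>Z. N Z powi b)) Z = 2 * of_int (b * (b + 1)) * N Z powi (b - 1)"
proof -
  have n: "N Z powi (b - 1) = N Z powi (b - 2) * N Z"
    using N_powi_minus_1[OF Z, of "b-1"] by simp
  have *: "pdv i j (pdv i' j' (on_inv (\<lambda>Z. N Z powi b))) Z =
     of_int b * (of_int (b - 1) * N Z powi (b - 2) * cofactor Z i j * cofactor Z i' j'
       + N Z powi (b - 1) * pdv i j (on_inv (\<lambda>Z. cofactor Z i' j')) Z)" for i j i' j'
    unfolding pdv_N_power
    by (subst pdv_cmult, intro laurent.mult laurent_N_power laurent_cofactor,
       subst pdv_mult, rule laurent_N_power, rule laurent_cofactor)
      (simp add: pdv_N_power on_inv_apply Z)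
  define n where "n = N Z powi (b - 2)"
  have "cofactor Z 1 1 * cofactor Z 2 2 - cofactor Z 1 2 * cofactor Z 2 1 = N Z"
    by (simp add: cofactor_def N_eq)
  then have N: "N Z = cofactor Z 1 1 * cofactor Z 2 2 - cofactor Z 1 2 * cofactor Z 2 1" by simp
  have "half_box (on_inv (\<lambda>Z. N Z powi b)) Z = 2 * of_int b * (of_int (b - 1) * n *
      (cofactor Z 1 1 * cofactor Z 2 2 - cofactor Z 1 2 * cofactor Z 2 1) + 2 * (n * N Z))"
    unfolding half_box_def * pdv_cofactor[OF Z] n n_def[symmetric] by (simp only: algebra_simps) simp
  also have "\<dots> = 2 * of_int (b * (b + 1)) * (n * N Z)"
    unfolding N[symmetric] by (simp add: algebra_simps)
  finally show ?thesis by (simp add: n n_def)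
qed

lemma pdv_tpoly: "pdv i j (on_inv (tpoly p k q)) =
   (if j = 1 then (\<lambda>Z. of_nat p * on_inv (tpoly (p - 1) k (if i = 1 then q - 1 else q)) Z)
    else (\<lambda>Z. of_nat k * on_inv (tpoly p (k - 1) (if i = 1 then q - 1 else q)) Z))"
proof
  fix Z
  show "pdv i j (on_inv (tpoly p k q)) Z = (if j = 1 then (\<lambda>Z. of_nat p * on_inv (tpoly (p - 1) k (if i = 1 then q - 1 else q)) Z)
    else (\<lambda>Z. of_nat k * on_inv (tpoly p (k - 1) (if i = 1 then q - 1 else q)) Z)) Z"
    by (cases "N Z = 0")
      (simp_all add: pdv_outside pdv_eq[OF has_grad_on_inv[OF has_grad_tpoly]] on_inv_apply tpoly_grad_def)
qed

text \<open>
The polynomials \<open>tpoly p k q\<close> are harmonic: \<open>\<partial>\<^sub>1\<^sub>1\<partial>\<^sub>2\<^sub>2\<close> and \<open>\<partial>\<^sub>1\<^sub>2\<partial>\<^sub>2\<^sub>1\<close> both lower \<open>p\<close>, \<open>k\<close> and \<open>q\<close> by one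
with the same factor \<open>p k\<close>.
\<close>

lemma half_box_tpoly: "half_box (on_inv (tpoly p k q)) = (\<lambda>_. 0)"
  by (simp add: half_box_def fun_eq_iff pdv_tpoly pdv_cmult laurent_tpoly)

text \<open>
In the product rule the mixed term of \<open>N\<^sup>b\<close> and \<open>tpoly p k q\<close> is \<open>b N\<^sup>b\<^sup>-\<^sup>1\<close> times the Euler
operator, which contributes the degree \<open>p + k\<close>.
\<close>

lemma half_box_Ntpoly: "half_box (Ntpoly b p k q) = (\<lambda>Z. (2 * of_int (b * (b + 1 + int (p + k)))) * Ntpoly (b - 1) p k q Z)"
proof
  fix Z
  show "half_box (Ntpoly b p k q) Z = (2 * of_int (b * (b + 1 + int (p + k)))) * Ntpoly (b - 1) p k q Z"
  proof (cases "N Z = 0")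
    case True
    then show ?thesis using laurent_outside[OF laurent_half_box[OF laurent_Ntpoly]] by (simp add: Ntpoly_outside)
  next
    case False
    have euler: "Z$1$1 * tpoly_grad p k q Z 1 1 + Z$1$2 * tpoly_grad p k q Z 1 2 + Z$2$1 * tpoly_grad p k q Z 2 1 + Z$2$2 * tpoly_grad p k q Z 2 2
       = of_int (int (p + k)) * tpoly p k q Z"
      using tpoly_row1[of q p k Z] tpoly_row2[of p k q Z] by (simp add: tpoly_grad_def algebra_simps)
    have d: "pdv i j (on_inv (tpoly p k q)) Z = tpoly_grad p k q Z i j" for i j
      using pdv_eq[OF has_grad_on_inv[OF has_grad_tpoly False] False] .
    have "half_box (Ntpoly b p k q) Z = 2 * of_int (b * (b + 1)) * N Z powi (b - 1) * tpoly p k q Z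
       + 2 * (of_int b * N Z powi (b - 1) * (Z$1$1 * tpoly_grad p k q Z 1 1 + Z$1$2 * tpoly_grad p k q Z 1 2 
          + Z$2$1 * tpoly_grad p k q Z 2 1 + Z$2$2 * tpoly_grad p k q Z 2 2))"
      unfolding Ntpoly_def on_inv_mult
      by (subst half_box_mult[OF laurent_N_power laurent_tpoly])
        (simp add: half_box_N_power[OF False] half_box_tpoly pdv_N_power d, simp add: on_inv_apply False cofactor_def algebra_simps)
    also have "\<dots> = (2 * of_int (b * (b + 1 + int (p + k)))) * Ntpoly (b - 1) p k q Z"
      unfolding euler by (simp add: Ntpoly_apply False algebra_simps)
    finally show ?thesis .
  qed
qed

section \<open>Laurent polynomials are spanned by powers of the determinant times matrix coefficients\<close>

inductive_set Nspan :: "(quat \<Rightarrow> complex) set" where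
  Nspan_Ntpoly: "Ntpoly b p k q \<in> Nspan"
| Nspan_add: "F \<in> Nspan \<Longrightarrow> G \<in> Nspan \<Longrightarrow> (\<lambda>Z. F Z + G Z) \<in> Nspan"
| Nspan_cmult: "F \<in> Nspan \<Longrightarrow> (\<lambda>Z. c * F Z) \<in> Nspan"

lemma Nspan_outside: "F \<in> Nspan \<Longrightarrow> N Z = 0 \<Longrightarrow> F Z = 0"
  by (induction rule: Nspan.induct) (auto simp: Ntpoly_outside)

lemma N_powi_plus_1: "N Z \<noteq> 0 \<Longrightarrow> N Z powi (b + 1) = N Z powi b * N Z"
  by (simp add: power_int_add)

lemma entry_mult_Ntpoly:
  "\<exists>c1 c2 p1 k1 q1 p2 k2 q2. \<forall>Z. Z$i$j * Ntpoly b p k q Z = c1 * Ntpoly b p1 k1 q1 Z + c2 * Ntpoly (b + 1) p2 k2 q2 Z"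
proof -
  have key: "\<exists>c1 c2 p1 k1 q1 p2 k2 q2. \<forall>Z. Z$i$j * Ntpoly b p k q Z = c1 * Ntpoly b p1 k1 q1 Z + c2 * Ntpoly (b + 1) p2 k2 q2 Z"
    if *: "\<And>Z. of_nat (p + k + 1) * (Z$i$j * tpoly p k q Z) = c1 * tpoly p1 k1 q1 Z + c2 * (N Z * tpoly p2 k2 q2 Z)"
    for c1 c2 p1 k1 q1 p2 k2 q2
  proof -
    have nz: "(of_nat (p + k + 1) :: complex) \<noteq> 0" by (simp only: of_nat_eq_0_iff)
    have "Z$i$j * Ntpoly b p k q Z = (c1 / of_nat (p + k + 1)) * Ntpoly b p1 k1 q1 Z + (c2 / of_nat (p + k + 1)) * Ntpoly (b + 1) p2 k2 q2 Z" for Z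
    proof (cases "N Z = 0")
      case False
      have "Z$i$j * tpoly p k q Z = (c1 * tpoly p1 k1 q1 Z + c2 * (N Z * tpoly p2 k2 q2 Z)) / of_nat (p + k + 1)"
        using * nz by (metis nonzero_mult_div_cancel_left)
      then have "N Z powi b * (Z$i$j * tpoly p k q Z) = N Z powi b * ((c1 * tpoly p1 k1 q1 Z + c2 * (N Z * tpoly p2 k2 q2 Z)) / of_nat (p + k + 1))"
        by simp
      then show ?thesis
        using False N_powi_plus_1[OF False, of b]
        by (simp add: Ntpoly_apply add_divide_distrib distrib_left mult.commute mult.left_commute)
    qed (simp add: Ntpoly_outside)
    then show ?thesis by blast
  qed
  have "(i = 1 \<or> i = 2) \<and> (j = 1 \<or> j = 2)" using exhaust_2 by blast
  then show ?thesis
  proof (elim conjE disjE)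
    assume "i = 1" "j = 1" then show ?thesis using tpoly_mult_11[of p k _ q]
      by (intro key[of "of_int (q + 1)" "Suc p" k "q + 1" "of_nat k" p "k - 1" q]) simp
  next
    assume "i = 1" "j = 2" then show ?thesis 
      using tpoly_mult_12[of p k _ q] 
      by (intro key[of "of_int (q + 1)" p "Suc k" "q + 1" "- of_nat p" "p - 1" k q]) simp
  next
    assume "i = 2" "j = 1" then show ?thesis 
      using tpoly_mult_21[of p k _ q] 
      by (intro key[of "of_int (int (p + k + 1) - q)" "Suc p" k q "- of_nat k" p "k - 1" "q - 1"]) simp
  next
    assume "i = 2" "j = 2" then show ?thesis using tpoly_mult_22[of p k _ q]
      by (intro key[of "of_int (int (p + k + 1) - q)" p "Suc k" q "of_nat p" "p - 1" k "q - 1"]) simp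
  qed
qed

lemma Nspan_entry_mult: "F \<in> Nspan \<Longrightarrow> (\<lambda>Z. Z$i$j * F Z) \<in> Nspan"
proof (induction rule: Nspan.induct)
  case (Nspan_Ntpoly b p k q)
  obtain c1 c2 p1 k1 q1 p2 k2 q2 where
    "\<forall>Z. Z$i$j * Ntpoly b p k q Z = c1 * Ntpoly b p1 k1 q1 Z + c2 * Ntpoly (b + 1) p2 k2 q2 Z"
    using entry_mult_Ntpoly by metis
  then show ?case by (simp only:) (intro Nspan.intros)
next
  case (Nspan_add F G)
  then show ?case unfolding distrib_left by (intro Nspan.intros)
next
  case (Nspan_cmult F c)
  then show ?case unfolding mult.left_commute[of _ c] by (intro Nspan.intros)
qed

lemma Nspan_N_inverse_mult: "F \<in> Nspan \<Longrightarrow> (\<lambda>Z. inverse (N Z) * F Z) \<in> Nspan"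
proof (induction rule: Nspan.induct)
  case (Nspan_Ntpoly b p k q)
  have "inverse (N Z) * Ntpoly b p k q Z = Ntpoly (b - 1) p k q Z" for Z
    by (cases "N Z = 0") (simp_all add: Ntpoly_apply power_int_diff field_simps)
  then show ?case by (simp only:) (intro Nspan.intros)
next
  case (Nspan_add F G)
  then show ?case unfolding distrib_left by (intro Nspan.intros)
next
  case (Nspan_cmult F c)
  then show ?case unfolding mult.left_commute[of _ c] by (intro Nspan.intros)
qed

text \<open>
The multipliers of the span contain the generators of the Laurent polynomials and are closed under
sums and products, so they are all Laurent polynomials.
\<close>

lemma Nspan_laurent_mult: "F \<in> laurent \<Longrightarrow> G \<in> Nspan \<Longrightarrow> (\<lambda>Z. F Z * G Z) \<in> Nspan"
proof (induction arbitrary: G rule: laurent.induct)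
  case (const c)
  have "(\<lambda>Z. on_inv (\<lambda>_. c) Z * G Z) = (\<lambda>Z. c * G Z)"
    using Nspan_outside[OF const] by (auto simp: fun_eq_iff on_inv_apply)
  then show ?case using Nspan_cmult[OF const] by simp
next
  case (coord u)
  have lin: "\<exists>i j i' j' a b. \<forall>Z. u Z = a * Z$i$j + b * Z$i'$j'"
    if "\<And>Z. u Z = a * Z$i$j + b * Z$i'$j'" for i j i' j' a b
    using that by meson
  have "u = z0 \<or> u = z1 \<or> u = z2 \<or> u = z3" using coord(1) by simp
  then have "\<exists>i j i' j' a b. \<forall>Z. u Z = a * Z$i$j + b * Z$i'$j'"
  proof (elim disjE)
    assume "u = z0" then show ?thesis
      by (intro lin[of "1/2" 1 1 "1/2" 2 2]) (simp add: z0_def field_simps)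
  next
    assume "u = z1" then show ?thesis
      by (intro lin[of "\<i>/2" 1 2 "\<i>/2" 2 1]) (simp add: z1_def field_simps)
  next
    assume "u = z2" then show ?thesis
      by (intro lin[of "1/2" 2 1 "-1/2" 1 2]) (simp add: z2_def field_simps)
  next
    assume "u = z3" then show ?thesis
      by (intro lin[of "\<i>/2" 1 1 "-\<i>/2" 2 2]) (simp add: z3_def field_simps)
  qed
  then obtain i j i' j' a b where u: "\<And>Z. u Z = a * Z$i$j + b * Z$i'$j'" by meson
  have "on_inv u Z * G Z = a * (Z$i$j * G Z) + b * (Z$i'$j' * G Z)" for Z
    by (cases "N Z = 0") (simp_all add: on_inv_apply u algebra_simps Nspan_outside[OF coord(2)])
  then show ?case
    by (simp only:) (intro Nspan_add Nspan_cmult Nspan_entry_mult coord(2))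
next
  case N_inverse
  have "(\<lambda>Z. on_inv (\<lambda>Z. inverse (N Z)) Z * G Z) = (\<lambda>Z. inverse (N Z) * G Z)"
    by (auto simp: fun_eq_iff on_inv_apply)
  then show ?case using Nspan_N_inverse_mult[OF N_inverse] by simp
next
  case (add f g)
  then show ?case unfolding distrib_right by (intro Nspan_add)
next
  case (mult f g)
  then show ?case unfolding mult.assoc by blast
qed

lemma laurent_Nspan:
  assumes "F \<in> laurent" shows "F \<in> Nspan"
proof -
  have "F Z * Ntpoly 0 0 0 0 Z = F Z" for Z
    using laurent_outside[OF assms] by (auto simp: Ntpoly_apply tpoly_0)
  then show ?thesis
    using Nspan_laurent_mult[OF assms Nspan_Ntpoly[of 0 0 0 0]] by (simp only:)
qed

section \<open>Pairs of Laurent polynomials, and kernels of diagonal operators\<close>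

abbreviation component :: "2 \<Rightarrow> qfun \<Rightarrow> quat \<Rightarrow> complex" where
  "component i f \<equiv> (\<lambda>Z. f Z $ i)"

definition laurent2 :: "qfun set" where
  "laurent2 = {f. \<forall>i. component i f \<in> laurent}"

definition pair :: "(quat \<Rightarrow> complex) \<Rightarrow> (quat \<Rightarrow> complex) \<Rightarrow> qfun" where
  "pair F G = (\<lambda>Z. vector [F Z, G Z])"

lemma pair_component [simp]: "pair F G Z $ 1 = F Z" "pair F G Z $ 2 = G Z"
  by (simp_all add: pair_def)

lemma qfun_eqI: "(\<And>Z. f Z $ 1 = g Z $ 1) \<Longrightarrow> (\<And>Z. f Z $ 2 = g Z $ 2) \<Longrightarrow> f = g" for f g :: qfun
  by (simp add: fun_eq_iff vec_eq_iff forall_2)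

lemma fscale_component [simp]: "fscale c f Z $ i = c * f Z $ i"
  by (simp add: fscale_def)

lemma zero_qfun_component [simp]: "(0 :: qfun) Z $ i = 0"
  by simp

lemma laurent2_pair: "F \<in> laurent \<Longrightarrow> G \<in> laurent \<Longrightarrow> pair F G \<in> laurent2"
  by (simp add: laurent2_def forall_2)

lemma laurent2_component: "f \<in> laurent2 \<Longrightarrow> component i f \<in> laurent"
  by (simp add: laurent2_def)

lemma laurent_zero: "(\<lambda>_. 0) \<in> laurent"
  using laurent.const[of 0] by (simp add: on_inv_def)

lemma laurent2_subspace: "qfun.subspace laurent2"
  unfolding qfun.subspace_def
  by (auto simp: laurent2_def laurent_zero intro!: laurent.add laurent_cmult)

text \<open>
The spanning set need not be independent. If \<open>f = c b + g\<close> with \<open>Q b = \<mu> b\<close>, \<open>\<mu> \<noteq> 0\<close> and \<open>Q f = 0\<close>, then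
\<open>c b = - Q g / \<mu>\<close> lies in the span of the other vectors, since \<open>Q\<close> preserves that span. Thus the
vectors with nonzero eigenvalue can be removed one at a time.
\<close>

lemma diagonal_kernel:
  assumes S: "qfun.subspace S" and add: "\<And>f g. f \<in> S \<Longrightarrow> g \<in> S \<Longrightarrow> Q (f + g) = Q f + Q g"
    and scale: "\<And>c f. f \<in> S \<Longrightarrow> Q (fscale c f) = fscale c (Q f)"
    and B: "B \<subseteq> S" and diag: "\<And>b. b \<in> B \<Longrightarrow> \<exists>\<mu>. Q b = fscale \<mu> b"
    and f: "f \<in> qfun.span B" "Q f = 0"
  shows "f \<in> qfun.span {b \<in> B. Q b = 0}"
proof -
  have spanS: "qfun.span C \<subseteq> S" if "C \<subseteq> B" for C
    using that B S by (intro qfun.span_minimal) auto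
  have Q0: "Q 0 = 0"
    using scale[of 0 0] qfun.subspace_0[OF S] by simp
  have Qspan: "Q g \<in> qfun.span C" if C: "C \<subseteq> B" and g: "g \<in> qfun.span C" for C g
  proof -
    have "Q g \<in> qfun.span C \<and> g \<in> S"
      using g
    proof (induction rule: qfun.span_induct_alt)
      case base
      show ?case unfolding Q0 using qfun.span_zero qfun.subspace_0[OF S] by blast
    next
      case (step c x y)
      obtain \<mu> where \<mu>: "Q x = fscale \<mu> x" using diag step C by blast
      have S': "x \<in> S" "y \<in> S" "fscale c x \<in> S"
        using step spanS[OF C] qfun.span_base[of x C] qfun.subspace_scale[OF S] by blast+
      then have Q: "Q (fscale c x + y) = fscale c (fscale \<mu> x) + Q y"
        by (simp only: add scale \<mu>)
      have "fscale c (fscale \<mu> x) + Q y \<in> qfun.span C"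
        using step by (meson qfun.span_add qfun.span_scale qfun.span_base)
      then show ?case unfolding Q using S' qfun.subspace_add[OF S] by blast
    qed
    then show ?thesis ..
  qed
  have drop: "f \<in> qfun.span C" if bC: "insert b C \<subseteq> B" "f \<in> qfun.span (insert b C)" "Q b \<noteq> 0" for b C
  proof -
    obtain c where c: "f - fscale c b \<in> qfun.span C"
      using bC(2) by (auto simp: qfun.span_insert)
    define g where "g = f - fscale c b"
    have g: "g \<in> qfun.span C" "g \<in> S" "b \<in> S" using c spanS[of C] bC(1) B by (auto simp: g_def)
    have fg: "f = fscale c b + g" by (simp add: g_def)
    obtain \<mu> where \<mu>: "Q b = fscale \<mu> b" using diag bC by auto
    then have "\<mu> \<noteq> 0" using bC(3) by auto
    have "fscale c (fscale \<mu> b) + Q g = 0"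
      using f(2) unfolding fg using g by (simp add: add scale qfun.subspace_scale[OF S] \<mu>)
    then have "fscale (c * \<mu>) b = - Q g" by (simp add: eq_neg_iff_add_eq_0)
    moreover have "- Q g \<in> qfun.span C" using Qspan[of C g] bC g by (simp add: qfun.span_neg)
    ultimately have "fscale (inverse \<mu>) (fscale (c * \<mu>) b) \<in> qfun.span C"
      by (simp only: qfun.span_scale)
    moreover have "inverse \<mu> * (c * \<mu>) = c" using \<open>\<mu> \<noteq> 0\<close> by simp
    ultimately have "fscale c b \<in> qfun.span C" by (simp only: qfun.scale_scale)
    then show ?thesis unfolding fg using g by (intro qfun.span_add)
  qed
  define K where "K = {b \<in> B. Q b = 0}"
  obtain T r where T: "finite T" "T \<subseteq> B" "f = (\<Sum>a\<in>T. fscale (r a) a)"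
    using f(1) unfolding qfun.span_explicit by blast
  have fT: "f \<in> qfun.span T"
    unfolding T(3) by (intro qfun.span_sum qfun.span_scale qfun.span_base)
  have drop_all: "finite U \<Longrightarrow> U \<subseteq> B \<Longrightarrow> (\<forall>u\<in>U. Q u \<noteq> 0) \<Longrightarrow> f \<in> qfun.span (U \<union> K) \<Longrightarrow> f \<in> qfun.span K" for U
  proof (induction U rule: finite_induct)
    case (insert u U)
    have u: "insert u (U \<union> K) \<subseteq> B" using insert.prems(1) unfolding K_def by blast
    have fu: "f \<in> qfun.span (insert u (U \<union> K))" using insert.prems(3) by (simp only: Un_insert_left)
    have "Q u \<noteq> 0" using insert.prems(2) by blast
    from drop[OF u fu this] have "f \<in> qfun.span (U \<union> K)" .
    then show ?case using insert.IH insert.prems(1,2) by (meson insert_subset insertI2)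
  qed (simp only: Un_empty_left)
  have "T \<subseteq> (T - K) \<union> K" by blast
  then have "f \<in> qfun.span ((T - K) \<union> K)" using fT qfun.span_mono by (meson subsetD)
  then have "f \<in> qfun.span K"
    by (intro drop_all[of "T - K"]) (use T(1,2) K_def in blast)+
  then show ?thesis by (simp only: K_def)
qed

section \<open>The two systems of differential equations\<close>

lemma deriv_pd_cong:
  assumes eq: "\<And>Z. N Z \<noteq> 0 \<Longrightarrow> f Z = g Z" and Z: "N Z \<noteq> 0"
  shows "pd e f Z = pd e g Z"
proof -
  have "eventually (\<lambda>w. N (Z + mscale w e) \<noteq> 0) (nhds 0)"
    by (rule eventually_invertible[where h = "\<lambda>i j. e $ i $ j"]) (simp only: line_0 Z not_False_eq_True, rule line_deriv)
  then have "eventually (\<lambda>w. f (Z + mscale w e) $ i = g (Z + mscale w e) $ i) (nhds 0)" for i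
    by eventually_elim (simp add: eq)
  then show ?thesis by (auto simp: pd_def vec_eq_iff intro!: deriv_cong_ev)
qed

text \<open>
The partial derivative \<open>\<partial>/\<partial>z\<^sup>j\<close> for \<open>e = e\<^sub>j\<close>, in terms of derivatives with respect to matrix entries.
\<close>

definition entry_pd :: "quat \<Rightarrow> qfun \<Rightarrow> qfun" where
  "entry_pd e f = (\<lambda>Z. \<chi> i. e$1$1 * pdv 1 1 (component i f) Z + e$1$2 * pdv 1 2 (component i f) Z
     + e$2$1 * pdv 2 1 (component i f) Z + e$2$2 * pdv 2 2 (component i f) Z)"

lemma pd_eq_entry_pd: 
  assumes "f \<in> laurent2" "N Z \<noteq> 0"
  shows "pd e f Z = entry_pd e f Z"
proof -
  have "deriv (\<lambda>w. f (Z + mscale w e) $ i) 0 = entry_pd e f Z $ i" for i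
    using has_grad_line[where F = "component i f" and Z = Z, OF laurent_has_grad[OF laurent2_component[OF assms(1)] assms(2)], where H = e]
    by (simp add: sum_2 entry_pd_def algebra_simps)
  then show ?thesis by (simp add: pd_def vec_eq_iff)
qed

lemma laurent2_entry_pd: "f \<in> laurent2 \<Longrightarrow> entry_pd e f \<in> laurent2"
  unfolding laurent2_def entry_pd_def by (auto intro!: laurent.add laurent_cmult laurent_pdv)

lemma pd_pd:
  assumes "f \<in> laurent2" "N Z \<noteq> 0"
  shows "pd e (pd e f) Z = entry_pd e (entry_pd e f) Z"
  using deriv_pd_cong[of "pd e f" "entry_pd e f" Z e] pd_eq_entry_pd laurent2_entry_pd assms by metis

definition entry_box :: "qfun \<Rightarrow> qfun" where
  "entry_box f = (\<lambda>Z. \<chi> i. 2 * half_box (component i f) Z)"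

lemma laurent2_entry_box: "f \<in> laurent2 \<Longrightarrow> entry_box f \<in> laurent2"
  unfolding laurent2_def entry_box_def by (auto intro!: laurent_cmult laurent_half_box)

lemma pdv_cmult_add4:
  assumes "left_regular \<in> laurent" "left_coregular \<in> laurent" "F3 \<in> laurent" "F4 \<in> laurent"
  shows "pdv i j (\<lambda>Z. a * left_regular Z + b * left_coregular Z + c * F3 Z + d * F4 Z) Z =
    a * pdv i j left_regular Z + b * pdv i j left_coregular Z + c * pdv i j F3 Z + d * pdv i j F4 Z"
  using assms by (simp add: pdv_add pdv_cmult laurent.add laurent_cmult)

lemma e_entries:
  "e0$1$1 = 1" "e0$1$2 = 0" "e0$2$1 = 0" "e0$2$2 = 1"
  "e1$1$1 = 0" "e1$1$2 = -\<i>" "e1$2$1 = -\<i>" "e1$2$2 = 0"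
  "e2$1$1 = 0" "e2$1$2 = -1" "e2$2$1 = 1" "e2$2$2 = 0"
  "e3$1$1 = -\<i>" "e3$1$2 = 0" "e3$2$1 = 0" "e3$2$2 = \<i>"
  by (simp_all add: e0_def e1_def e2_def e3_def mat_def)

lemma laplacian_eq:
  assumes "f \<in> laurent2" "N Z \<noteq> 0"
  shows "laplacian f Z = entry_box f Z"
proof -
  have "laplacian f Z $ i = 2 * half_box (component i f) Z" for i
  proof -
    have F: "component i f \<in> laurent" using assms laurent2_component by blast
    have *: "entry_pd e (entry_pd e f) Z $ i = 
        e$1$1 * (e$1$1 * pdv 1 1 (pdv 1 1 (component i f)) Z + e$1$2 * pdv 1 1 (pdv 1 2 (component i f)) Z
                + e$2$1 * pdv 1 1 (pdv 2 1 (component i f)) Z + e$2$2 * pdv 1 1 (pdv 2 2 (component i f)) Z)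
      + e$1$2 * (e$1$1 * pdv 1 2 (pdv 1 1 (component i f)) Z + e$1$2 * pdv 1 2 (pdv 1 2 (component i f)) Z
                + e$2$1 * pdv 1 2 (pdv 2 1 (component i f)) Z + e$2$2 * pdv 1 2 (pdv 2 2 (component i f)) Z)
      + e$2$1 * (e$1$1 * pdv 2 1 (pdv 1 1 (component i f)) Z + e$1$2 * pdv 2 1 (pdv 1 2 (component i f)) Z
                + e$2$1 * pdv 2 1 (pdv 2 1 (component i f)) Z + e$2$2 * pdv 2 1 (pdv 2 2 (component i f)) Z)
      + e$2$2 * (e$1$1 * pdv 2 2 (pdv 1 1 (component i f)) Z + e$1$2 * pdv 2 2 (pdv 1 2 (component i f)) Z
                + e$2$1 * pdv 2 2 (pdv 2 1 (component i f)) Z + e$2$2 * pdv 2 2 (pdv 2 2 (component i f)) Z)" for e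
      unfolding entry_pd_def vec_lambda_beta
      by (simp only: pdv_cmult_add4 laurent_pdv F)
    show ?thesis
      unfolding laplacian_def pd_pd[OF assms] vector_add_component * e_entries half_box_def
      by (simp add: algebra_simps)
  qed
  then show ?thesis by (simp add: vec_eq_iff entry_box_def)
qed

text \<open>
\<open>left_op f\<close> is a quarter of \<open>N(Z) Z (\<nabla>\<box>f)(Z)\<close>, and \<open>right_op f\<close> of \<open>N(Z) ((\<box>f)\<nabla>)(Z) Z\<close>.
Multiplication by \<open>Z\<close> replaces the derivatives in \<open>\<nabla>\<close> by row or column operators, and \<open>N\<close> restores
the degree, so that these operators are diagonal on the pairs below.
\<close>

definition left_op :: "qfun \<Rightarrow> qfun" where
  "left_op f = (let F = half_box (component 1 f); G = half_box (component 2 f) in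
     pair (\<lambda>Z. N Z * (rowop 1 1 F Z + rowop 1 2 G Z)) (\<lambda>Z. N Z * (rowop 2 1 F Z + rowop 2 2 G Z)))"

definition right_op :: "qfun \<Rightarrow> qfun" where
  "right_op g = (let F = half_box (component 1 g); G = half_box (component 2 g) in
     pair (\<lambda>Z. N Z * (colop 1 1 F Z + colop 1 2 G Z)) (\<lambda>Z. N Z * (colop 2 1 F Z + colop 2 2 G Z)))"

lemma matrix_vector_mult_2: 
  "((A :: quat) *v x) $ i = A$i$1 * x$1 + A$i$2 * x$2"
  by (simp add: matrix_vector_mult_def sum_2)

lemma vector_matrix_mult_2: 
  "(x v* (A :: quat)) $ i = A$1$i * x$1 + A$2$i * x$2"
  by (simp add: vector_matrix_mult_def sum_2)

lemma invertible_kernel: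
  assumes "N Z \<noteq> 0"
  shows "Z *v x = 0 \<longleftrightarrow> x = 0" "x v* Z = 0 \<longleftrightarrow> x = 0"
proof -
  have l: "N Z * x$1 = Z$2$2 * (Z *v x)$1 - Z$1$2 * (Z *v x)$2" "N Z * x$2 = Z$1$1 * (Z *v x)$2 - Z$2$1 * (Z *v x)$1"
    and r: "N Z * x$1 = Z$2$2 * (x v* Z)$1 - Z$2$1 * (x v* Z)$2" "N Z * x$2 = Z$1$1 * (x v* Z)$2 - Z$1$2 * (x v* Z)$1"
    by (simp_all add: N_eq matrix_vector_mult_2 vector_matrix_mult_2 algebra_simps)
  show "Z *v x = 0 \<longleftrightarrow> x = 0"
    using l assms by (auto simp: vec_eq_iff forall_2 matrix_vector_mult_2)
  show "x v* Z = 0 \<longleftrightarrow> x = 0"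
    using r assms by (auto simp: vec_eq_iff forall_2 vector_matrix_mult_2)
qed

lemma left_op_eq:
  assumes "f \<in> laurent2" "N Z \<noteq> 0"
  shows "4 *s left_op f Z = N Z *s (Z *v nabla_left (laplacian f) Z)"
proof -
  have pd: "pd e (laplacian f) Z = entry_pd e (entry_box f) Z" for e
    using deriv_pd_cong[of "laplacian f" "entry_box f" Z e] laplacian_eq pd_eq_entry_pd laurent2_entry_box assms by metis
  have c: "component i (entry_box f) = (\<lambda>Z. 2 * half_box (component i f) Z)" for i
    by (simp add: entry_box_def)
  have p: "pdv a b (\<lambda>Z. 2 * half_box (component i f) Z) Z = 2 * pdv a b (half_box (component i f)) Z" for a b i
    by (simp add: pdv_cmult laurent_half_box laurent2_component assms)
  have d: "entry_pd e (entry_box f) Z $ i = e$1$1 * (2 * pdv 1 1 (half_box (component i f)) Z)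
      + e$1$2 * (2 * pdv 1 2 (half_box (component i f)) Z) + e$2$1 * (2 * pdv 2 1 (half_box (component i f)) Z)
      + e$2$2 * (2 * pdv 2 2 (half_box (component i f)) Z)" for e i
    unfolding entry_pd_def vec_lambda_beta c p ..
  have n: "nabla_left (laplacian f) Z $ 1 = 4 * (pdv 1 1 (half_box (component 1 f)) Z + pdv 2 1 (half_box (component 2 f)) Z)"
    "nabla_left (laplacian f) Z $ 2 = 4 * (pdv 1 2 (half_box (component 1 f)) Z + pdv 2 2 (half_box (component 2 f)) Z)"
    unfolding nabla_left_def pd vector_minus_component matrix_vector_mult_2 d e_entries by (simp_all add: algebra_simps)
  have "(4 *s left_op f Z) $ 1 = (N Z *s (Z *v nabla_left (laplacian f) Z)) $ 1" "(4 *s left_op f Z) $ 2 = (N Z *s (Z *v nabla_left (laplacian f) Z)) $ 2"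
    unfolding vector_smult_component matrix_vector_mult_2 n left_op_def Let_def pair_component rowop_def
    by (simp_all add: algebra_simps)
  then show ?thesis by (simp only: vec_eq_iff forall_2 simp_thms)
qed

lemma right_op_eq:
  assumes "f \<in> laurent2" "N Z \<noteq> 0"
  shows "4 *s right_op f Z = N Z *s (nabla_right (laplacian f) Z v* Z)"
proof -
  have pd: "pd e (laplacian f) Z = entry_pd e (entry_box f) Z" for e
    using deriv_pd_cong[of "laplacian f" "entry_box f" Z e] laplacian_eq pd_eq_entry_pd laurent2_entry_box assms by metis
  have c: "component i (entry_box f) = (\<lambda>Z. 2 * half_box (component i f) Z)" for i
    by (simp add: entry_box_def)
  have p: "pdv a b (\<lambda>Z. 2 * half_box (component i f) Z) Z = 2 * pdv a b (half_box (component i f)) Z" for a b i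
    by (simp add: pdv_cmult laurent_half_box laurent2_component assms)
  have d: "entry_pd e (entry_box f) Z $ i = e$1$1 * (2 * pdv 1 1 (half_box (component i f)) Z)
      + e$1$2 * (2 * pdv 1 2 (half_box (component i f)) Z) + e$2$1 * (2 * pdv 2 1 (half_box (component i f)) Z)
      + e$2$2 * (2 * pdv 2 2 (half_box (component i f)) Z)" for e i
    unfolding entry_pd_def vec_lambda_beta c p ..
  have n: "nabla_right (laplacian f) Z $ 1 = 4 * (pdv 1 1 (half_box (component 1 f)) Z + pdv 1 2 (half_box (component 2 f)) Z)"
    "nabla_right (laplacian f) Z $ 2 = 4 * (pdv 2 1 (half_box (component 1 f)) Z + pdv 2 2 (half_box (component 2 f)) Z)"
    unfolding nabla_right_def pd vector_minus_component vector_matrix_mult_2 d e_entries by (simp_all add: algebra_simps)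
  have "(4 *s right_op f Z) $ 1 = (N Z *s (nabla_right (laplacian f) Z v* Z)) $ 1" "(4 *s right_op f Z) $ 2 = (N Z *s (nabla_right (laplacian f) Z v* Z)) $ 2"
    unfolding vector_smult_component vector_matrix_mult_2 n right_op_def Let_def pair_component colop_def
    by (simp_all add: algebra_simps)
  then show ?thesis by (simp only: vec_eq_iff forall_2 simp_thms)
qed

lemma left_op_outside: "N Z = 0 \<Longrightarrow> left_op f Z = 0" "N Z = 0 \<Longrightarrow> right_op f Z = 0"
  by (simp_all add: left_op_def right_op_def Let_def vec_eq_iff forall_2)

text \<open>
The factor 4 matches \<open>left_op_eq\<close> and \<open>right_op_eq\<close>, which hold on the invertible matrices.
\<close>

lemma zero_iff_scaled_zero:
  assumes "\<And>Z. N Z = 0 \<Longrightarrow> f Z = 0"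
  shows "f = (0::qfun) \<longleftrightarrow> (\<forall>Z. N Z \<noteq> 0 \<longrightarrow> 4 *s f Z = 0)"
proof -
  have "f = 0 \<longleftrightarrow> (\<forall>Z. f Z = 0)" by (simp only: fun_eq_iff zero_fun_apply)
  then show ?thesis using assms by auto
qed

lemma \<U>_eq: "\<U> = {f \<in> laurent2. left_op f = 0}"
proof -
  have "(\<forall>Z. N Z \<noteq> 0 \<longrightarrow> nabla_left (laplacian f) Z = 0) \<longleftrightarrow> left_op f = 0" if f: "f \<in> laurent2" for f
  proof -
    have "left_op f = 0 \<longleftrightarrow> (\<forall>Z. N Z \<noteq> 0 \<longrightarrow> 4 *s left_op f Z = 0)"
      by (rule zero_iff_scaled_zero) (rule left_op_outside)
    also have "\<dots> \<longleftrightarrow> (\<forall>Z. N Z \<noteq> 0 \<longrightarrow> nabla_left (laplacian f) Z = 0)"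
      using f by (simp add: left_op_eq invertible_kernel)
    finally show ?thesis by blast
  qed
  then show ?thesis unfolding \<U>_def laurent2_def by blast
qed

lemma \<U>'_eq: "\<U>' = {f \<in> laurent2. right_op f = 0}"
proof -
  have "(\<forall>Z. N Z \<noteq> 0 \<longrightarrow> nabla_right (laplacian f) Z = 0) \<longleftrightarrow> right_op f = 0" if f: "f \<in> laurent2" for f
  proof -
    have "right_op f = 0 \<longleftrightarrow> (\<forall>Z. N Z \<noteq> 0 \<longrightarrow> 4 *s right_op f Z = 0)"
      by (rule zero_iff_scaled_zero) (rule left_op_outside)
    also have "\<dots> \<longleftrightarrow> (\<forall>Z. N Z \<noteq> 0 \<longrightarrow> nabla_right (laplacian f) Z = 0)"
      using f by (simp add: right_op_eq invertible_kernel)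
    finally show ?thesis by blast
  qed
  then show ?thesis unfolding \<U>'_def laurent2_def by blast
qed

lemma rowop_add: "F \<in> laurent \<Longrightarrow> G \<in> laurent \<Longrightarrow> rowop c a (\<lambda>Z. F Z + G Z) Z = rowop c a F Z + rowop c a G Z"
  by (simp add: rowop_def pdv_add algebra_simps)
lemma rowop_cmult: "F \<in> laurent \<Longrightarrow> rowop c a (\<lambda>Z. r * F Z) Z = r * rowop c a F Z"
  by (simp add: rowop_def pdv_cmult algebra_simps)
lemma colop_add: "F \<in> laurent \<Longrightarrow> G \<in> laurent \<Longrightarrow> colop c a (\<lambda>Z. F Z + G Z) Z = colop c a F Z + colop c a G Z"
  by (simp add: colop_def pdv_add algebra_simps)
lemma colop_cmult: "F \<in> laurent \<Longrightarrow> colop c a (\<lambda>Z. r * F Z) Z = r * colop c a F Z"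
  by (simp add: colop_def pdv_cmult algebra_simps)

lemma left_op_add: "f \<in> laurent2 \<Longrightarrow> g \<in> laurent2 \<Longrightarrow> left_op (f + g) = left_op f + left_op g"
  by (rule qfun_eqI)
    (simp_all add: left_op_def Let_def half_box_add rowop_add laurent_half_box laurent2_component algebra_simps)
lemma right_op_add: "f \<in> laurent2 \<Longrightarrow> g \<in> laurent2 \<Longrightarrow> right_op (f + g) = right_op f + right_op g"
  by (rule qfun_eqI)
    (simp_all add: right_op_def Let_def half_box_add colop_add laurent_half_box laurent2_component algebra_simps)
lemma left_op_scale: "f \<in> laurent2 \<Longrightarrow> left_op (fscale c f) = fscale c (left_op f)"
  by (rule qfun_eqI)
    (simp_all add: left_op_def Let_def half_box_cmult rowop_cmult laurent_half_box laurent2_component algebra_simps)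
lemma right_op_scale: "f \<in> laurent2 \<Longrightarrow> right_op (fscale c f) = fscale c (right_op f)"
  by (rule qfun_eqI)
    (simp_all add: right_op_def Let_def half_box_cmult colop_cmult laurent_half_box laurent2_component algebra_simps)

text \<open>
For \<open>b = 0\<close> the pairs \<open>left_regular\<close> and \<open>right_regular\<close> satisfy \<open>\<nabla>f = 0\<close> and \<open>g\<nabla> = 0\<close>,
while \<open>f \<mapsto> Z\<nabla>f\<close> and \<open>g \<mapsto> (g\<nabla>)Z\<close> act on the other two kinds by twice one more than their degree.
Natural number subtraction in the indices is harmless because of the coefficients \<open>k\<close> and \<open>p\<close>.
\<close>

definition left_regular :: "int \<Rightarrow> nat \<Rightarrow> nat \<Rightarrow> int \<Rightarrow> qfun" where
  "left_regular b p k q = pair (Ntpoly b p k q) (\<lambda>Z. - 1 * Ntpoly b p k (q - 1) Z)"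
definition left_coregular :: "int \<Rightarrow> nat \<Rightarrow> nat \<Rightarrow> int \<Rightarrow> qfun" where
  "left_coregular b p k q = pair (\<lambda>Z. of_int q * Ntpoly b p k q Z) (\<lambda>Z. of_int (int (p + k) + 1 - q) * Ntpoly b p k (q - 1) Z)"
definition right_regular :: "int \<Rightarrow> nat \<Rightarrow> nat \<Rightarrow> int \<Rightarrow> qfun" where
  "right_regular b p k q = pair (\<lambda>Z. of_nat k * Ntpoly b p (k - 1) q Z) (\<lambda>Z. (- of_nat p) * Ntpoly b (p - 1) k q Z)"
definition right_coregular :: "int \<Rightarrow> nat \<Rightarrow> nat \<Rightarrow> int \<Rightarrow> qfun" where
  "right_coregular b p k q = pair (Ntpoly b (Suc p) k q) (Ntpoly b p (Suc k) q)"

lemma laurent2_basis: "left_regular b p k q \<in> laurent2" "left_coregular b p k q \<in> laurent2" "right_regular b p k q \<in> laurent2" "right_coregular b p k q \<in> laurent2"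
  unfolding left_regular_def left_coregular_def right_regular_def right_coregular_def by (intro laurent2_pair laurent_cmult laurent_Ntpoly)+

lemma Ntpoly_minus: "N Z * Ntpoly (b - 1) p k q Z = Ntpoly b p k q Z"
  by (cases "N Z = 0") (simp_all add: Ntpoly_apply flip: N_powi_minus_1[of Z b])

lemma half_box_scaled_Ntpoly:
  "half_box (\<lambda>Z. c * Ntpoly b p k q Z) = (\<lambda>Z. (c * (2 * of_int (b * (b + 1 + int (p + k))))) * Ntpoly (b - 1) p k q Z)"
  by (simp add: half_box_cmult[OF laurent_Ntpoly] half_box_Ntpoly mult.assoc)

lemma rowop_scaled_Ntpoly: "rowop i j (\<lambda>Z. c * Ntpoly b p k q Z) Z = c * rowop i j (Ntpoly b p k q) Z"
  by (rule rowop_cmult[OF laurent_Ntpoly])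

lemma colop_scaled_Ntpoly: "colop i j (\<lambda>Z. c * Ntpoly b p k q Z) Z = c * colop i j (Ntpoly b p k q) Z"
  by (rule colop_cmult[OF laurent_Ntpoly])

lemma left_op_pair:
  "left_op (pair (\<lambda>Z. c * Ntpoly b p k q Z) (\<lambda>Z. d * Ntpoly b p k (q - 1) Z)) =
   fscale (of_int (2 * b * (b + 1 + int (p + k))))
    (pair (\<lambda>Z. (c * of_int (b - 1 + q) + d * of_int q) * Ntpoly b p k q Z)
          (\<lambda>Z. (c * of_int (int (p + k) - q + 1) + d * of_int (b + int (p + k) - q)) * Ntpoly b p k (q - 1) Z))"
proof (rule qfun_eqI; unfold fscale_component left_op_def Let_def pair_component half_box_scaled_Ntpoly rowop_scaled_Ntpoly rowop_Ntpoly_values)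
  fix Z
  show "N Z * (c * (2 * of_int (b * (b + 1 + int (p + k)))) * (of_int (b - 1 + q) * Ntpoly (b - 1) p k q Z) +
      d * (2 * of_int (b * (b + 1 + int (p + k)))) * (of_int (q - 1 + 1) * Ntpoly (b - 1) p k (q - 1 + 1) Z)) =
    of_int (2 * b * (b + 1 + int (p + k))) * ((c * of_int (b - 1 + q) + d * of_int q) * Ntpoly b p k q Z)"
    unfolding Ntpoly_minus[of Z b, symmetric] by (simp add: algebra_simps)
  show "N Z * (c * (2 * of_int (b * (b + 1 + int (p + k)))) * (of_int (int (p + k) - q + 1) * Ntpoly (b - 1) p k (q - 1) Z) +
      d * (2 * of_int (b * (b + 1 + int (p + k)))) * (of_int (b - 1 + int (p + k) - (q - 1)) * Ntpoly (b - 1) p k (q - 1) Z)) =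
    of_int (2 * b * (b + 1 + int (p + k))) * ((c * of_int (int (p + k) - q + 1) + d * of_int (b + int (p + k) - q)) * Ntpoly b p k (q - 1) Z)"
    unfolding Ntpoly_minus[of Z b, symmetric] by (simp add: algebra_simps)
qed

text \<open>
The factors \<open>b\<close> and \<open>b + 1 + p + k\<close> come from \<open>\<box>\<close>, the last one from \<open>Z\<nabla>\<close> acting on the power \<open>b - 1\<close> of
\<open>N\<close>.
\<close>

lemma left_op_left_regular: "left_op (left_regular b p k q) = fscale (of_int (2 * b * (b + 1 + int (p + k)) * (b - 1))) (left_regular b p k q)"
proof -
  have left_regular: "left_regular b p k q = pair (\<lambda>Z. 1 * Ntpoly b p k q Z) (\<lambda>Z. (-1) * Ntpoly b p k (q - 1) Z)"
    by (simp add: left_regular_def)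
  show ?thesis unfolding left_regular left_op_pair by (rule qfun_eqI) (simp_all add: algebra_simps)
qed

lemma left_op_left_coregular: "left_op (left_coregular b p k q) = fscale (of_int (2 * b * (b + 1 + int (p + k)) * (b + int (p + k)))) (left_coregular b p k q)"
  unfolding left_coregular_def left_op_pair by (rule qfun_eqI) (simp_all add: algebra_simps)

section \<open>Bases of pairs of Laurent polynomials\<close>

lemma right_op_right_regular: "right_op (right_regular b p k q) = fscale (of_int (2 * b * (b + int (p + k)) * (b - 1))) (right_regular b p k q)"
proof (rule qfun_eqI; unfold fscale_component right_op_def right_regular_def Let_def pair_component half_box_scaled_Ntpoly colop_scaled_Ntpoly colop_Ntpoly_values)
  fix Z
  show "N Z *
         (of_nat k * (2 * of_int (b * (b + 1 + int (p + (k - 1))))) * (of_int (b - 1 + int p) * Ntpoly (b - 1) p (k - 1) q Z) +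
          (- of_nat p) * (2 * of_int (b * (b + 1 + int (p - 1 + k)))) * (of_nat k * Ntpoly (b - 1) (Suc (p - 1)) (k - 1) q Z)) =
         of_int (2 * b * (b + int (p + k)) * (b - 1)) * (of_nat k * Ntpoly b p (k - 1) q Z)"
    unfolding Ntpoly_minus[of Z b, symmetric]
    by (cases p; cases k) (simp_all add: algebra_simps)
  show "N Z *
         (of_nat k * (2 * of_int (b * (b + 1 + int (p + (k - 1))))) * (of_nat p * Ntpoly (b - 1) (p - 1) (Suc (k - 1)) q Z) +
          (- of_nat p) * (2 * of_int (b * (b + 1 + int (p - 1 + k)))) * (of_int (b - 1 + int k) * Ntpoly (b - 1) (p - 1) k q Z)) =
         of_int (2 * b * (b + int (p + k)) * (b - 1)) * ((- of_nat p) * Ntpoly b (p - 1) k q Z)"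
    unfolding Ntpoly_minus[of Z b, symmetric]
    by (cases p; cases k) (simp_all add: algebra_simps)
qed

lemma right_op_right_coregular: "right_op (right_coregular b p k q) = fscale (of_int (2 * b * (b + 2 + int (p + k)) * (b + 1 + int (p + k)))) (right_coregular b p k q)"
proof (rule qfun_eqI; unfold fscale_component right_op_def right_coregular_def Let_def pair_component half_box_Ntpoly colop_scaled_Ntpoly colop_Ntpoly_values)
  fix Z
  show "N Z *
         (2 * of_int (b * (b + 1 + int (Suc p + k))) * (of_int (b - 1 + int (Suc p)) * Ntpoly (b - 1) (Suc p) k q Z) +
          2 * of_int (b * (b + 1 + int (p + Suc k))) * (of_nat (Suc k) * Ntpoly (b - 1) (Suc p) (Suc k - 1) q Z)) =
         of_int (2 * b * (b + 2 + int (p + k)) * (b + 1 + int (p + k))) * Ntpoly b (Suc p) k q Z"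
    unfolding Ntpoly_minus[of Z b, symmetric] by (simp add: algebra_simps)
  show "N Z *
         (2 * of_int (b * (b + 1 + int (Suc p + k))) * (of_nat (Suc p) * Ntpoly (b - 1) (Suc p - 1) (Suc k) q Z) +
          2 * of_int (b * (b + 1 + int (p + Suc k))) * (of_int (b - 1 + int (Suc k)) * Ntpoly (b - 1) p (Suc k) q Z)) =
         of_int (2 * b * (b + 2 + int (p + k)) * (b + 1 + int (p + k))) * Ntpoly b p (Suc k) q Z"
    unfolding Ntpoly_minus[of Z b, symmetric] by (simp add: algebra_simps)
qed

definition left_basis :: "qfun set" where "left_basis = {left_regular b p k q | b p k q. True} \<union> {left_coregular b p k q | b p k q. True}"
definition right_basis :: "qfun set" where "right_basis = {right_regular b p k q | b p k q. True} \<union> {right_coregular b p k q | b p k q. True}"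

lemma span_unscale:
  assumes "fscale c f \<in> qfun.span B" "c \<noteq> 0" shows "f \<in> qfun.span B"
proof -
  have "fscale (inverse c) (fscale c f) \<in> qfun.span B" using assms(1) by (rule qfun.span_scale)
  moreover have "inverse c * c = 1" using assms(2) by simp
  ultimately show ?thesis by (simp only: qfun.scale_scale qfun.scale_one)
qed

lemma laurent2_subset_span:
  assumes 1: "\<And>b p k q. pair (Ntpoly b p k q) (\<lambda>_. 0) \<in> qfun.span B"
    and 2: "\<And>b p k q. pair (\<lambda>_. 0) (Ntpoly b p k q) \<in> qfun.span B"
  shows "laurent2 \<subseteq> qfun.span B"
proof
  fix f assume f: "f \<in> laurent2"
  have "pair F (\<lambda>_. 0) \<in> qfun.span B \<and> pair (\<lambda>_. 0) F \<in> qfun.span B" if "F \<in> Nspan" for F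
    using that
  proof (induction rule: Nspan.induct)
    case (Nspan_Ntpoly b p k q)
    then show ?case using 1 2 by blast
  next
    case (Nspan_add F G)
    have "pair (\<lambda>Z. F Z + G Z) (\<lambda>_. 0) = pair F (\<lambda>_. 0) + pair G (\<lambda>_. 0)"
      "pair (\<lambda>_. 0) (\<lambda>Z. F Z + G Z) = pair (\<lambda>_. 0) F + pair (\<lambda>_. 0) G"
      by (rule qfun_eqI; simp)+
    then show ?case using Nspan_add by (simp only: qfun.span_add simp_thms)
  next
    case (Nspan_cmult F c)
    have "pair (\<lambda>Z. c * F Z) (\<lambda>_. 0) = fscale c (pair F (\<lambda>_. 0))"
      "pair (\<lambda>_. 0) (\<lambda>Z. c * F Z) = fscale c (pair (\<lambda>_. 0) F)"
      by (rule qfun_eqI; simp)+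
    then show ?case using Nspan_cmult by (simp only: qfun.span_scale simp_thms)
  qed
  then have "pair (component 1 f) (\<lambda>_. 0) + pair (\<lambda>_. 0) (component 2 f) \<in> qfun.span B"
    using f by (intro qfun.span_add) (simp_all add: laurent_Nspan laurent2_component)
  also have "pair (component 1 f) (\<lambda>_. 0) + pair (\<lambda>_. 0) (component 2 f) = f"
    by (rule qfun_eqI) simp_all
  finally show "f \<in> qfun.span B" .
qed

text \<open>
The two kinds of pairs at the same indices form a system of determinant \<open>p + k + 1\<close>, so it can be
solved for the pairs with a single nonzero component.
\<close>

lemma laurent2_span_left_basis: "laurent2 \<subseteq> qfun.span left_basis"
proof (rule laurent2_subset_span)
  fix b p k q
  have F: "left_regular b p k q \<in> qfun.span left_basis" "left_coregular b p k q \<in> qfun.span left_basis" for q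
    unfolding left_basis_def by (rule qfun.span_base, blast)+
  have nz: "(of_nat (p + k + 1) :: complex) \<noteq> 0" by (simp only: of_nat_eq_0_iff)
  have "fscale (of_nat (p + k + 1)) (pair (Ntpoly b p k q) (\<lambda>_. 0)) =
     fscale (of_int (int (p + k) + 1 - q)) (left_regular b p k q) + left_coregular b p k q"
    by (rule qfun_eqI) (simp_all add: left_regular_def left_coregular_def algebra_simps)
  then have "fscale (of_nat (p + k + 1)) (pair (Ntpoly b p k q) (\<lambda>_. 0)) \<in> qfun.span left_basis"
    using F by (simp only: qfun.span_add qfun.span_scale)
  then show "pair (Ntpoly b p k q) (\<lambda>_. 0) \<in> qfun.span left_basis" using nz by (rule span_unscale)
  have "fscale (of_nat (p + k + 1)) (pair (\<lambda>_. 0) (Ntpoly b p k q)) =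
     fscale (of_int (- q - 1)) (left_regular b p k (q + 1)) + left_coregular b p k (q + 1)"
    by (rule qfun_eqI) (simp_all add: left_regular_def left_coregular_def algebra_simps)
  then have "fscale (of_nat (p + k + 1)) (pair (\<lambda>_. 0) (Ntpoly b p k q)) \<in> qfun.span left_basis"
    using F by (simp only: qfun.span_add qfun.span_scale)
  then show "pair (\<lambda>_. 0) (Ntpoly b p k q) \<in> qfun.span left_basis" using nz by (rule span_unscale)
qed

lemma laurent2_span_right_basis: "laurent2 \<subseteq> qfun.span right_basis"
proof (rule laurent2_subset_span)
  fix b p k q
  have F: "right_regular b p k q \<in> qfun.span right_basis" "right_coregular b p k q \<in> qfun.span right_basis" for p k
    unfolding right_basis_def by (rule qfun.span_base, blast)+
  have nz: "(of_nat (p + k + 1) :: complex) \<noteq> 0" by (simp only: of_nat_eq_0_iff)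
  have "fscale (of_nat (p + k + 1)) (pair (Ntpoly b p k q) (\<lambda>_. 0)) =
     fscale (of_nat p) (right_coregular b (p - 1) k q) + right_regular b p (Suc k) q"
    by (cases p; rule qfun_eqI) (simp_all add: right_regular_def right_coregular_def algebra_simps)
  then have "fscale (of_nat (p + k + 1)) (pair (Ntpoly b p k q) (\<lambda>_. 0)) \<in> qfun.span right_basis"
    using F by (simp only: qfun.span_add qfun.span_scale)
  then show "pair (Ntpoly b p k q) (\<lambda>_. 0) \<in> qfun.span right_basis" using nz by (rule span_unscale)
  have "fscale (of_nat (p + k + 1)) (pair (\<lambda>_. 0) (Ntpoly b p k q)) =
     fscale (of_nat k) (right_coregular b p (k - 1) q) + fscale (- 1) (right_regular b (Suc p) k q)"
    by (cases k; rule qfun_eqI) (simp_all add: right_regular_def right_coregular_def algebra_simps)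
  then have "fscale (of_nat (p + k + 1)) (pair (\<lambda>_. 0) (Ntpoly b p k q)) \<in> qfun.span right_basis"
    using F by (simp only: qfun.span_add qfun.span_scale)
  then show "pair (\<lambda>_. 0) (Ntpoly b p k q) \<in> qfun.span right_basis" using nz by (rule span_unscale)
qed

section \<open>Homogeneous components\<close>

lemma N_mscale: "N (mscale c Z) = c ^ 2 * N Z"
  by (simp add: N_eq mscale_def power2_eq_square algebra_simps)

lemma tpoly_mscale: "tpoly p k q (mscale c Z) = c ^ (p + k) * tpoly p k q Z"
proof (induction p k arbitrary: q rule: tpoly_induct)
  case 0 then show ?case by (simp add: tpoly_0)
next
  case (1 p k) then show ?case by (simp add: tpoly_Suc1 mscale_def algebra_simps)
next
  case (2 k) then show ?case by (simp add: tpoly_Suc2 mscale_def algebra_simps)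
qed

lemma Ntpoly_mscale:
  assumes "c \<noteq> 0"
  shows "Ntpoly b p k q (mscale c Z) = c powi (2 * b + int (p + k)) * Ntpoly b p k q Z"
proof -
  have "c powi (2 * b) = (c ^ 2) powi b"
    using power_int_mult[of c 2 b] by simp
  moreover have "c powi (2 * b + int (p + k)) = c powi (2 * b) * c ^ (p + k)"
    using power_int_add[of c "2 * b" "int (p + k)"] assms by (simp only: power_int_of_nat simp_thms)
  ultimately have "c powi (2 * b + int (p + k)) = (c ^ 2) powi b * c ^ (p + k)" by simp
  then show ?thesis
    using assms by (simp add: Ntpoly_apply N_mscale tpoly_mscale power_int_mult_distrib)
qed

lemma homogeneous_pair:
  assumes "\<And>c Z. c \<noteq> 0 \<Longrightarrow> N Z \<noteq> 0 \<Longrightarrow> F (mscale c Z) = c powi d * F Z"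
     "\<And>c Z. c \<noteq> 0 \<Longrightarrow> N Z \<noteq> 0 \<Longrightarrow> G (mscale c Z) = c powi d * G Z"
  shows "homogeneous d (pair F G)"
  unfolding homogeneous_def vec_eq_iff forall_2 vector_smult_component pair_component
  using assms by blast

lemma homogeneous_basis:
  "homogeneous (2 * b + int (p + k)) (left_regular b p k q)"
  "homogeneous (2 * b + int (p + k)) (left_coregular b p k q)"
  "homogeneous (2 * b + int (p + k) - 1) (right_regular b p k q)"
  "homogeneous (2 * b + int (p + k) + 1) (right_coregular b p k q)"
proof -
  show "homogeneous (2 * b + int (p + k)) (left_regular b p k q)"
    "homogeneous (2 * b + int (p + k)) (left_coregular b p k q)"
    unfolding left_regular_def left_coregular_def by (rule homogeneous_pair; simp add: Ntpoly_mscale)+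
  show "homogeneous (2 * b + int (p + k) + 1) (right_coregular b p k q)"
    unfolding right_coregular_def by (rule homogeneous_pair; simp add: Ntpoly_mscale algebra_simps)+
  show "homogeneous (2 * b + int (p + k) - 1) (right_regular b p k q)"
    unfolding right_regular_def by (rule homogeneous_pair; cases p; cases k; simp add: Ntpoly_mscale algebra_simps)+
qed

lemma laurent2_outside: "f \<in> laurent2 \<Longrightarrow> N Z = 0 \<Longrightarrow> f Z = 0"
  using laurent_outside[OF laurent2_component] by (simp add: vec_eq_iff)

text \<open>
Dilation by 2 suffices to separate the degrees, as the integral powers of 2 are distinct.
\<close>

definition degree_op :: "int \<Rightarrow> qfun \<Rightarrow> qfun" where
  "degree_op d f = (\<lambda>Z. f (mscale 2 Z) - (2 powi d) *s f Z)"

lemma degree_op_homogeneous: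
  assumes "f \<in> laurent2" "homogeneous e f"
  shows "degree_op d f = fscale (2 powi e - 2 powi d) f"
proof
  fix Z
  show "degree_op d f Z = fscale (2 powi e - 2 powi d) f Z"
    using assms laurent2_outside[OF assms(1), of Z] laurent2_outside[OF assms(1), of "mscale 2 Z"]
    by (cases "N Z = 0") (simp_all add: degree_op_def homogeneous_def fscale_def N_mscale vec_eq_iff algebra_simps)
qed

lemma powi_2_eq: "(2::complex) powi d = 2 powi e \<longleftrightarrow> d = e"
proof
  assume "(2::complex) powi d = 2 powi e"
  then have "norm ((2::complex) powi d) = norm ((2::complex) powi e)" by simp
  then have "(2::real) powi d = 2 powi e" by (simp add: norm_power_int)
  then show "d = e" using power_int_strict_increasing[of d e "2::real"] power_int_strict_increasing[of e d "2::real"]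
    by (cases d e rule: linorder_cases) auto
qed simp

lemma degree_op_zero_iff:
  assumes "f \<in> laurent2" "homogeneous e f"
  shows "degree_op d f = 0 \<longleftrightarrow> f = 0 \<or> d = e"
  unfolding degree_op_homogeneous[OF assms] by (simp only: qfun.scale_eq_0_iff right_minus_eq powi_2_eq) blast

text \<open>
Two diagonal operators, one after the other: the first removes the vectors of wrong degree, the
second those not annihilated by \<open>Q\<close>.
\<close>

lemma homogeneous_kernel:
  assumes B: "B \<subseteq> laurent2" "laurent2 \<subseteq> qfun.span B"
    and hom: "\<And>b. b \<in> B \<Longrightarrow> \<exists>e. homogeneous e b"
    and Q: "\<And>f g. f \<in> laurent2 \<Longrightarrow> g \<in> laurent2 \<Longrightarrow> Q (f + g) = Q f + Q g"
      "\<And>c f. f \<in> laurent2 \<Longrightarrow> Q (fscale c f) = fscale c (Q f)"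
      "\<And>b. b \<in> B \<Longrightarrow> \<exists>\<mu>. Q b = fscale \<mu> b"
    and f: "f \<in> laurent2" "homogeneous d f" "Q f = 0"
  shows "f \<in> qfun.span {b \<in> B. degree_op d b = 0 \<and> Q b = 0}"
proof -
  have "f \<in> qfun.span {b \<in> B. degree_op d b = 0}"
  proof (rule diagonal_kernel[where S = UNIV])
    show "degree_op d (f + g) = degree_op d f + degree_op d g" "degree_op d (fscale c f) = fscale c (degree_op d f)" for f g c
      by (rule qfun_eqI; simp add: degree_op_def algebra_simps)+
    show "\<exists>\<mu>. degree_op d b = fscale \<mu> b" if "b \<in> B" for b
      using degree_op_homogeneous hom[OF that] that B(1) by blast
    show "degree_op d f = 0" using degree_op_zero_iff f by blast
  qed (use f B in auto)
  moreover have "{b \<in> B. degree_op d b = 0} \<subseteq> laurent2" using B by blast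
  moreover have "\<exists>\<mu>. Q b = fscale \<mu> b" if "b \<in> {b \<in> B. degree_op d b = 0}" for b
    using Q(3) that by blast
  ultimately have "f \<in> qfun.span {b \<in> {b \<in> B. degree_op d b = 0}. Q b = 0}"
    using diagonal_kernel[OF laurent2_subspace Q(1) Q(2)] f(3) by blast
  then show ?thesis by (simp only: mem_Collect_eq conj_assoc)
qed

section \<open>The infinitesimal actions\<close>

lemma forall_sum: "(\<forall>x. P x) \<longleftrightarrow> (\<forall>a. P (Inl a)) \<and> (\<forall>b. P (Inr b))" for P :: "'a + 'b \<Rightarrow> bool"
  by (metis sum.exhaust)

lemma mscale_entry: "mscale c M $ i $ j = c * M $ i $ j"
  by (simp add: mscale_def)

lemma sum_UNIV_sum: "(\<Sum>x\<in>UNIV. f x) = (\<Sum>a\<in>UNIV. f (Inl a)) + (\<Sum>b\<in>UNIV. f (Inr b))"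
  for f :: "'a::finite + 'b::finite \<Rightarrow> 'c::comm_monoid_add"
  by (subst UNIV_Plus_UNIV[symmetric], subst sum.Plus) simp_all

lemma block_diag_mult: "block_diag P Q ** block_diag P' Q' = block_diag (P ** P') (Q ** Q')"
  by (simp add: vec_eq_iff forall_sum matrix_matrix_mult_def sum_UNIV_sum block_diag_def)

lemma block_diag_mat_1: "block_diag (mat 1) (mat 1) = mat 1"
  by (simp add: vec_eq_iff forall_sum block_diag_def mat_def)

lemma block_diag_line:
  "mat 1 + mscale w (block_diag A D) = block_diag (mat 1 + mscale w A) (mat 1 + mscale w D)"
  by (simp add: vec_eq_iff forall_sum block_diag_def mat_def mscale_def)

lemma blocks_block_diag:
  "block11 (block_diag P Q) = P" "block12 (block_diag P Q) = 0"
  "block21 (block_diag P Q) = 0" "block22 (block_diag P Q) = Q"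
  by (simp_all add: vec_eq_iff block11_def block12_def block21_def block22_def block_diag_def)

text \<open>
Cramer's rule.
\<close>

definition inv2 :: "quat \<Rightarrow> quat" where
  "inv2 a = (\<chi> i j. (if i = 1 then (if j = 1 then a$2$2 else - a$1$2)
      else (if j = 1 then - a$2$1 else a$1$1)) / N a)"

lemma inv2_entries: "inv2 a $ 1 $ 1 = a$2$2 / N a" "inv2 a $ 1 $ 2 = - a$1$2 / N a"
  "inv2 a $ 2 $ 1 = - a$2$1 / N a" "inv2 a $ 2 $ 2 = a$1$1 / N a"
  by (simp_all add: inv2_def)

lemma matrix_mult_2: "((A :: quat) ** B) $ i $ j = A$i$1 * B$1$j + A$i$2 * B$2$j"
  by (simp add: matrix_matrix_mult_def sum_2)

lemma inv2_inverse:
  assumes "N a \<noteq> 0"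
  shows "a ** inv2 a = mat 1" "inv2 a ** a = mat 1" 
proof -
  have n: "N a = a$1$1 * a$2$2 - a$1$2 * a$2$1" by (rule N_eq)
  show "a ** inv2 a = mat 1" "inv2 a ** a = mat 1" 
    using assms by (simp_all add: vec_eq_iff forall_2 matrix_mult_2 inv2_entries mat_def field_simps)
      (simp_all add: n algebra_simps)
qed

lemma matrix_inv_eq:
  assumes "A ** B = mat 1" "B ** A = mat 1" shows "matrix_inv A = (B :: complex^'n^'n)"
proof -
  have "A ** matrix_inv A = mat 1 \<and> matrix_inv A ** A = mat 1"
    unfolding matrix_inv_def by (rule someI[of _ B]) (simp add: assms)
  then have "matrix_inv A = matrix_inv A ** (A ** B)" "matrix_inv A ** A = mat 1"
    by (simp_all add: assms)
  then show ?thesis by (metis matrix_mul_assoc matrix_mul_lid)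
qed

lemma N_inv2: "N a \<noteq> 0 \<Longrightarrow> N (inv2 a) = 1 / N a"
  using det_mul[of a "inv2 a"] by (simp add: inv2_inverse field_simps)

text \<open>
The derivation with \<open>X Z = Z D - A Z\<close>.
\<close>

definition orbit_deriv :: "quat \<Rightarrow> quat \<Rightarrow> (quat \<Rightarrow> complex) \<Rightarrow> quat \<Rightarrow> complex" where
  "orbit_deriv A D F Z = D$1$1 * colop 1 1 F Z + D$2$1 * colop 2 1 F Z + D$1$2 * colop 1 2 F Z + D$2$2 * colop 2 2 F Z
    - (A$1$1 * rowop 1 1 F Z + A$1$2 * rowop 2 1 F Z + A$2$1 * rowop 1 2 F Z + A$2$2 * rowop 2 2 F Z)"

text \<open>
The differentials of \<open>\<pi>\<^sub>l\<close> and \<open>\<pi>\<^sub>r\<close> at block diagonal matrices with traceless blocks. The factor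
\<open>N(a')\<close> has derivative \<open>0\<close> because of the vanishing trace, and inversion gives \<open>- D\<close> in the right
action.
\<close>

definition act_left :: "quat \<Rightarrow> quat \<Rightarrow> qfun \<Rightarrow> qfun" where
  "act_left A D f = pair (\<lambda>Z. A$1$1 * f Z $ 1 + A$1$2 * f Z $ 2 + orbit_deriv A D (component 1 f) Z)
     (\<lambda>Z. A$2$1 * f Z $ 1 + A$2$2 * f Z $ 2 + orbit_deriv A D (component 2 f) Z)"

definition act_right :: "quat \<Rightarrow> quat \<Rightarrow> qfun \<Rightarrow> qfun" where
  "act_right A D f = pair (\<lambda>Z. orbit_deriv A D (component 1 f) Z - (D$1$1 * f Z $ 1 + D$2$1 * f Z $ 2))
     (\<lambda>Z. orbit_deriv A D (component 2 f) Z - (D$1$2 * f Z $ 1 + D$2$2 * f Z $ 2))"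

text \<open>
The argument of \<open>f\<close> in \<open>\<pi>\<^sub>l\<close> along \<open>1 + w X\<close>; it coincides with the argument of \<open>g\<close> in \<open>\<pi>\<^sub>r\<close>, where
the blocks of the inverse matrix appear.
\<close>

definition orbit :: "quat \<Rightarrow> quat \<Rightarrow> quat \<Rightarrow> complex \<Rightarrow> quat" where
  "orbit A D Z w = inv2 (mat 1 + mscale w A) ** (Z ** (mat 1 + mscale w D))"

lemma sl2_trace: "A \<in> sl2 \<Longrightarrow> A$2$2 = - A$1$1"
  by (simp add: sl2_def qRe_def trace_def sum_2 eq_neg_iff_add_eq_0 add.commute)

lemma line_entries:
  "(mat 1 + mscale w A) $ 1 $ 1 = 1 + w * A$1$1" "(mat 1 + mscale w A) $ 1 $ 2 = w * A$1$2"
  "(mat 1 + mscale w A) $ 2 $ 1 = w * A$2$1" "(mat 1 + mscale w A) $ 2 $ 2 = 1 + w * A$2$2" for A :: quat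
  by (simp_all add: mat_def mscale_def)

lemma N_line_deriv:
  assumes "A \<in> sl2"
  shows "((\<lambda>w. N (mat 1 + mscale w A)) has_field_derivative 0) (at 0)"
  unfolding N_eq line_entries
  by (rule derivative_eq_intros refl)+ (simp add: sl2_trace[OF assms])

lemma N_line_0: "N (mat 1 + mscale 0 A) = 1"
  unfolding N_eq line_entries by simp

lemma inverse_N_line_deriv:
  assumes "A \<in> sl2"
  shows "((\<lambda>w. 1 / N (mat 1 + mscale w A)) has_field_derivative 0) (at 0)"
  by (rule DERIV_cong[OF DERIV_divide[OF DERIV_const N_line_deriv[OF assms]]]) (simp_all add: N_line_0)

lemma eventually_N_line:
  "eventually (\<lambda>w. N (mat 1 + mscale w A) \<noteq> 0) (nhds 0)"
  by (rule eventually_invertible[where h = "\<lambda>i j. A $ i $ j"])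
    (simp only: N_line_0 zero_neq_one[symmetric] not_False_eq_True, rule line_deriv)

lemma orbit_0: "orbit A D Z 0 = Z"
  by (simp add: vec_eq_iff forall_2 orbit_def matrix_mult_2 inv2_entries line_entries N_line_0 del: vector_add_component)

lemma orbit_curve_deriv:
  assumes A: "A \<in> sl2"
  shows "((\<lambda>w. orbit A D Z w $ i $ j) has_field_derivative (Z ** D - A ** Z) $ i $ j) (at 0)"
proof -
  have d: "((\<lambda>w. (Z ** (mat 1 + mscale w D)) $ i $ j) has_field_derivative (Z ** D) $ i $ j) (at 0)" for i j
    using exhaust_2[of i] exhaust_2[of j]
    by (auto simp: matrix_mult_2 line_entries simp del: vector_add_component intro!: derivative_eq_intros)
  have a: "((\<lambda>w. orbit A D Z w $ i $ j) has_field_derivative d) (at 0)"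
    if "\<And>w. orbit A D Z w $ i $ j = 1 / N (mat 1 + mscale w A) * 
       ((c + w * x) * (Z ** (mat 1 + mscale w D)) $ 1 $ j + (c' + w * y) * (Z ** (mat 1 + mscale w D)) $ 2 $ j)"
      "d = x * Z$1$j + c * (Z ** D)$1$j + (y * Z$2$j + c' * (Z ** D)$2$j)" for c x c' y d i j
    unfolding that(1)
    by (rule derivative_eq_intros d inverse_N_line_deriv[OF A] refl)+
      (use exhaust_2[of j] in \<open>auto simp: N_line_0 that(2) matrix_mult_2 line_entries simp del: vector_add_component\<close>)
  show ?thesis
  proof (cases "i = 1")
    case True
    show ?thesis
      by (rule a[of _ _ 1 "A$2$2" 0 "- A$1$2"])
        (simp_all add: True orbit_def matrix_mult_2[of "inv2 X" for X] inv2_entries line_entries sl2_trace[OF A] matrix_mult_2[of A] divide_inverse algebra_simps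
          del: vector_add_component)
  next
    case False
    then have "i = 2" using exhaust_2 by blast
    then show ?thesis
      by (intro a[of _ _ 0 "- A$2$1" 1 "A$1$1"])
        (simp_all add: orbit_def matrix_mult_2[of "inv2 X" for X] inv2_entries line_entries sl2_trace[OF A] matrix_mult_2[of A] divide_inverse algebra_simps
          del: vector_add_component)
  qed
qed

lemma orbit_laurent_deriv:
  assumes "A \<in> sl2" "F \<in> laurent" "N Z \<noteq> 0"
  shows "((\<lambda>w. F (orbit A D Z w)) has_field_derivative orbit_deriv A D F Z) (at 0)"
  using has_gradD[OF laurent_has_grad[OF assms(2,3)], where \<gamma> = "orbit A D Z", OF orbit_0 orbit_curve_deriv[OF assms(1)]]
  by (simp add: sum_2 matrix_mult_2 orbit_deriv_def rowop_def colop_def algebra_simps)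

lemma differentiated_\<pi>\<^sub>l:
  assumes f: "f \<in> laurent2" and A: "A \<in> sl2" 
  shows "differentiated \<pi>\<^sub>l (block_diag A D) f = act_left A D f"
proof
  fix Z
  show "differentiated \<pi>\<^sub>l (block_diag A D) f Z = act_left A D f Z"
  proof (cases "N Z = 0")
    case True
    have "orbit_deriv A D F Z = 0" for F using True by (simp add: orbit_deriv_def rowop_outside colop_outside)
    then show ?thesis using True laurent2_outside[OF f True]
      by (simp add: differentiated_def on_inv_apply vec_eq_iff forall_2 act_left_def)
  next
    case False
    define a where "a w = mat 1 + mscale w A" for w
    have ev: "eventually (\<lambda>w. \<pi>\<^sub>l (mat 1 + mscale w (block_diag A D)) f Z $ i =
        1 / N (a w) * (a w $ i $ 1 * f (orbit A D Z w) $ 1 + a w $ i $ 2 * f (orbit A D Z w) $ 2)) (nhds 0)" for i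
      using eventually_N_line[of A]
    proof eventually_elim
      case (elim w)
      have i: "matrix_inv (a w) = inv2 (a w)"
        using elim unfolding a_def by (intro matrix_inv_eq inv2_inverse)
      have o: "orbit A D Z w = inv2 (a w) ** (Z ** (mat 1 + mscale w D))"
        by (simp only: orbit_def a_def)
      have z: "Z ** (0 :: quat) = 0" by (simp add: vec_eq_iff matrix_mult_2)
      show ?case
        unfolding \<pi>\<^sub>l_def block_diag_line blocks_block_diag Let_def a_def[symmetric] z diff_zero i minus_zero
          add_0_left o matrix_vector_mult_2 mscale_entry
        by (simp only: distrib_left mult.assoc)
    qed
    have e: "a w $ 1 $ 1 = 1 + w * A$1$1" "a w $ 1 $ 2 = w * A$1$2"
      "a w $ 2 $ 1 = w * A$2$1" "a w $ 2 $ 2 = 1 + w * A$2$2" for w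
      unfolding a_def by (rule line_entries)+
    have N: "((\<lambda>w. 1 / N (a w)) has_field_derivative 0) (at 0)" "N (a 0) = 1"
      unfolding a_def by (rule inverse_N_line_deriv[OF A] N_line_0)+
    note F = orbit_laurent_deriv[OF A laurent2_component[OF f] False, of D]
    have d: "((\<lambda>w. 1 / N (a w) * (a w $ i $ 1 * f (orbit A D Z w) $ 1 + a w $ i $ 2 * f (orbit A D Z w) $ 2))
        has_field_derivative act_left A D f Z $ i) (at 0)" for i
      using exhaust_2[of i]
    proof
      assume i: "i = 1"
      show ?thesis unfolding i e
        by (rule derivative_eq_intros F N refl)+ (simp add: act_left_def N orbit_0)
    next
      assume i: "i = 2"
      show ?thesis unfolding i e
        by (rule derivative_eq_intros F N refl)+ (simp add: act_left_def N orbit_0)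
    qed
    have "deriv (\<lambda>w. \<pi>\<^sub>l (mat 1 + mscale w (block_diag A D)) f Z $ i) 0 = act_left A D f Z $ i" for i
      using DERIV_imp_deriv[OF d[of i]] deriv_cong_ev[OF ev[of i] refl] by simp
    then show ?thesis using False by (simp add: differentiated_def on_inv_apply vec_eq_iff)
  qed
qed

lemma differentiated_\<pi>\<^sub>r:
  assumes f: "f \<in> laurent2" and A: "A \<in> sl2" and D: "D \<in> sl2"
  shows "differentiated \<pi>\<^sub>r (block_diag A D) f = act_right A D f"
proof
  fix Z
  show "differentiated \<pi>\<^sub>r (block_diag A D) f Z = act_right A D f Z"
  proof (cases "N Z = 0")
    case True
    have "orbit_deriv A D F Z = 0" for F using True by (simp add: orbit_deriv_def rowop_outside colop_outside)
    then show ?thesis using True laurent2_outside[OF f True]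
      by (simp add: differentiated_def on_inv_apply vec_eq_iff forall_2 act_right_def)
  next
    case False
    define d where "d w = mat 1 + mscale w D" for w
    define a where "a w = mat 1 + mscale w A" for w
    have e: "d w $ 1 $ 1 = 1 + w * D$1$1" "d w $ 1 $ 2 = w * D$1$2"
      "d w $ 2 $ 1 = w * D$2$1" "d w $ 2 $ 2 = 1 + w * D$2$2" for w
      unfolding d_def by (rule line_entries)+
    have ev: "eventually (\<lambda>w. \<pi>\<^sub>r (mat 1 + mscale w (block_diag A D)) f Z =
        f (orbit A D Z w) v* mscale (N (d w)) (inv2 (d w))) (nhds 0)" (is "eventually (\<lambda>w. ?l w = ?r w) _")
      using eventually_N_line[of A] eventually_N_line[of D]
    proof eventually_elim
      case (elim w)
      then have N: "N (a w) \<noteq> 0" "N (d w) \<noteq> 0" unfolding a_def d_def .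
      have "matrix_inv (block_diag (a w) (d w)) = block_diag (inv2 (a w)) (inv2 (d w))"
        by (rule matrix_inv_eq) (simp_all add: block_diag_mult inv2_inverse N block_diag_mat_1)
      moreover have "matrix_inv (inv2 (d w)) = d w"
        by (rule matrix_inv_eq) (simp_all add: inv2_inverse N)
      ultimately show ?case
        unfolding \<pi>\<^sub>r_def block_diag_line a_def[symmetric] d_def[symmetric]
        by (simp add: blocks_block_diag Let_def N_inv2 N orbit_def a_def[symmetric] d_def[symmetric] matrix_mul_assoc)
    qed
    have r: "?r w $ 1 = (1 + w * D$2$2) * f (orbit A D Z w) $ 1 - w * D$2$1 * f (orbit A D Z w) $ 2"
       "?r w $ 2 = (1 + w * D$1$1) * f (orbit A D Z w) $ 2 - w * D$1$2 * f (orbit A D Z w) $ 1" if "N (d w) \<noteq> 0" for w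
      using that by (simp_all add: vector_matrix_mult_2 mscale_def inv2_entries e)
    have evN: "eventually (\<lambda>w. N (d w) \<noteq> 0) (nhds 0)" using eventually_N_line[of D] unfolding d_def .
    have ev1: "eventually (\<lambda>w. \<pi>\<^sub>r (mat 1 + mscale w (block_diag A D)) f Z $ 1 =
        (1 + w * D$2$2) * f (orbit A D Z w) $ 1 - w * D$2$1 * f (orbit A D Z w) $ 2) (nhds 0)"
      and ev2: "eventually (\<lambda>w. \<pi>\<^sub>r (mat 1 + mscale w (block_diag A D)) f Z $ 2 =
        (1 + w * D$1$1) * f (orbit A D Z w) $ 2 - w * D$1$2 * f (orbit A D Z w) $ 1) (nhds 0)"
      subgoal using ev evN by eventually_elim (simp only: r not_False_eq_True)
      subgoal using ev evN by eventually_elim (simp only: r not_False_eq_True)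
      done
    note F = orbit_laurent_deriv[OF A laurent2_component[OF f] False, of D]
    have d1: "((\<lambda>w. (1 + w * D$2$2) * f (orbit A D Z w) $ 1 - w * D$2$1 * f (orbit A D Z w) $ 2)
        has_field_derivative act_right A D f Z $ 1) (at 0)"
      by (rule derivative_eq_intros F refl)+ (simp add: act_right_def orbit_0 sl2_trace[OF D])
    have d2: "((\<lambda>w. (1 + w * D$1$1) * f (orbit A D Z w) $ 2 - w * D$1$2 * f (orbit A D Z w) $ 1)
        has_field_derivative act_right A D f Z $ 2) (at 0)"
      by (rule derivative_eq_intros F refl)+ (simp add: act_right_def orbit_0 sl2_trace[OF D])
    have "deriv (\<lambda>w. \<pi>\<^sub>r (mat 1 + mscale w (block_diag A D)) f Z $ 1) 0 = act_right A D f Z $ 1"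
      "deriv (\<lambda>w. \<pi>\<^sub>r (mat 1 + mscale w (block_diag A D)) f Z $ 2) 0 = act_right A D f Z $ 2"
      using DERIV_imp_deriv[OF d1] deriv_cong_ev[OF ev1 refl] DERIV_imp_deriv[OF d2] deriv_cong_ev[OF ev2 refl] by simp_all
    then show ?thesis using False by (simp add: differentiated_def on_inv_apply vec_eq_iff forall_2)
  qed
qed

section \<open>The Casimir operator and uniqueness of components\<close>

text \<open>
What the module theory below uses of the two actions: on pairs of Laurent polynomials they are
linear operators.
\<close>

locale sl2_action =
  fixes \<rho> :: "quat2 \<Rightarrow> qfun \<Rightarrow> qfun"
  assumes closed: "A \<in> sl2 \<Longrightarrow> D \<in> sl2 \<Longrightarrow> f \<in> laurent2 \<Longrightarrow> \<rho> (block_diag A D) f \<in> laurent2"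
    and add: "A \<in> sl2 \<Longrightarrow> D \<in> sl2 \<Longrightarrow> f \<in> laurent2 \<Longrightarrow> g \<in> laurent2 \<Longrightarrow>
      \<rho> (block_diag A D) (f + g) = \<rho> (block_diag A D) f + \<rho> (block_diag A D) g"
    and scale: "A \<in> sl2 \<Longrightarrow> D \<in> sl2 \<Longrightarrow> f \<in> laurent2 \<Longrightarrow>
      \<rho> (block_diag A D) (fscale a f) = fscale a (\<rho> (block_diag A D) f)"
begin

lemma zero: "A \<in> sl2 \<Longrightarrow> D \<in> sl2 \<Longrightarrow> \<rho> (block_diag A D) 0 = 0"
  using scale[of A D 0 0] qfun.subspace_0[OF laurent2_subspace] by (simp only: qfun.scale_zero_left)

lemma sum:
  assumes "A \<in> sl2" "D \<in> sl2" "\<And>i. i \<in> I \<Longrightarrow> f i \<in> laurent2"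
  shows "\<rho> (block_diag A D) (\<Sum>i\<in>I. fscale (a i) (f i)) = (\<Sum>i\<in>I. fscale (a i) (\<rho> (block_diag A D) (f i)))"
  using assms(3)
proof (induction I rule: infinite_finite_induct)
  case (insert i I)
  have L: "fscale (a i) (f i) \<in> laurent2" "(\<Sum>i\<in>I. fscale (a i) (f i)) \<in> laurent2"
    using insert.prems by (auto intro!: qfun.subspace_scale qfun.subspace_sum laurent2_subspace)
  have IH: "\<rho> (block_diag A D) (\<Sum>i\<in>I. fscale (a i) (f i)) = (\<Sum>i\<in>I. fscale (a i) (\<rho> (block_diag A D) (f i)))"
    using insert.IH insert.prems by blast
  show ?case
    unfolding sum.insert[OF insert.hyps(1,2)]
    by (simp only: add[OF assms(1,2) L] scale[OF assms(1,2) insert.prems[OF insertI1]] IH)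
qed (simp_all only: sum.empty sum.infinite zero assms not_False_eq_True)

end

definition sl2_H :: "complex \<Rightarrow> quat" where "sl2_H s = vector [vector [s, 0], vector [0, - s]]"
definition sl2_E :: quat where "sl2_E = vector [vector [0, 1], vector [0, 0]]"
definition sl2_F :: quat where "sl2_F = vector [vector [0, 0], vector [1, 0]]"

lemma sl2_HEF: "sl2_H s \<in> sl2" "sl2_E \<in> sl2" "sl2_F \<in> sl2" "0 \<in> sl2"
  by (simp_all add: sl2_def qRe_def trace_def sum_2 sl2_H_def sl2_E_def sl2_F_def)

text \<open>
The sum of the Casimir operators \<open>EF + FE + H\<^sup>2/2\<close> of the two factors.
\<close>

definition casimir :: "(quat2 \<Rightarrow> qfun \<Rightarrow> qfun) \<Rightarrow> qfun \<Rightarrow> qfun" where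
  "casimir \<rho> f =
     \<rho> (block_diag sl2_E 0) (\<rho> (block_diag sl2_F 0) f) + \<rho> (block_diag sl2_F 0) (\<rho> (block_diag sl2_E 0) f)
     + fscale (1/2) (\<rho> (block_diag (sl2_H 1) 0) (\<rho> (block_diag (sl2_H 1) 0) f))
     + (\<rho> (block_diag 0 sl2_E) (\<rho> (block_diag 0 sl2_F) f) + \<rho> (block_diag 0 sl2_F) (\<rho> (block_diag 0 sl2_E) f)
     + fscale (1/2) (\<rho> (block_diag 0 (sl2_H 1)) (\<rho> (block_diag 0 (sl2_H 1)) f)))"

lemma V_act_casimir:
  "V_act l sl2_E (V_act l sl2_F c) q + V_act l sl2_F (V_act l sl2_E c) q
     + 1/2 * V_act l (sl2_H 1) (V_act l (sl2_H 1) c) q = of_real (2 * l * (l + 1)) * c q"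
  by (cases q) (simp_all add: V_act_def sl2_E_def sl2_F_def sl2_H_def algebra_simps)

lemma V_act_0: "V_act l 0 c q = 0"
  by (simp add: V_act_def)

lemma VV_act_left: "VV_act j k A 0 c = (\<lambda>p q. V_act j A (\<lambda>p'. c p' q) p)"
  by (simp add: VV_act_def V_act_0 fun_eq_iff)

lemma VV_act_right: "VV_act j k 0 D c = (\<lambda>p q. V_act k D (c p) q)"
  by (simp add: VV_act_def V_act_0 fun_eq_iff)

lemma V_act_closed':
  assumes "2 * l \<in> \<nat> \<or> l < 0" "c \<in> V l"
  shows "V_act l A c \<in> V l"
proof (cases "l < 0")
  case True
  then have "c k = 0" for k using assms(2) by (simp add: V_def)
  then show ?thesis by (simp add: V_def V_act_def)
next
  case False
  then show ?thesis using assms by (intro V_act_closed) auto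
qed

lemma VV_add_scale: "c \<in> VV j k \<Longrightarrow> d \<in> VV j k \<Longrightarrow> c + d \<in> VV j k" "c \<in> VV j k \<Longrightarrow> (\<lambda>p q. a * c p q) \<in> VV j k"
  "(\<lambda>_ _. 0) \<in> VV j k"
  by (simp_all add: VV_def V_def)

lemma VV_act_closed:
  assumes "2 * j \<in> \<nat> \<or> j < 0" "2 * k \<in> \<nat> \<or> k < 0" "c \<in> VV j k"
  shows "VV_act j k A D c \<in> VV j k"
proof -
  have c: "(\<lambda>p. c p q) \<in> V j" "c p \<in> V k" for p q using assms(3) by (simp_all add: VV_def)
  have c0: "c p q = 0" if "real p > 2 * j \<or> real q > 2 * k" for p q using c[of q] c(2)[of p] that by (auto simp: V_def)
  have "V_act j A (\<lambda>p'. c p' q) \<in> V j" "V_act k D (c p) \<in> V k" for p q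
    using V_act_closed' assms c by blast+
  moreover have "V_act j A (\<lambda>p'. c p' q) p = 0" if "real q > 2 * k" for p q
    using that by (simp add: V_act_def c0)
  moreover have "V_act k D (c p) q = 0" if "real p > 2 * j" for p q
    using that by (simp add: V_act_def c0)
  ultimately show ?thesis by (auto simp: VV_def VV_act_def V_def)
qed

lemma casimir_iso:
  assumes iso: "iso_VV \<rho> W j k" and f: "f \<in> W"
    and jk: "2 * j \<in> \<nat> \<or> j < 0" "2 * k \<in> \<nat> \<or> k < 0"
  shows "casimir \<rho> f = fscale (of_real (2 * j * (j + 1) + 2 * k * (k + 1))) f"
proof -
  obtain \<phi> where bij: "bij_betw \<phi> (VV j k) W"
    and add: "\<And>c d. c \<in> VV j k \<Longrightarrow> d \<in> VV j k \<Longrightarrow> \<phi> (c + d) = \<phi> c + \<phi> d"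
    and scale: "\<And>a c. c \<in> VV j k \<Longrightarrow> \<phi> (\<lambda>p q. a * c p q) = fscale a (\<phi> c)"
    and act: "\<And>A D c. A \<in> sl2 \<Longrightarrow> D \<in> sl2 \<Longrightarrow> c \<in> VV j k \<Longrightarrow> \<phi> (VV_act j k A D c) = \<rho> (block_diag A D) (\<phi> c)"
    using iso unfolding iso_VV_def by blast
  obtain c where c: "c \<in> VV j k" "f = \<phi> c" using bij f by (auto simp: bij_betw_def)
  have act2: "\<rho> (block_diag A D) (\<rho> (block_diag A' D') f) = \<phi> (VV_act j k A D (VV_act j k A' D' c))"
    "VV_act j k A D (VV_act j k A' D' c) \<in> VV j k"
    if "A \<in> sl2" "D \<in> sl2" "A' \<in> sl2" "D' \<in> sl2" for A D A' D'
    unfolding c(2) using that c(1) VV_act_closed[OF jk] act by simp_all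
  let ?c = "VV_act j k sl2_E 0 (VV_act j k sl2_F 0 c) + VV_act j k sl2_F 0 (VV_act j k sl2_E 0 c)
     + (\<lambda>p q. 1/2 * VV_act j k (sl2_H 1) 0 (VV_act j k (sl2_H 1) 0 c) p q)
     + (VV_act j k 0 sl2_E (VV_act j k 0 sl2_F c) + VV_act j k 0 sl2_F (VV_act j k 0 sl2_E c)
     + (\<lambda>p q. 1/2 * VV_act j k 0 (sl2_H 1) (VV_act j k 0 (sl2_H 1) c) p q))"
  have "casimir \<rho> f = \<phi> ?c"
    unfolding casimir_def by (simp only: act2 sl2_HEF add scale VV_add_scale)
  also have "?c = (\<lambda>p q. of_real (2 * j * (j + 1) + 2 * k * (k + 1)) * c p q)"
  proof (intro ext)
    fix p q
    have "?c p q = (V_act j sl2_E (V_act j sl2_F (\<lambda>p. c p q)) p + V_act j sl2_F (V_act j sl2_E (\<lambda>p. c p q)) p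
       + 1/2 * V_act j (sl2_H 1) (V_act j (sl2_H 1) (\<lambda>p. c p q)) p)
       + (V_act k sl2_E (V_act k sl2_F (c p)) q + V_act k sl2_F (V_act k sl2_E (c p)) q
       + 1/2 * V_act k (sl2_H 1) (V_act k (sl2_H 1) (c p)) q)"
      unfolding plus_fun_apply VV_act_left VV_act_right ..
    then show "?c p q = of_real (2 * j * (j + 1) + 2 * k * (k + 1)) * c p q"
      unfolding V_act_casimir by (simp add: algebra_simps)
  qed
  also have "\<phi> (\<lambda>p q. of_real (2 * j * (j + 1) + 2 * k * (k + 1)) * c p q)
      = fscale (of_real (2 * j * (j + 1) + 2 * k * (k + 1))) f"
    by (simp only: scale c)
  finally show ?thesis .
qed

lemma iso_zero:
  assumes iso: "iso_VV \<rho> W j k" and f: "f \<in> W" and jk: "j < 0 \<or> k < 0"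
  shows "f = 0"
proof -
  have "c = (\<lambda>_ _. 0)" if "c \<in> VV j k" for c
    using that jk V_negative[of j] V_negative[of k] unfolding VV_def fun_eq_iff mem_Collect_eq
    by (metis singletonD zero_fun_apply)
  moreover obtain \<phi> where bij: "bij_betw \<phi> (VV j k) W"
    and add: "\<And>c d. c \<in> VV j k \<Longrightarrow> d \<in> VV j k \<Longrightarrow> \<phi> (c + d) = \<phi> c + \<phi> d"
    using iso unfolding iso_VV_def by blast
  moreover obtain c where c: "c \<in> VV j k" "f = \<phi> c" using bij f by (auto simp: bij_betw_def)
  ultimately have "c + c = c" by (simp add: fun_eq_iff)
  then have "f = f + f" using add[OF c(1) c(1)] c by simp
  then show ?thesis by (simp only: add_cancel_right_right)
qed

context sl2_action
begin

lemma casimir_add: 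
  assumes "f \<in> laurent2" "g \<in> laurent2"
  shows "casimir \<rho> (f + g) = casimir \<rho> f + casimir \<rho> g"
proof -
  have twice: "\<rho> (block_diag A D) (\<rho> (block_diag A' D') (f + g)) =
      \<rho> (block_diag A D) (\<rho> (block_diag A' D') f) + \<rho> (block_diag A D) (\<rho> (block_diag A' D') g)"
    if "A \<in> sl2" "D \<in> sl2" "A' \<in> sl2" "D' \<in> sl2" for A D A' D'
    unfolding add[OF that(3,4) assms] using that assms by (intro add closed)
  have regroup: "(a1 + a2) + (b1 + b2) + fscale x (c1 + c2) + ((d1 + d2) + (e1 + e2) + fscale x (g1 + g2))
     = (a1 + b1 + fscale x c1 + (d1 + e1 + fscale x g1)) + (a2 + b2 + fscale x c2 + (d2 + e2 + fscale x g2))"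
    for a1 a2 b1 b2 c1 c2 d1 d2 e1 e2 g1 g2 x
    by (rule qfun_eqI; simp add: algebra_simps)
  show ?thesis
    unfolding casimir_def twice[OF sl2_HEF(2,4,3,4)] twice[OF sl2_HEF(3,4,2,4)] twice[OF sl2_HEF(1,4,1,4)]
      twice[OF sl2_HEF(4,2,4,3)] twice[OF sl2_HEF(4,3,4,2)] twice[OF sl2_HEF(4,1,4,1)]
    by (rule regroup)
qed

lemma casimir_zero: "casimir \<rho> 0 = 0"
  unfolding casimir_def by (simp only: zero sl2_HEF qfun.scale_zero_right add_0_left)

text \<open>
Decompose an element of \<open>W\<^sub>i\<close> along the \<open>S\<^sub>j\<close>. The Casimir operator acts by one scalar on the element
and by pairwise different scalars on its three parts, so only the part in \<open>S\<^sub>i\<close> survives.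
\<close>

lemma component_subset:
  assumes W: "components3 \<rho> M (j1, k1) (j2, k2) (j3, k3) W1 W2 W3"
    and S: "components3 \<rho> M (j1, k1) (j2, k2) (j3, k3) S1 S2 S3"
    and M: "M \<subseteq> laurent2"
    and eig: "\<And>W f. iso_VV \<rho> W j1 k1 \<Longrightarrow> f \<in> W \<Longrightarrow> casimir \<rho> f = fscale \<alpha> f"
      "\<And>W f. iso_VV \<rho> W j2 k2 \<Longrightarrow> f \<in> W \<Longrightarrow> casimir \<rho> f = fscale \<beta> f"
      "\<And>W f. iso_VV \<rho> W j3 k3 \<Longrightarrow> f \<in> W \<Longrightarrow> casimir \<rho> f = fscale \<gamma> f"
    and dist: "\<alpha> \<noteq> \<beta>" "\<alpha> \<noteq> \<gamma>" "\<beta> \<noteq> \<gamma>"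
  shows "W1 \<subseteq> S1 \<and> W2 \<subseteq> S2 \<and> W3 \<subseteq> S3"
proof -
  have S': "qfun.subspace S1" "qfun.subspace S2" "qfun.subspace S3"
    "iso_VV \<rho> S1 j1 k1" "iso_VV \<rho> S2 j2 k2" "iso_VV \<rho> S3 j3 k3"
    "M = {f + g + h | f g h. f \<in> S1 \<and> g \<in> S2 \<and> h \<in> S3}"
    and dir: "\<And>f g h. f \<in> S1 \<Longrightarrow> g \<in> S2 \<Longrightarrow> h \<in> S3 \<Longrightarrow> f + g + h = 0 \<Longrightarrow> f = 0 \<and> g = 0 \<and> h = 0"
    using S unfolding components3_def submodule_def direct_sum3_def by (simp_all only: prod.case)
  have W': "iso_VV \<rho> W1 j1 k1" "iso_VV \<rho> W2 j2 k2" "iso_VV \<rho> W3 j3 k3"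
    "qfun.subspace W1" "qfun.subspace W2" "qfun.subspace W3"
    "M = {f + g + h | f g h. f \<in> W1 \<and> g \<in> W2 \<and> h \<in> W3}"
    using W unfolding components3_def submodule_def direct_sum3_def by (simp_all only: prod.case)
  have inM: "f \<in> M \<and> g \<in> M \<and> h \<in> M" if "f \<in> X1" "g \<in> X2" "h \<in> X3"
    "qfun.subspace X1" "qfun.subspace X2" "qfun.subspace X3" 
    "M = {f + g + h | f g h. f \<in> X1 \<and> g \<in> X2 \<and> h \<in> X3}" for f g h X1 X2 X3
  proof -
    note z = qfun.subspace_0[OF that(4)] qfun.subspace_0[OF that(5)] qfun.subspace_0[OF that(6)]
    have "f + 0 + 0 \<in> M" "0 + g + 0 \<in> M" "0 + 0 + h \<in> M"
      unfolding that(7) using that(1-3) z by blast+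
    then show ?thesis by (simp only: add_0_left add_0_right simp_thms)
  qed
  have S0: "0 \<in> S1" "0 \<in> S2" "0 \<in> S3" and W0: "0 \<in> W1" "0 \<in> W2" "0 \<in> W3"
    using S' W' qfun.subspace_0 by blast+
  have SM: "f \<in> laurent2" if "f \<in> S1 \<or> f \<in> S2 \<or> f \<in> S3" for f
    using that inM[OF _ _ _ S'(1-3,7)] S0 M by blast
  have WM: "f \<in> M" if "f \<in> W1 \<or> f \<in> W2 \<or> f \<in> W3" for f
    using that inM[OF _ _ _ W'(4-7)] W0 by blast
  have decomp: "\<exists>a\<in>S1. \<exists>b\<in>S2. \<exists>c\<in>S3. f = a + b + c \<and> fscale (\<alpha> - \<mu>) a = 0 \<and> fscale (\<beta> - \<mu>) b = 0 \<and> fscale (\<gamma> - \<mu>) c = 0"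
    if f: "f \<in> M" "casimir \<rho> f = fscale \<mu> f" for f \<mu>
  proof -
    obtain a b c where abc: "a \<in> S1" "b \<in> S2" "c \<in> S3" "f = a + b + c" using f(1) S'(7) by blast
    have L: "a \<in> laurent2" "b \<in> laurent2" "c \<in> laurent2" "a + b \<in> laurent2"
      using SM abc qfun.subspace_add[OF laurent2_subspace] by blast+
    have "casimir \<rho> f = fscale \<alpha> a + fscale \<beta> b + fscale \<gamma> c"
      unfolding abc(4) by (simp only: casimir_add L eig(1)[OF S'(4) abc(1)] eig(2)[OF S'(5) abc(2)] eig(3)[OF S'(6) abc(3)])
    then have "fscale \<alpha> a + fscale \<beta> b + fscale \<gamma> c = fscale \<mu> a + fscale \<mu> b + fscale \<mu> c"
      using f(2) abc(4) by (simp only: qfun.scale_right_distrib)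
    moreover have "fscale (\<alpha> - \<mu>) a + fscale (\<beta> - \<mu>) b + fscale (\<gamma> - \<mu>) c
        = (fscale \<alpha> a + fscale \<beta> b + fscale \<gamma> c) - (fscale \<mu> a + fscale \<mu> b + fscale \<mu> c)"
      by (rule qfun_eqI; simp add: algebra_simps)
    ultimately have "fscale (\<alpha> - \<mu>) a + fscale (\<beta> - \<mu>) b + fscale (\<gamma> - \<mu>) c = 0"
      by (simp only: diff_self)
    moreover have "fscale (\<alpha> - \<mu>) a \<in> S1" "fscale (\<beta> - \<mu>) b \<in> S2" "fscale (\<gamma> - \<mu>) c \<in> S3"
      using abc S'(1-3) by (simp_all add: qfun.subspace_scale)
    ultimately show ?thesis using dir abc by blast
  qed
  have nz: "f = 0" if "fscale (x - y) f = 0" "x \<noteq> y" for f and x y :: complex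
    using that by (simp only: qfun.scale_eq_0_iff right_minus_eq) blast
  have "f \<in> S1" if f: "f \<in> W1" for f
  proof -
    obtain a b c where *: "a \<in> S1" "f = a + b + c" "fscale (\<beta> - \<alpha>) b = 0" "fscale (\<gamma> - \<alpha>) c = 0"
      using decomp[OF WM eig(1)[OF W'(1) f]] f by blast
    have "b = 0" "c = 0" using nz[OF *(3)] nz[OF *(4)] dist by blast+
    then show ?thesis using * by (simp only: add_0_right)
  qed
  moreover have "f \<in> S2" if f: "f \<in> W2" for f
  proof -
    obtain a b c where *: "b \<in> S2" "f = a + b + c" "fscale (\<alpha> - \<beta>) a = 0" "fscale (\<gamma> - \<beta>) c = 0"
      using decomp[OF WM eig(2)[OF W'(2) f]] f by blast
    have "a = 0" "c = 0" using nz[OF *(3)] nz[OF *(4)] dist by blast+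
    then show ?thesis using * by (simp only: add_0_right add_0_left)
  qed
  moreover have "f \<in> S3" if f: "f \<in> W3" for f
  proof -
    obtain a b c where *: "c \<in> S3" "f = a + b + c" "fscale (\<alpha> - \<gamma>) a = 0" "fscale (\<beta> - \<gamma>) b = 0"
      using decomp[OF WM eig(3)[OF W'(3) f]] f by blast
    have "a = 0" "b = 0" using nz[OF *(3)] nz[OF *(4)] dist by blast+
    then show ?thesis using * by (simp only: add_0_right add_0_left)
  qed
  ultimately show ?thesis by blast
qed

lemma eigenvectors_independent:
  assumes "finite I" "A \<in> sl2" "D \<in> sl2"
    and v: "\<And>i. i \<in> I \<Longrightarrow> v i \<in> laurent2" "\<And>i. i \<in> I \<Longrightarrow> v i \<noteq> 0"
    and eig: "\<And>i. i \<in> I \<Longrightarrow> \<rho> (block_diag A D) (v i) = fscale (\<mu> i) (v i)"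
    and inj: "inj_on \<mu> I"
    and "(\<Sum>i\<in>I. fscale (a i) (v i)) = 0" "i \<in> I"
  shows "a i = 0"
  using assms(1) v eig inj assms(8,9)
proof (induction I arbitrary: a i rule: finite_induct)
  case (insert k I)
  have "\<rho> (block_diag A D) (\<Sum>i\<in>insert k I. fscale (a i) (v i)) = (\<Sum>i\<in>insert k I. fscale (a i) (fscale (\<mu> i) (v i)))"
    using insert.prems(1,3) by (simp only: sum assms cong: sum.cong)
  then have "(\<Sum>i\<in>insert k I. fscale (a i) (fscale (\<mu> i) (v i))) = 0"
    unfolding insert.prems(5) by (simp only: zero assms)
  moreover have "fscale (\<mu> k) (\<Sum>i\<in>insert k I. fscale (a i) (v i)) = 0"
    unfolding insert.prems(5) by (rule qfun.scale_zero_right)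
  ultimately have "(\<Sum>i\<in>insert k I. fscale (a i) (fscale (\<mu> i) (v i))) 
      - fscale (\<mu> k) (\<Sum>i\<in>insert k I. fscale (a i) (v i)) = 0" by (simp only: diff_0_right)
  then have "(\<Sum>i\<in>insert k I. fscale (a i * (\<mu> i - \<mu> k)) (v i)) = 0"
    by (simp only: qfun.scale_sum_right sum_subtractf[symmetric] qfun.scale_scale qfun.scale_left_diff_distrib[symmetric])
      (simp only: right_diff_distrib mult.commute)
  then have s: "(\<Sum>i\<in>I. fscale (a i * (\<mu> i - \<mu> k)) (v i)) = 0"
    unfolding sum.insert[OF insert.hyps(1,2)] by (simp only: diff_self mult_zero_right qfun.scale_zero_left add_0_left)
  have I: "a i * (\<mu> i - \<mu> k) = 0" if "i \<in> I" for i
    by (rule insert.IH[OF _ _ _ _ s that]) (use insert.prems in \<open>auto simp: inj_on_def\<close>)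
  have aI: "a i = 0" if "i \<in> I" for i
    using I[OF that] insert.prems(4) insert.hyps that by (auto simp: inj_on_def)
  have "(\<Sum>i\<in>I. fscale (a i) (v i)) = 0"
    by (intro sum.neutral ballI) (simp only: aI qfun.scale_zero_left)
  then have "fscale (a k) (v k) = 0"
    using insert.prems(5) unfolding sum.insert[OF insert.hyps(1,2)] by (simp only: add_0_right)
  then have "a k = 0" using insert.prems(2) by (simp only: qfun.scale_eq_0_iff) blast
  then show ?case using aI insert.prems(6) by blast
qed simp

end

section \<open>Recognising an external tensor product\<close>

text \<open>
The integer bound may be negative, which covers the components with \<open>V\<^sub>j = 0\<close>.
\<close>

definition nats_upto :: "int \<Rightarrow> nat set" where "nats_upto P = {q. int q \<le> P}"

lemma nats_upto_cases: "P < 0 \<and> nats_upto P = {} \<or> (\<exists>n. P = int n \<and> nats_upto P = {..n})"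
  by (cases "P < 0") (auto simp: nats_upto_def atMost_def dest!: zero_le_imp_eq_int not_less[THEN iffD1])

lemma finite_nats_upto [simp]: "finite (nats_upto P)"
  using nats_upto_cases[of P] by auto

text \<open>
The action on coefficients is transpose to the action on monomials; the boundary terms vanish because
\<open>c\<close> is supported on \<open>nats_upto P\<close>.
\<close>

lemma V_act_sum:
  fixes g :: "nat \<Rightarrow> complex"
  assumes c: "c \<in> V j" and j: "2 * j = of_int P"
  shows "(\<Sum>q\<in>nats_upto P. V_act j A c q * g q) = (\<Sum>q\<in>nats_upto P. c q *
     ((of_int (P - int q) * A$1$1 + of_nat q * A$2$2) * g q + of_int (P - int q) * A$2$1 * g (q + 1) + of_nat q * A$1$2 * g (q - 1)))"
proof -
  consider "nats_upto P = {}" | n where "P = int n" "nats_upto P = {..n}" using nats_upto_cases by blast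
  then show ?thesis
  proof cases
    case 2
    have cn: "c (Suc n) = 0" using c j 2 by (simp add: V_def)
    have a: "(\<Sum>q\<le>n. (if q = 0 then 0 else of_int (P - int q + 1) * A$2$1 * c (q - 1)) * g q)
        = (\<Sum>q\<le>n. c q * (of_int (P - int q) * A$2$1 * g (q + 1)))"
    proof -
      have "(\<Sum>q\<le>n. c q * (of_int (P - int q) * A$2$1 * g (q + 1))) = (\<Sum>q<n. c q * (of_int (P - int q) * A$2$1 * g (q + 1)))"
        by (simp add: lessThan_Suc_atMost[symmetric] 2)
      also have "\<dots> = (\<Sum>q\<le>n. (if q = 0 then 0 else of_int (P - int q + 1) * A$2$1 * c (q - 1)) * g q)"
        by (simp add: sum.atMost_shift mult_ac)
      finally show ?thesis by simp
    qed
    have b: "(\<Sum>q\<le>n. of_nat (q + 1) * A$1$2 * c (q + 1) * g q) = (\<Sum>q\<le>n. c q * (of_nat q * A$1$2 * g (q - 1)))"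
    proof -
      have "(\<Sum>q\<le>n. c q * (of_nat q * A$1$2 * g (q - 1))) = (\<Sum>q<n. c (Suc q) * (of_nat (Suc q) * A$1$2 * g q))"
        by (simp add: sum.atMost_shift)
      also have "\<dots> = (\<Sum>q\<le>n. of_nat (q + 1) * A$1$2 * c (q + 1) * g q)"
        by (simp add: lessThan_Suc_atMost[symmetric] cn algebra_simps)
      finally show ?thesis by simp
    qed
    have v: "V_act j A c q = (of_int (P - int q) * A$1$1 + of_nat q * A$2$2) * c q
        + (if q = 0 then 0 else of_int (P - int q + 1) * A$2$1 * c (q - 1)) + of_nat (q + 1) * A$1$2 * c (q + 1)" for q
      unfolding V_act_def j by (simp only: of_real_diff of_real_add of_real_of_int_eq of_real_of_nat_eq of_real_1 of_int_diff of_int_add of_int_of_nat_eq of_int_1)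
    show ?thesis
      unfolding 2(2) v distrib_left distrib_right[of _ _ "g q" for q] sum.distrib a b
      by (simp add: algebra_simps sum.distrib sum_subtractf)
  qed simp
qed

lemma qfun_sum_component: "(\<Sum>x\<in>I. f x :: qfun) Z $ i = (\<Sum>x\<in>I. f x Z $ i)"
  by (induction I rule: infinite_finite_induct) simp_all

lemma V_iff_nats_upto:
  assumes "2 * j = of_int P" shows "c \<in> V j \<longleftrightarrow> (\<forall>q. q \<notin> nats_upto P \<longrightarrow> c q = 0)"
proof -
  have "real q > 2 * j \<longleftrightarrow> q \<notin> nats_upto P" for q unfolding assms nats_upto_def by simp linarith
  then show ?thesis by (simp add: V_def)
qed

lemma VV_iff_nats_upto:
  assumes "2 * j = of_int P" "2 * k = of_int K"
  shows "c \<in> VV j k \<longleftrightarrow> (\<forall>q r. q \<notin> nats_upto P \<or> r \<notin> nats_upto K \<longrightarrow> c q r = 0)"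
  unfolding VV_def V_iff_nats_upto[OF assms(1)] V_iff_nats_upto[OF assms(2)] by blast

lemma sl2_H_entries: "sl2_H s $ 1 $ 1 = s" "sl2_H s $ 1 $ 2 = 0" "sl2_H s $ 2 $ 1 = 0" "sl2_H s $ 2 $ 2 = - s"
  by (simp_all add: sl2_H_def)

lemma half_integer_cases: "2 * j = of_int P \<Longrightarrow> 2 * j \<in> \<nat> \<or> j < 0" for j :: real
  by (cases "P < 0") (auto dest!: zero_le_imp_eq_int not_less[THEN iffD1])

context sl2_action
begin

text \<open>
The law says that \<open>G q r\<close> transforms like the product of the monomials with indices \<open>q\<close> and \<open>r\<close>, so
sending coefficients to linear combinations intertwines the actions. Injectivity comes from weights:
the element \<open>(H, s H)\<close> with \<open>s = P + 1\<close> acts on the vectors \<open>G q r\<close> by pairwise different scalars.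
\<close>

lemma module_iso_VV:
  fixes G :: "nat \<Rightarrow> nat \<Rightarrow> qfun"
  assumes jk: "2 * j = of_int P" "2 * k = of_int K"
    and L: "\<And>q r. q \<in> nats_upto P \<Longrightarrow> r \<in> nats_upto K \<Longrightarrow> G q r \<in> laurent2"
    and nz: "\<And>q r. q \<in> nats_upto P \<Longrightarrow> r \<in> nats_upto K \<Longrightarrow> G q r \<noteq> 0"
    and law: "\<And>q r A D. q \<in> nats_upto P \<Longrightarrow> r \<in> nats_upto K \<Longrightarrow> A \<in> sl2 \<Longrightarrow> D \<in> sl2 \<Longrightarrow>
      \<rho> (block_diag A D) (G q r) =
        fscale (of_int (P - int q) * A$1$1 + of_nat q * A$2$2 + (of_int (K - int r) * D$1$1 + of_nat r * D$2$2)) (G q r)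
        + fscale (of_int (P - int q) * A$2$1) (G (q + 1) r) + fscale (of_nat q * A$1$2) (G (q - 1) r)
        + fscale (of_int (K - int r) * D$2$1) (G q (r + 1)) + fscale (of_nat r * D$1$2) (G q (r - 1))"
    and W: "W = qfun.span {G q r | q r. q \<in> nats_upto P \<and> r \<in> nats_upto K}"
  shows "submodule \<rho> W \<and> iso_VV \<rho> W j k"
proof -
  define \<phi> where "\<phi> c = (\<Sum>x\<in>nats_upto P \<times> nats_upto K. fscale (c (fst x) (snd x)) (G (fst x) (snd x)))" for c
  have comp: "\<phi> c Z $ i = (\<Sum>q\<in>nats_upto P. \<Sum>r\<in>nats_upto K. c q r * G q r Z $ i)" for c Z i
    unfolding \<phi>_def qfun_sum_component by (simp add: sum.cartesian_product case_prod_beta)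
  have add: "\<phi> (c + d) = \<phi> c + \<phi> d" for c d
    unfolding fun_eq_iff vec_eq_iff comp plus_fun_apply vector_add_component distrib_right sum.distrib by simp
  have scl: "\<phi> (\<lambda>p q. a * c p q) = fscale a (\<phi> c)" for a c
    unfolding fun_eq_iff vec_eq_iff comp fscale_component by (simp add: sum_distrib_left mult.assoc)
  have act: "\<phi> (VV_act j k A D c) = \<rho> (block_diag A D) (\<phi> c)" if A: "A \<in> sl2" "D \<in> sl2" and c: "c \<in> VV j k" for A D c
  proof -
    have "\<phi> (VV_act j k A D c) Z $ i = \<rho> (block_diag A D) (\<phi> c) Z $ i" for Z i
    proof -
      define g where "g q r = G q r Z $ i" for q r
      have cV: "(\<lambda>p. c p r) \<in> V j" "c q \<in> V k" for q r using c by (simp_all add: VV_def)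
      have "\<phi> (VV_act j k A D c) Z $ i = 
          (\<Sum>r\<in>nats_upto K. \<Sum>q\<in>nats_upto P. V_act j A (\<lambda>p. c p r) q * g q r) + (\<Sum>q\<in>nats_upto P. \<Sum>r\<in>nats_upto K. V_act k D (c q) r * g q r)"
        unfolding comp VV_act_def distrib_right sum.distrib g_def[symmetric]
        by (subst sum.swap) simp
      also have "\<dots> = (\<Sum>q\<in>nats_upto P. \<Sum>r\<in>nats_upto K. c q r * (
          (of_int (P - int q) * A$1$1 + of_nat q * A$2$2) * g q r + of_int (P - int q) * A$2$1 * g (q + 1) r + of_nat q * A$1$2 * g (q - 1) r
         + ((of_int (K - int r) * D$1$1 + of_nat r * D$2$2) * g q r + of_int (K - int r) * D$2$1 * g q (r + 1) + of_nat r * D$1$2 * g q (r - 1))))"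
        unfolding V_act_sum[OF cV(1) jk(1)] V_act_sum[OF cV(2) jk(2)] distrib_left[of "c q r" for q r] sum.distrib
        by (subst (1 2 3) sum.swap[of _ "nats_upto K" "nats_upto P"]) (simp add: sum.distrib algebra_simps)
      also have "\<dots> = \<rho> (block_diag A D) (\<phi> c) Z $ i"
        unfolding \<phi>_def
        apply (subst sum[OF A])
        subgoal using L by auto
        unfolding qfun_sum_component sum.cartesian_product case_prod_beta
        by (rule sum.cong[OF refl]) (auto simp: law A g_def algebra_simps)
      finally show ?thesis .
    qed
    then show ?thesis by (intro ext vec_eq_iff[THEN iffD2] allI)
  qed
  have indep: "c q r = 0" if c0: "\<phi> c = 0" and qr: "q \<in> nats_upto P" "r \<in> nats_upto K" for c q r
  proof -
    \<comment> \<open>any \<open>s > P\<close> separates the weights, as \<open>q\<close> ranges over \<open>0, \<dots>, P\<close>\<close>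
    define s where "s = of_int P + (1 :: complex)"
    define \<mu> where "\<mu> x = of_int (P - 2 * int (fst x)) + of_int (K - 2 * int (snd x)) * s" for x :: "nat \<times> nat"
    have "c (fst (q, r)) (snd (q, r)) = 0"
    proof (rule eigenvectors_independent[where I = "nats_upto P \<times> nats_upto K" and A = "sl2_H 1" and D = "sl2_H s"
          and v = "\<lambda>x. G (fst x) (snd x)" and \<mu> = \<mu> and a = "\<lambda>x. c (fst x) (snd x)"])
      show "(\<Sum>x\<in>nats_upto P \<times> nats_upto K. fscale (c (fst x) (snd x)) (G (fst x) (snd x))) = 0"
        using c0 unfolding \<phi>_def .
      show "\<rho> (block_diag (sl2_H 1) (sl2_H s)) (G (fst x) (snd x)) = fscale (\<mu> x) (G (fst x) (snd x))"
        if "x \<in> nats_upto P \<times> nats_upto K" for x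
      proof -
        have x: "fst x \<in> nats_upto P" "snd x \<in> nats_upto K" using that by auto
        have "\<rho> (block_diag (sl2_H 1) (sl2_H s)) (G (fst x) (snd x)) =
          fscale (of_int (P - int (fst x)) * 1 + of_nat (fst x) * (- 1) + (of_int (K - int (snd x)) * s + of_nat (snd x) * (- s))) (G (fst x) (snd x))"
          using law[OF x sl2_HEF(1) sl2_HEF(1), of 1 s]
          by (simp only: sl2_H_entries mult_zero_right qfun.scale_zero_left add_0_right)
        also have "of_int (P - int (fst x)) * 1 + of_nat (fst x) * (- 1) + (of_int (K - int (snd x)) * s + of_nat (snd x) * (- s)) = \<mu> x"
          by (simp add: \<mu>_def algebra_simps)
        finally show ?thesis .
      qed
      show "inj_on \<mu> (nats_upto P \<times> nats_upto K)"
      proof (rule inj_onI)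
        fix x y assume xy: "x \<in> nats_upto P \<times> nats_upto K" "y \<in> nats_upto P \<times> nats_upto K" "\<mu> x = \<mu> y"
        then have "(of_int (P - 2 * int (fst x) + (K - 2 * int (snd x)) * (P + 1)) :: complex) =
            of_int (P - 2 * int (fst y) + (K - 2 * int (snd y)) * (P + 1))"
          by (simp add: \<mu>_def s_def)
        then have e: "P - 2 * int (fst x) + (K - 2 * int (snd x)) * (P + 1) = P - 2 * int (fst y) + (K - 2 * int (snd y)) * (P + 1)"
          by (simp only: of_int_eq_iff)
        have e': "int (fst x) + int (snd x) * (P + 1) = int (fst y) + int (snd y) * (P + 1)"
          using e by (simp add: algebra_simps)
        have b: "0 \<le> int (fst x)" "int (fst x) < P + 1" "0 \<le> int (fst y)" "int (fst y) < P + 1"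
          using xy by (auto simp: nats_upto_def)
        have "int (fst x) = (int (fst x) + int (snd x) * (P + 1)) mod (P + 1)" using b by simp
        also have "\<dots> = int (fst y)" unfolding e' using b by simp
        finally have "fst x = fst y" by simp
        moreover from this e' b have "snd x = snd y" by simp
        ultimately show "x = y" by (simp add: prod_eq_iff)
      qed
    qed (use L nz qr sl2_HEF in auto)
    then show ?thesis by simp
  qed
  have inj: "inj_on \<phi> (VV j k)"
  proof (rule inj_onI)
    fix c d assume cd: "c \<in> VV j k" "d \<in> VV j k" "\<phi> c = \<phi> d"
    have "\<phi> (c + (\<lambda>p q. (-1) * d p q)) = 0"
      unfolding add scl cd(3) by (rule qfun_eqI) simp_all
    then have *: "(c + (\<lambda>p q. (-1) * d p q)) q r = 0" if "q \<in> nats_upto P" "r \<in> nats_upto K" for q r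
      using indep that by blast
    have "c q r = d q r" for q r
    proof (cases "q \<in> nats_upto P \<and> r \<in> nats_upto K")
      case True
      then show ?thesis using *[of q r] by simp
    next
      case False
      then show ?thesis using cd VV_iff_nats_upto[OF jk] by metis
    qed
    then show "c = d" by blast
  qed
  have base: "G q r \<in> W" if "q \<in> nats_upto P" "r \<in> nats_upto K" for q r
    unfolding W using that by (intro qfun.span_base) blast
  have "\<phi> c \<in> W" for c
    unfolding \<phi>_def W by (intro qfun.span_sum qfun.span_scale) (use base W in auto)
  moreover have "W \<subseteq> \<phi> ` VV j k"
    unfolding W
  proof (rule qfun.span_minimal)
    show "{G q r | q r. q \<in> nats_upto P \<and> r \<in> nats_upto K} \<subseteq> \<phi> ` VV j k"
    proof clarify
      fix q r assume qr: "q \<in> nats_upto P" "r \<in> nats_upto K"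
      define c :: "nat \<Rightarrow> nat \<Rightarrow> complex" where "c = (\<lambda>q' r'. if q' = q \<and> r' = r then 1 else 0)"
      have "c \<in> VV j k" unfolding VV_iff_nats_upto[OF jk] c_def using qr by auto
      moreover have "\<phi> c = G q r"
      proof -
        have "\<phi> c = (\<Sum>x\<in>nats_upto P \<times> nats_upto K. if x = (q, r) then G q r else 0)"
          unfolding \<phi>_def
          by (rule sum.cong[OF refl]) (rule qfun_eqI; auto simp: c_def prod_eq_iff)
        also have "\<dots> = G q r" using qr by (subst sum.delta) simp_all
        finally show ?thesis .
      qed
      ultimately show "G q r \<in> \<phi> ` VV j k" by (metis image_eqI)
    qed
    show "qfun.subspace (\<phi> ` VV j k)"
      unfolding qfun.subspace_def
    proof (intro conjI ballI allI)
      have "\<phi> (\<lambda>_ _. 0) = 0" by (rule qfun_eqI) (simp_all add: comp)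
      then show "0 \<in> \<phi> ` VV j k" using VV_add_scale(3) by (metis image_eqI)
    next
      fix x y assume "x \<in> \<phi> ` VV j k" "y \<in> \<phi> ` VV j k"
      then obtain c d where cd: "c \<in> VV j k" "d \<in> VV j k" and xy: "x = \<phi> c" "y = \<phi> d" by blast
      show "x + y \<in> \<phi> ` VV j k"
        unfolding xy add[symmetric] using VV_add_scale(1)[OF cd] by (rule imageI)
    next
      fix a x assume "x \<in> \<phi> ` VV j k"
      then obtain c where c: "c \<in> VV j k" and x: "x = \<phi> c" by blast
      show "fscale a x \<in> \<phi> ` VV j k"
        unfolding x scl[symmetric] using VV_add_scale(2)[OF c] by (rule imageI)
    qed
  qed
  ultimately have img: "\<phi> ` VV j k = W" by blast
  have "iso_VV \<rho> W j k"
    unfolding iso_VV_def bij_betw_def using inj img add scl act by blast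
  moreover have "submodule \<rho> W"
    unfolding submodule_def
  proof (intro conjI ballI)
    show "qfun.subspace W" unfolding W by (rule qfun.subspace_span)
    fix A D f assume A: "A \<in> sl2" "D \<in> sl2" and f: "f \<in> W"
    then obtain c where c: "c \<in> VV j k" "f = \<phi> c" using img by blast
    have "VV_act j k A D c \<in> VV j k"
      using VV_act_closed half_integer_cases jk c by blast
    then show "\<rho> (block_diag A D) f \<in> W" using act[OF A c(1)] img c(2) by (metis image_eqI)
  qed
  ultimately show ?thesis by blast
qed

end

section \<open>The two actions on families of pairs\<close>

lemma laurent_entry_mult: "F \<in> laurent \<Longrightarrow> (\<lambda>Z. Z $ i $ j * F Z) \<in> laurent"
proof -
  assume F: "F \<in> laurent"
  have "(\<lambda>Z. on_inv (\<lambda>Z. Z $ i $ j) Z * F Z) \<in> laurent" by (intro laurent.mult laurent_entry F)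
  moreover have "(\<lambda>Z. on_inv (\<lambda>Z. Z $ i $ j) Z * F Z) = (\<lambda>Z. Z $ i $ j * F Z)"
    using laurent_outside[OF F] by (auto simp: fun_eq_iff on_inv_apply)
  ultimately show ?thesis by simp
qed

lemma laurent_orbit_deriv: "F \<in> laurent \<Longrightarrow> orbit_deriv A D F \<in> laurent"
  unfolding orbit_deriv_def[abs_def] rowop_def colop_def
  by (intro laurent_minus laurent.add laurent_cmult laurent_entry_mult laurent_pdv)

lemma orbit_deriv_add: "F \<in> laurent \<Longrightarrow> G \<in> laurent \<Longrightarrow> orbit_deriv A D (\<lambda>Z. F Z + G Z) Z = orbit_deriv A D F Z + orbit_deriv A D G Z"
  by (simp add: orbit_deriv_def rowop_add colop_add algebra_simps)

lemma orbit_deriv_cmult: "F \<in> laurent \<Longrightarrow> orbit_deriv A D (\<lambda>Z. c * F Z) Z = c * orbit_deriv A D F Z"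
  by (simp add: orbit_deriv_def rowop_cmult colop_cmult algebra_simps)

lemma laurent2_rho:
  assumes "f \<in> laurent2" shows "act_left A D f \<in> laurent2" "act_right A D f \<in> laurent2"
  unfolding act_left_def act_right_def
  by (intro laurent2_pair laurent_minus laurent.add laurent_cmult laurent_orbit_deriv laurent2_component assms)+

lemma rho_add:
  assumes "f \<in> laurent2" "g \<in> laurent2"
  shows "act_left A D (f + g) = act_left A D f + act_left A D g" "act_right A D (f + g) = act_right A D f + act_right A D g"
  by (rule qfun_eqI; simp add: act_left_def act_right_def orbit_deriv_add laurent2_component assms algebra_simps)+

lemma rho_scale:
  assumes "f \<in> laurent2"
  shows "act_left A D (fscale a f) = fscale a (act_left A D f)" "act_right A D (fscale a f) = fscale a (act_right A D f)"
  by (rule qfun_eqI; simp add: act_left_def act_right_def orbit_deriv_cmult laurent2_component assms algebra_simps)+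

interpretation left: sl2_action "differentiated \<pi>\<^sub>l"
proof
  fix A D f g a
  assume *: "A \<in> sl2" "D \<in> sl2" "f \<in> laurent2"
  then show "differentiated \<pi>\<^sub>l (block_diag A D) f \<in> laurent2"
    by (simp add: differentiated_\<pi>\<^sub>l laurent2_rho)
  show "differentiated \<pi>\<^sub>l (block_diag A D) (fscale a f) = fscale a (differentiated \<pi>\<^sub>l (block_diag A D) f)"
    using * by (simp only: differentiated_\<pi>\<^sub>l rho_scale qfun.subspace_scale[OF laurent2_subspace])
  assume "g \<in> laurent2"
  with * show "differentiated \<pi>\<^sub>l (block_diag A D) (f + g) =
      differentiated \<pi>\<^sub>l (block_diag A D) f + differentiated \<pi>\<^sub>l (block_diag A D) g"
    by (simp only: differentiated_\<pi>\<^sub>l rho_add qfun.subspace_add[OF laurent2_subspace])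
qed

interpretation right: sl2_action "differentiated \<pi>\<^sub>r"
proof
  fix A D f g a
  assume *: "A \<in> sl2" "D \<in> sl2" "f \<in> laurent2"
  then show "differentiated \<pi>\<^sub>r (block_diag A D) f \<in> laurent2"
    by (simp add: differentiated_\<pi>\<^sub>r laurent2_rho)
  show "differentiated \<pi>\<^sub>r (block_diag A D) (fscale a f) = fscale a (differentiated \<pi>\<^sub>r (block_diag A D) f)"
    using * by (simp only: differentiated_\<pi>\<^sub>r rho_scale qfun.subspace_scale[OF laurent2_subspace])
  assume "g \<in> laurent2"
  with * show "differentiated \<pi>\<^sub>r (block_diag A D) (f + g) =
      differentiated \<pi>\<^sub>r (block_diag A D) f + differentiated \<pi>\<^sub>r (block_diag A D) g"
    by (simp only: differentiated_\<pi>\<^sub>r rho_add qfun.subspace_add[OF laurent2_subspace])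
qed

text \<open>
The relations satisfied by all six families. In the first factor they describe the dual basis, whence
the signs; \<open>family_iso_VV\<close> normalizes them away.
\<close>

definition ladder_law :: "(quat2 \<Rightarrow> qfun \<Rightarrow> qfun) \<Rightarrow> int \<Rightarrow> int \<Rightarrow> (nat \<Rightarrow> nat \<Rightarrow> int \<Rightarrow> qfun) \<Rightarrow> bool" where
  "ladder_law \<rho> P K \<Phi> \<longleftrightarrow> (\<forall>A\<in>sl2. \<forall>D\<in>sl2. \<forall>p k q. int (p + k) = K \<longrightarrow>
     \<rho> (block_diag A D) (\<Phi> p k q) =
       fscale (of_int (P - q) * A$1$1 + of_int q * A$2$2 + (of_nat p * D$1$1 + of_nat k * D$2$2)) (\<Phi> p k q)
       + fscale (- of_int (q + 1) * A$2$1) (\<Phi> p k (q + 1)) + fscale (- of_int (P - q + 1) * A$1$2) (\<Phi> p k (q - 1))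
       + fscale (of_nat p * D$2$1) (\<Phi> (p - 1) (k + 1) q) + fscale (of_nat k * D$1$2) (\<Phi> (p + 1) (k - 1) q))"

definition family :: "int \<Rightarrow> int \<Rightarrow> (nat \<Rightarrow> nat \<Rightarrow> int \<Rightarrow> qfun) \<Rightarrow> qfun set" where
  "family P K \<Phi> = {\<Phi> p k q | p k q. int (p + k) = K \<and> 0 \<le> q \<and> q \<le> P}"

text \<open>
Multiplying the \<open>q\<close>-th vector by \<open>(- 1)\<^sup>q q! (P - q)!\<close> turns the ladder law into the action on monomials,
which identifies \<open>V\<^sub>j\<close> with its dual.
\<close>

lemma (in sl2_action) family_iso_VV:
  assumes jk: "2 * j = of_int P" "2 * k = of_int K"
    and L: "\<And>p k q. \<Phi> p k q \<in> laurent2"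
    and nz: "\<And>p k q. int (p + k) = K \<Longrightarrow> 0 \<le> q \<Longrightarrow> q \<le> P \<Longrightarrow> \<Phi> p k q \<noteq> 0"
    and out: "\<And>p k. int (p + k) = K \<Longrightarrow> \<Phi> p k (- 1) = 0" "\<And>p k. int (p + k) = K \<Longrightarrow> \<Phi> p k (P + 1) = 0"
    and law: "ladder_law \<rho> P K \<Phi>"
  shows "submodule \<rho> (qfun.span (family P K \<Phi>)) \<and> iso_VV \<rho> (qfun.span (family P K \<Phi>)) j k"
proof -
  define \<gamma> :: "nat \<Rightarrow> complex" where "\<gamma> q = (-1) ^ q * fact q * fact (nat P - q)" for q
  define F where "F q r = \<Phi> (nat K - r) r q" for q r
  define G where "G q r = fscale (\<gamma> q) (F (int q) r)" for q r
  have \<gamma>0: "\<gamma> q \<noteq> 0" for q by (simp add: \<gamma>_def)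
  have \<gamma>_Suc: "- of_nat (q + 1) * \<gamma> q = of_int (P - int q) * \<gamma> (q + 1)" if "int q < P" for q
  proof -
    have n: "nat P - q = Suc (nat P - (q + 1))" using that by linarith
    have "int (nat P - q) = P - int q" using that by linarith
    then have "(of_nat (nat P - q) :: complex) = of_int (P - int q)" by (metis of_int_of_nat_eq)
    moreover have "(fact (nat P - q) :: complex) = of_nat (nat P - q) * fact (nat P - (q + 1))"
      unfolding n fact_Suc ..
    moreover define d where "d = (of_int (P - int q) :: complex)"
    ultimately have f: "(fact (nat P - q) :: complex) = d * fact (nat P - (q + 1))" by simp
    show ?thesis unfolding \<gamma>_def f d_def[symmetric] by (simp add: algebra_simps)
  qed
  have r: "int (nat K - r + r) = K" "of_nat (nat K - r) = (of_int (K - int r) :: complex)" if "r \<in> nats_upto K" for r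
  proof -
    have "int r \<le> K" using that by (simp add: nats_upto_def)
    then have "int (nat K - r) = K - int r" by linarith
    then show "int (nat K - r + r) = K" "of_nat (nat K - r) = (of_int (K - int r) :: complex)"
      by (simp, metis of_int_of_nat_eq)
  qed
  have span: "qfun.span (family P K \<Phi>) = qfun.span {G q r | q r. q \<in> nats_upto P \<and> r \<in> nats_upto K}"
  proof (rule qfun.span_eq[THEN iffD2], intro conjI subsetI)
    fix x assume "x \<in> family P K \<Phi>"
    then obtain p k q where *: "x = \<Phi> p k q" "int (p + k) = K" "0 \<le> q" "q \<le> P" unfolding family_def by blast
    have "nat K - k = p" "nat q \<in> nats_upto P" "k \<in> nats_upto K" "int (nat q) = q" using * by (auto simp: nats_upto_def)
    then have "fscale (\<gamma> (nat q)) x = G (nat q) k" by (simp add: G_def F_def *(1))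
    then have "fscale (\<gamma> (nat q)) x \<in> qfun.span {G q r | q r. q \<in> nats_upto P \<and> r \<in> nats_upto K}"
      using \<open>nat q \<in> nats_upto P\<close> \<open>k \<in> nats_upto K\<close> by (intro qfun.span_base) blast
    then show "x \<in> qfun.span {G q r | q r. q \<in> nats_upto P \<and> r \<in> nats_upto K}"
      using \<gamma>0 by (rule span_unscale)
  next
    fix x assume "x \<in> {G q r | q r. q \<in> nats_upto P \<and> r \<in> nats_upto K}"
    then obtain q r' where *: "x = G q r'" "q \<in> nats_upto P" "r' \<in> nats_upto K" by blast
    have "F (int q) r' \<in> family P K \<Phi>"
      unfolding family_def F_def mem_Collect_eq using r(1)[OF *(3)] *(2)
      by (intro exI[of _ "nat K - r'"] exI[of _ r'] exI[of _ "int q"]) (simp add: nats_upto_def)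
    then show "x \<in> qfun.span (family P K \<Phi>)"
      unfolding *(1) G_def by (intro qfun.span_scale qfun.span_base)
  qed
  show ?thesis
  proof (rule module_iso_VV[OF jk _ _ _ span])
    fix q r' assume qr: "q \<in> nats_upto P" "r' \<in> nats_upto K"
    have q: "int q \<le> P" using qr by (simp add: nats_upto_def)
    show "G q r' \<in> laurent2" unfolding G_def F_def by (intro qfun.subspace_scale laurent2_subspace L)
    have "F (int q) r' \<noteq> 0" unfolding F_def using nz r(1) qr q by simp
    then show "G q r' \<noteq> 0" unfolding G_def using \<gamma>0[of q] by (simp only: qfun.scale_eq_0_iff) blast
    fix A D assume A: "A \<in> sl2" "D \<in> sl2"
    have FL: "F (int q) r' \<in> laurent2" unfolding F_def by (rule L)
    have up: "fscale (\<gamma> q) (fscale (- of_int (int q + 1) * A$2$1) (F (int q + 1) r')) = fscale (of_int (P - int q) * A$2$1) (G (q + 1) r')"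
    proof (cases "int q < P")
      case True
      have "\<gamma> q * (- of_int (int q + 1) * A$2$1) = (- of_nat (q + 1) * \<gamma> q) * A$2$1" by (simp add: algebra_simps)
      also have "\<dots> = (of_int (P - int q) * A$2$1) * \<gamma> (q + 1)" unfolding \<gamma>_Suc[OF True] by simp
      finally show ?thesis unfolding G_def qfun.scale_scale by (simp add: add.commute)
    next
      case False
      then have "P = int q" using q by simp
      moreover have "F (P + 1) r' = 0" unfolding F_def using out(2) r(1) qr by blast
      ultimately show ?thesis by (simp only: diff_self of_int_0 mult_zero_left qfun.scale_zero_left qfun.scale_zero_right)
    qed
    have down: "fscale (\<gamma> q) (fscale (- of_int (P - int q + 1) * A$1$2) (F (int q - 1) r')) = fscale (of_nat q * A$1$2) (G (q - 1) r')"
    proof (cases q)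
      case 0
      have "F (int q - 1) r' = 0" unfolding F_def 0 using out(1) r(1) qr by simp
      then show ?thesis by (simp only: 0 of_nat_0 mult_zero_left qfun.scale_zero_left qfun.scale_zero_right)
    next
      case (Suc q')
      then have "int q' < P" using q by simp
      have "\<gamma> q * (- of_int (P - int q + 1) * A$1$2) = - (of_int (P - int q') * \<gamma> (q' + 1)) * A$1$2"
        by (simp add: Suc algebra_simps)
      also have "\<dots> = (of_nat q * A$1$2) * \<gamma> q'" unfolding \<gamma>_Suc[OF \<open>int q' < P\<close>, symmetric] by (simp add: Suc algebra_simps)
      finally show ?thesis unfolding G_def qfun.scale_scale by (simp add: Suc)
    qed
    have D21: "fscale (\<gamma> q) (fscale (of_nat (nat K - r') * D$2$1) (\<Phi> (nat K - r' - 1) (r' + 1) (int q))) = 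
        fscale (of_int (K - int r') * D$2$1) (G q (r' + 1))"
      unfolding r(2)[OF qr(2)] G_def F_def by (simp add: mult.commute)
    have D12: "fscale (\<gamma> q) (fscale (of_nat r' * D$1$2) (\<Phi> (nat K - r' + 1) (r' - 1) (int q))) = 
        fscale (of_nat r' * D$1$2) (G q (r' - 1))"
    proof (cases r')
      case 0 then show ?thesis by (simp only: of_nat_0 mult_zero_left qfun.scale_zero_left qfun.scale_zero_right)
    next
      case (Suc r'')
      then have "nat K - r' + 1 = nat K - (r' - 1)" using qr by (auto simp: nats_upto_def)
      then show ?thesis unfolding G_def F_def by (simp add: mult.commute)
    qed
    have lawF: "\<rho> (block_diag A D) (F (int q) r') =
       fscale (of_int (P - int q) * A$1$1 + of_int (int q) * A$2$2 + (of_nat (nat K - r') * D$1$1 + of_nat r' * D$2$2)) (F (int q) r')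
       + fscale (- of_int (int q + 1) * A$2$1) (F (int q + 1) r') + fscale (- of_int (P - int q + 1) * A$1$2) (F (int q - 1) r')
       + fscale (of_nat (nat K - r') * D$2$1) (\<Phi> (nat K - r' - 1) (r' + 1) (int q)) + fscale (of_nat r' * D$1$2) (\<Phi> (nat K - r' + 1) (r' - 1) (int q))"
      using law A r(1)[OF qr(2)] unfolding ladder_law_def F_def by blast
    have main: "fscale (\<gamma> q) (fscale (of_int (P - int q) * A$1$1 + of_int (int q) * A$2$2 + (of_nat (nat K - r') * D$1$1 + of_nat r' * D$2$2)) (F (int q) r'))
       = fscale (of_int (P - int q) * A$1$1 + of_nat q * A$2$2 + (of_int (K - int r') * D$1$1 + of_nat r' * D$2$2)) (G q r')"
      unfolding r(2)[OF qr(2)] G_def by (simp add: mult.commute)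
    show "\<rho> (block_diag A D) (G q r') =
        fscale (of_int (P - int q) * A$1$1 + of_nat q * A$2$2 + (of_int (K - int r') * D$1$1 + of_nat r' * D$2$2)) (G q r')
        + fscale (of_int (P - int q) * A$2$1) (G (q + 1) r') + fscale (of_nat q * A$1$2) (G (q - 1) r')
        + fscale (of_int (K - int r') * D$2$1) (G q (r' + 1)) + fscale (of_nat r' * D$1$2) (G q (r' - 1))"
      unfolding G_def[of q r'] scale[OF A FL] lawF qfun.scale_right_distrib up down D21 D12 main
      unfolding G_def[of q r'] ..
  qed
qed

section \<open>Ladder relations of the four kinds of pairs\<close>

text \<open>
The power of \<open>N\<close> does not contribute, since \<open>A\<close> and \<open>D\<close> are traceless.
\<close>

lemma orbit_deriv_Ntpoly:
  assumes "A \<in> sl2" "D \<in> sl2"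
  shows "orbit_deriv A D (Ntpoly b p k q) Z =
    (of_int (int (p + k) - q) * A$1$1 + of_int q * A$2$2 + (of_nat p * D$1$1 + of_nat k * D$2$2)) * Ntpoly b p k q Z
    - of_int (q + 1) * A$2$1 * Ntpoly b p k (q + 1) Z - of_int (int (p + k) - q + 1) * A$1$2 * Ntpoly b p k (q - 1) Z
    + of_nat p * D$2$1 * Ntpoly b (p - 1) (Suc k) q Z + of_nat k * D$1$2 * Ntpoly b (Suc p) (k - 1) q Z"
  unfolding orbit_deriv_def rowop_Ntpoly_values colop_Ntpoly_values
  by (simp add: sl2_trace[OF assms(1)] sl2_trace[OF assms(2)] algebra_simps)

lemma ladder_law_left_regular: "ladder_law (differentiated \<pi>\<^sub>l) (K + 1) K (left_regular b)"
  unfolding ladder_law_def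
proof (intro ballI allI impI)
  fix A D p k q assume A: "A \<in> sl2" "D \<in> sl2" and K: "int (p + k) = K"
  note act = orbit_deriv_Ntpoly[OF A] orbit_deriv_cmult[OF laurent_Ntpoly]
  show "differentiated \<pi>\<^sub>l (block_diag A D) (left_regular b p k q) =
       fscale (of_int (K + 1 - q) * A$1$1 + of_int q * A$2$2 + (of_nat p * D$1$1 + of_nat k * D$2$2)) (left_regular b p k q)
       + fscale (- of_int (q + 1) * A$2$1) (left_regular b p k (q + 1)) + fscale (- of_int (K + 1 - q + 1) * A$1$2) (left_regular b p k (q - 1))
       + fscale (of_nat p * D$2$1) (left_regular b (p - 1) (k + 1) q) + fscale (of_nat k * D$1$2) (left_regular b (p + 1) (k - 1) q)"
    unfolding differentiated_\<pi>\<^sub>l[OF laurent2_basis(1) A(1)] K[symmetric]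
    by (rule qfun_eqI; simp only: act_left_def left_regular_def pair_component fscale_component plus_fun_apply vector_add_component act; 
       simp add: sl2_trace[OF A(1)] sl2_trace[OF A(2)] algebra_simps)
qed

lemma ladder_law_left_coregular: "ladder_law (differentiated \<pi>\<^sub>l) (K - 1) K (\<lambda>p k q. left_coregular b p k (q + 1))"
  unfolding ladder_law_def
proof (intro ballI allI impI)
  fix A D p k q assume A: "A \<in> sl2" "D \<in> sl2" and K: "int (p + k) = K"
  note act = orbit_deriv_Ntpoly[OF A] orbit_deriv_cmult[OF laurent_Ntpoly]
  show "differentiated \<pi>\<^sub>l (block_diag A D) (left_coregular b p k (q + 1)) =
       fscale (of_int (K - 1 - q) * A$1$1 + of_int q * A$2$2 + (of_nat p * D$1$1 + of_nat k * D$2$2)) (left_coregular b p k (q + 1))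
       + fscale (- of_int (q + 1) * A$2$1) (left_coregular b p k (q + 1 + 1)) + fscale (- of_int (K - 1 - q + 1) * A$1$2) (left_coregular b p k (q - 1 + 1))
       + fscale (of_nat p * D$2$1) (left_coregular b (p - 1) (k + 1) (q + 1)) + fscale (of_nat k * D$1$2) (left_coregular b (p + 1) (k - 1) (q + 1))"
    unfolding differentiated_\<pi>\<^sub>l[OF laurent2_basis(2) A(1)] K[symmetric]
    by (cases p; cases k; rule qfun_eqI; simp only: act_left_def left_coregular_def pair_component fscale_component plus_fun_apply vector_add_component act; 
       simp add: sl2_trace[OF A(1)] sl2_trace[OF A(2)] algebra_simps)
qed

lemma ladder_law_right_regular: "ladder_law (differentiated \<pi>\<^sub>r) (K - 1) K (right_regular b)"
  unfolding ladder_law_def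
proof (intro ballI allI impI)
  fix A D p k q assume A: "A \<in> sl2" "D \<in> sl2" and K: "int (p + k) = K"
  note act = orbit_deriv_Ntpoly[OF A] orbit_deriv_cmult[OF laurent_Ntpoly]
  show "differentiated \<pi>\<^sub>r (block_diag A D) (right_regular b p k q) =
       fscale (of_int (K - 1 - q) * A$1$1 + of_int q * A$2$2 + (of_nat p * D$1$1 + of_nat k * D$2$2)) (right_regular b p k q)
       + fscale (- of_int (q + 1) * A$2$1) (right_regular b p k (q + 1)) + fscale (- of_int (K - 1 - q + 1) * A$1$2) (right_regular b p k (q - 1))
       + fscale (of_nat p * D$2$1) (right_regular b (p - 1) (k + 1) q) + fscale (of_nat k * D$1$2) (right_regular b (p + 1) (k - 1) q)"
    unfolding differentiated_\<pi>\<^sub>r[OF laurent2_basis(3) A(1) A(2)] K[symmetric]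
    by (cases p; cases k; rule qfun_eqI; simp only: act_right_def right_regular_def pair_component fscale_component plus_fun_apply vector_add_component act; 
       simp add: sl2_trace[OF A(1)] sl2_trace[OF A(2)] algebra_simps)
qed

lemma ladder_law_right_coregular: "ladder_law (differentiated \<pi>\<^sub>r) (K + 1) K (right_coregular b)"
  unfolding ladder_law_def
proof (intro ballI allI impI)
  fix A D p k q assume A: "A \<in> sl2" "D \<in> sl2" and K: "int (p + k) = K"
  note act = orbit_deriv_Ntpoly[OF A] orbit_deriv_cmult[OF laurent_Ntpoly]
  show "differentiated \<pi>\<^sub>r (block_diag A D) (right_coregular b p k q) =
       fscale (of_int (K + 1 - q) * A$1$1 + of_int q * A$2$2 + (of_nat p * D$1$1 + of_nat k * D$2$2)) (right_coregular b p k q)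
       + fscale (- of_int (q + 1) * A$2$1) (right_coregular b p k (q + 1)) + fscale (- of_int (K + 1 - q + 1) * A$1$2) (right_coregular b p k (q - 1))
       + fscale (of_nat p * D$2$1) (right_coregular b (p - 1) (k + 1) q) + fscale (of_nat k * D$1$2) (right_coregular b (p + 1) (k - 1) q)"
    unfolding differentiated_\<pi>\<^sub>r[OF laurent2_basis(4) A(1) A(2)] K[symmetric]
    by (cases p; cases k; rule qfun_eqI; simp only: act_right_def right_coregular_def pair_component fscale_component plus_fun_apply vector_add_component act; 
       simp add: sl2_trace[OF A(1)] sl2_trace[OF A(2)] algebra_simps)
qed

section \<open>The contour integral\<close>

lemma higher_deriv_poly: "(deriv ^^ n) (poly P) = poly ((pderiv ^^ n) P)" for P :: "complex poly"
proof (induction n)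
  case (Suc n)
  have "deriv (poly Q) = poly (pderiv Q)" for Q :: "complex poly"
    by (rule ext) (rule DERIV_imp_deriv[OF poly_DERIV])
  then show ?case by (simp add: Suc.IH)
qed simp

text \<open>
Cauchy's formula for the \<open>n\<close>-th derivative at \<open>0\<close>.
\<close>

lemma contour_integral_coeff:
  fixes P :: "complex poly"
  shows "contour_integral (circlepath 0 1) (\<lambda>s. poly P s / s ^ Suc n) = 2 * of_real pi * \<i> * coeff P n"
proof -
  have "((\<lambda>s. poly P s / (s - 0) ^ Suc n) has_contour_integral
      of_real (2 * pi) * \<i> / fact n * (deriv ^^ n) (poly P) 0) (circlepath 0 1)"
    by (rule Cauchy_has_contour_integral_higher_derivative_circlepath)
      (auto intro!: continuous_intros holomorphic_intros)
  moreover have "(deriv ^^ n) (poly P) 0 = fact n * coeff P n"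
    unfolding higher_deriv_poly poly_0_coeff_0 coeff_higher_pderiv by (simp add: pochhammer_fact)
  ultimately show ?thesis by (simp add: contour_integral_unique)
qed

text \<open>
Outside the range of \<open>n\<close> both sides vanish, so \<open>q\<close> is an arbitrary integer.
\<close>

lemma tcoef_eq_tpoly:
  assumes L: "2 * l = real L" and k: "k \<le> L"
  shows "tcoef l (l - of_int q) (real k - l) Z = tpoly (L - k) k q Z"
proof (cases "0 \<le> q \<and> q \<le> int L")
  case False
  have "l - of_int q \<notin> steps (- l) l"
  proof
    assume "l - of_int q \<in> steps (- l) l"
    then have "l - of_int q - - l \<in> \<nat>" "of_int q \<ge> (0::real)" by (simp_all add: steps_def)
    then obtain m where "l - of_int q - - l = real m" by (auto elim: Nats_cases)
    then have "of_int (int L - q) = (of_int (int m) :: real)" using L by simp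
    then have "int L - q = int m" by (simp only: of_int_eq_iff)
    then show False using False \<open>of_int q \<ge> (0::real)\<close> by simp
  qed
  moreover have "q < 0 \<or> q > int (L - k + k)" using False k by auto
  ultimately show ?thesis by (simp add: tcoef_def tpoly_eq_0)
next
  case True
  then obtain n where n: "q = int n" "n \<le> L" by (metis of_nat_le_iff zero_le_imp_eq_int)
  have "l - real n - - l = real (L - n)" using n L by (simp add: of_nat_diff)
  then have s1: "l - of_int q \<in> steps (- l) l" unfolding steps_def n by simp
  have "real k - l - - l = real k" by simp
  then have s2: "real k - l \<in> steps (- l) l" unfolding steps_def using k L by simp
  have "l - (real k - l) = of_int (int (L - k))" "l + (real k - l) = of_int (int k)" "- l + (l - of_int q) = of_int (- int n)"
    using L k n by (simp_all add: of_nat_diff)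
  then have fl: "nat \<lfloor>l - (real k - l)\<rfloor> = L - k" "nat \<lfloor>l + (real k - l)\<rfloor> = k" "\<lfloor>- l + (l - of_int q)\<rfloor> = - int n"
    by (simp_all only: floor_of_int nat_int)
  define P where "P = [:Z$2$1, Z$1$1:] ^ (L - k) * [:Z$2$2, Z$1$2:] ^ k"
  have e: "(\<lambda>s. (s * Z$1$1 + Z$2$1) ^ (L - k) * (s * Z$1$2 + Z$2$2) ^ k * s powi (- int n) / s) = (\<lambda>s. poly P s / s ^ Suc n)"
    by (simp add: fun_eq_iff P_def power_int_minus field_simps)
  have "tcoef l (l - of_int q) (real k - l) Z = 1 / (2 * of_real pi * \<i>) * (2 * of_real pi * \<i> * coeff P n)"
    unfolding tcoef_def fl e contour_integral_coeff by (simp only: s1 s2 simp_thms if_True)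
  then have "tcoef l (l - of_int q) (real k - l) Z = coeff P n" by simp
  then show ?thesis by (simp add: tpoly_def P_def n)
qed

lemma steps_eq:
  assumes "b - a = of_int P"
  shows "steps a b = {a + real i | i. int i \<le> P}"
proof -
  have "x \<in> steps a b \<longleftrightarrow> (\<exists>i. x = a + real i \<and> int i \<le> P)" for x
  proof
    assume x: "x \<in> steps a b"
    then obtain i where i: "x - a = real i" by (auto simp: steps_def elim: Nats_cases)
    moreover have "(of_int (int i) :: real) \<le> of_int P" using x i assms by (simp add: steps_def)
    then have "int i \<le> P" by (simp only: of_int_le_iff)
    ultimately show "\<exists>i. x = a + real i \<and> int i \<le> P" by (intro exI[of _ i]) simp
  next
    assume "\<exists>i. x = a + real i \<and> int i \<le> P"
    then obtain i where i: "x = a + real i" "int i \<le> P" by blast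
    then have "(of_int (int i) :: real) \<le> of_int P" by (simp only: of_int_le_iff)
    then show "x \<in> steps a b" using i assms by (simp add: steps_def)
  qed
  then show ?thesis by blast
qed

section \<open>The homogeneous solutions\<close>

definition Z_pos :: quat where "Z_pos = vector [vector [2, 1], vector [1, 1]]"

lemma N_Z_pos: "N Z_pos = 1"
  by (simp add: N_eq Z_pos_def)

lemma Ntpoly_Z_pos: "0 \<le> q \<Longrightarrow> q \<le> int (p + k) \<Longrightarrow> Ntpoly b p k q Z_pos \<noteq> 0"
proof -
  assume q: "0 \<le> q" "q \<le> int (p + k)"
  define a :: "2 \<Rightarrow> 2 \<Rightarrow> real" where "a i j = (if i = 1 \<and> j = 1 then 2 else 1)" for i j
  have "Z_pos $ i $ j = of_real (a i j)" "a i j > 0" for i j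
    using exhaust_2[of i] exhaust_2[of j] by (auto simp: Z_pos_def a_def)
  from tpoly_positive[OF this, of p k q] q show ?thesis by (auto simp: Ntpoly_apply N_Z_pos)
qed

lemma Ntpoly_range: "q < 0 \<or> q > int (p + k) \<Longrightarrow> Ntpoly b p k q Z = 0"
  by (simp add: Ntpoly_apply tpoly_eq_0)

lemma nonzero_qfunI: "f Z $ i \<noteq> 0 \<Longrightarrow> f \<noteq> (0 :: qfun)"
  by (metis zero_qfun_component)

text \<open>
Each pair in range has a component that does not vanish at \<open>Z_pos\<close>.
\<close>

lemma left_regular_nonzero: 
  assumes "0 \<le> q" "q \<le> int (p + k) + 1" shows "left_regular b p k q \<noteq> 0"
proof (cases "q \<le> int (p + k)")
  case True
  then show ?thesis using assms Ntpoly_Z_pos[of q p k b] by (intro nonzero_qfunI[of _ Z_pos 1]) (simp add: left_regular_def)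
next
  case False
  then show ?thesis using assms Ntpoly_Z_pos[of "q - 1" p k b] by (intro nonzero_qfunI[of _ Z_pos 2]) (simp add: left_regular_def)
qed

lemma left_regular_zero: "q < 0 \<or> q > int (p + k) + 1 \<Longrightarrow> left_regular b p k q = 0"
  by (rule qfun_eqI; auto simp: left_regular_def Ntpoly_range)

lemma left_coregular_nonzero: 
  assumes "1 \<le> q" "q \<le> int (p + k)" shows "left_coregular b p k q \<noteq> 0"
  using assms Ntpoly_Z_pos[of q p k b] by (intro nonzero_qfunI[of _ Z_pos 1]) (simp add: left_coregular_def)

lemma left_coregular_zero: "q < 1 \<or> q > int (p + k) \<Longrightarrow> left_coregular b p k q = 0"
proof (rule qfun_eqI)
  fix Z assume q: "q < 1 \<or> q > int (p + k)"
  show "left_coregular b p k q Z $ 1 = 0 Z $ 1"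
    using q by (cases "q = 0") (auto simp: left_coregular_def Ntpoly_range)
  show "left_coregular b p k q Z $ 2 = 0 Z $ 2"
    using q by (cases "q = int (p + k) + 1") (auto simp: left_coregular_def Ntpoly_range)
qed

lemma right_regular_nonzero: 
  assumes "0 \<le> q" "q < int (p + k)" shows "right_regular b p k q \<noteq> 0"
proof (cases k)
  case 0
  then have "p > 0" using assms by simp
  then show ?thesis using assms 0 Ntpoly_Z_pos[of q "p - 1" k b] 
    by (intro nonzero_qfunI[of _ Z_pos 2]) (simp add: right_regular_def of_nat_diff)
next
  case (Suc k')
  have "of_nat k * Ntpoly b p k' q Z_pos \<noteq> 0"
    using Suc assms Ntpoly_Z_pos[of q p k' b] by (simp del: of_nat_Suc)
  then show ?thesis by (intro nonzero_qfunI[of _ Z_pos 1]) (simp add: right_regular_def Suc del: of_nat_Suc)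
qed

lemma right_regular_zero: "q < 0 \<or> q \<ge> int (p + k) \<Longrightarrow> right_regular b p k q = 0"
proof (rule qfun_eqI)
  fix Z assume q: "q < 0 \<or> q \<ge> int (p + k)"
  show "right_regular b p k q Z $ 1 = 0 Z $ 1"
    using q by (cases k) (auto simp: right_regular_def Ntpoly_range)
  show "right_regular b p k q Z $ 2 = 0 Z $ 2"
    using q by (cases p) (auto simp: right_regular_def Ntpoly_range)
qed

lemma right_coregular_nonzero: 
  assumes "0 \<le> q" "q \<le> int (p + k) + 1" shows "right_coregular b p k q \<noteq> 0"
  using assms Ntpoly_Z_pos[of q "Suc p" k b] by (intro nonzero_qfunI[of _ Z_pos 1]) (simp add: right_coregular_def)

lemma right_coregular_zero: "q < 0 \<or> q > int (p + k) + 1 \<Longrightarrow> right_coregular b p k q = 0"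
  by (rule qfun_eqI; auto simp: right_coregular_def Ntpoly_range)

lemma homogeneous_subspace: 
  assumes "\<And>f g. f \<in> laurent2 \<Longrightarrow> g \<in> laurent2 \<Longrightarrow> Q (f + g) = Q f + Q g"
    "\<And>c f. f \<in> laurent2 \<Longrightarrow> Q (fscale c f) = fscale c (Q f)"
  shows "qfun.subspace {f \<in> laurent2. Q f = 0 \<and> homogeneous d f}"
  unfolding qfun.subspace_def
proof (intro conjI ballI allI)
  have "0 \<in> laurent2" using laurent2_subspace by (rule qfun.subspace_0)
  moreover have "Q 0 = 0" using assms(2)[OF \<open>0 \<in> laurent2\<close>, of 0] by (simp only: qfun.scale_zero_left)
  moreover have "homogeneous d 0" by (simp add: homogeneous_def)
  ultimately show "0 \<in> {f \<in> laurent2. Q f = 0 \<and> homogeneous d f}" by blast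
next
  fix f g assume "f \<in> {f \<in> laurent2. Q f = 0 \<and> homogeneous d f}" "g \<in> {f \<in> laurent2. Q f = 0 \<and> homogeneous d f}"
  then have *: "f \<in> laurent2" "g \<in> laurent2" "Q f = 0" "Q g = 0" "homogeneous d f" "homogeneous d g" by blast+
  have "Q (f + g) = 0" using assms(1)[OF *(1,2)] *(3,4) by (simp only: add_0_left)
  moreover have "homogeneous d (f + g)" using *(5,6) by (simp add: homogeneous_def vec_eq_iff algebra_simps)
  ultimately show "f + g \<in> {f \<in> laurent2. Q f = 0 \<and> homogeneous d f}"
    using qfun.subspace_add[OF laurent2_subspace *(1,2)] by blast
next
  fix c f assume "f \<in> {f \<in> laurent2. Q f = 0 \<and> homogeneous d f}"
  then have *: "f \<in> laurent2" "Q f = 0" "homogeneous d f" by blast+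
  have "Q (fscale c f) = 0" using assms(2)[OF *(1)] *(2) by (simp only: qfun.scale_zero_right)
  moreover have "homogeneous d (fscale c f)" using *(3) by (simp add: homogeneous_def vec_eq_iff algebra_simps)
  ultimately show "fscale c f \<in> {f \<in> laurent2. Q f = 0 \<and> homogeneous d f}"
    using qfun.subspace_scale[OF laurent2_subspace *(1)] by blast
qed

lemma fscale_of_int_eq_0: "fscale (of_int c) f = 0 \<Longrightarrow> f \<noteq> 0 \<Longrightarrow> c = 0"
  by (simp only: qfun.scale_eq_0_iff of_int_eq_0_iff) blast

text \<open>
The six families of the theorem. The arithmetic in the bounds follows the pattern of the ladder laws,
\<open>K + 1\<close> or \<open>K - 1\<close> against \<open>K\<close>.
\<close>

abbreviation (input) "left1 L \<equiv> family (int L + 1) (int L) (left_regular 0)"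
abbreviation (input) "left2 L \<equiv> family (int L - 1) (int L) (\<lambda>p k q. left_coregular 0 p k (q + 1))"
abbreviation (input) "left3 L \<equiv> family (int L - 2 + 1) (int L - 2) (left_regular 1)"
abbreviation (input) "right1 L \<equiv> family (int L + 1 - 1) (int L + 1) (right_regular 0)"
abbreviation (input) "right2 L \<equiv> family (int L - 1 + 1) (int L - 1) (right_coregular 0)"
abbreviation (input) "right3 L \<equiv> family (int L - 1 - 1) (int L - 1) (right_regular 1)"

lemma left_basis_cases:
  assumes "x \<in> left_basis"
  obtains b p k q where "x = left_regular b p k q" | b p k q where "x = left_coregular b p k q"
proof -
  have "(\<exists>b p k q. x = left_regular b p k q) \<or> (\<exists>b p k q. x = left_coregular b p k q)" using assms by (simp add: left_basis_def)
  then show ?thesis using that by (elim disjE exE) simp_all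
qed

lemma right_basis_cases:
  assumes "x \<in> right_basis"
  obtains b p k q where "x = right_regular b p k q" | b p k q where "x = right_coregular b p k q"
proof -
  have "(\<exists>b p k q. x = right_regular b p k q) \<or> (\<exists>b p k q. x = right_coregular b p k q)" using assms by (simp add: right_basis_def)
  then show ?thesis using that by (elim disjE exE) simp_all
qed

lemma familyI: "int (p + k) = K \<Longrightarrow> 0 \<le> q \<Longrightarrow> q \<le> P \<Longrightarrow> \<Phi> p k q \<in> family P K \<Phi>"
  unfolding family_def by blast

lemma family_subset: "(\<And>p k q. int (p + k) = K \<Longrightarrow> \<Phi> p k q \<in> T) \<Longrightarrow> family P K \<Phi> \<subseteq> T"
  unfolding family_def by auto

lemma homogeneous_kernel_eq_span:
  assumes B: "B \<subseteq> laurent2" "laurent2 \<subseteq> qfun.span B"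
    and hom: "\<And>b. b \<in> B \<Longrightarrow> \<exists>e. homogeneous e b"
    and Q: "\<And>f g. f \<in> laurent2 \<Longrightarrow> g \<in> laurent2 \<Longrightarrow> Q (f + g) = Q f + Q g"
      "\<And>c f. f \<in> laurent2 \<Longrightarrow> Q (fscale c f) = fscale c (Q f)"
      "\<And>b. b \<in> B \<Longrightarrow> \<exists>\<mu>. Q b = fscale \<mu> b"
    and sub: "S \<subseteq> {f \<in> laurent2. Q f = 0 \<and> homogeneous d f}"
    and kernel: "\<And>b. b \<in> B \<Longrightarrow> b \<noteq> 0 \<Longrightarrow> degree_op d b = 0 \<Longrightarrow> Q b = 0 \<Longrightarrow> b \<in> S"
  shows "{f \<in> laurent2. Q f = 0 \<and> homogeneous d f} = qfun.span S"
proof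
  show "qfun.span S \<subseteq> {f \<in> laurent2. Q f = 0 \<and> homogeneous d f}"
    by (rule qfun.span_minimal[OF sub homogeneous_subspace[OF Q(1,2)]])
  show "{f \<in> laurent2. Q f = 0 \<and> homogeneous d f} \<subseteq> qfun.span S"
  proof
    fix f assume "f \<in> {f \<in> laurent2. Q f = 0 \<and> homogeneous d f}"
    then have f: "f \<in> laurent2" "homogeneous d f" "Q f = 0" by simp_all
    have "f \<in> qfun.span {b \<in> B. degree_op d b = 0 \<and> Q b = 0}"
      by (rule homogeneous_kernel[OF B hom Q f])
    moreover have "{b \<in> B. degree_op d b = 0 \<and> Q b = 0} \<subseteq> qfun.span S"
    proof
      fix b assume "b \<in> {b \<in> B. degree_op d b = 0 \<and> Q b = 0}"
      then have b: "b \<in> B" "degree_op d b = 0" "Q b = 0" by blast+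
      show "b \<in> qfun.span S"
      proof (cases "b = 0")
        case True
        then show ?thesis by (simp only: qfun.span_zero)
      next
        case False
        then show ?thesis using kernel b by (intro qfun.span_base) blast
      qed
    qed
    ultimately show "f \<in> qfun.span S"
      using qfun.span_minimal[OF _ qfun.subspace_span] by blast
  qed
qed

text \<open>
A nonzero pair of degree \<open>L \<ge> 0\<close> has \<open>2b + p + k = L\<close>, so the factors of the eigenvalue that contain
\<open>p + k\<close> can vanish only for \<open>b = 0\<close>; the factor \<open>b - 1\<close> of the regular pairs leaves \<open>b = 1\<close>.
\<close>

lemma \<U>_deg_eq_span: "\<U>_deg (int L) = qfun.span (left1 L \<union> left2 L \<union> left3 L)" (is "_ = qfun.span ?S")
proof -
  have "\<U>_deg (int L) = {f \<in> laurent2. left_op f = 0 \<and> homogeneous (int L) f}"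
    unfolding \<U>_deg_def \<U>_eq by blast
  also have "\<dots> = qfun.span ?S"
  proof (rule homogeneous_kernel_eq_span[OF _ laurent2_span_left_basis _ left_op_add left_op_scale])
    show "left_basis \<subseteq> laurent2" by (rule subsetI, erule left_basis_cases) (simp_all only: laurent2_basis)
    show "\<exists>e. homogeneous e b" if "b \<in> left_basis" for b
      using that by (rule left_basis_cases) (simp_all only:, (rule exI, rule homogeneous_basis)+)
    show "\<exists>\<mu>. left_op b = fscale \<mu> b" if "b \<in> left_basis" for b
      using that by (rule left_basis_cases) (simp_all only:, (rule exI, rule left_op_left_regular left_op_left_coregular)+)
    have "left_op (left_regular 0 p k q) = 0" "left_op (left_regular 1 p k q) = 0" "left_op (left_coregular 0 p k q) = 0" for p k q
      unfolding left_op_left_regular left_op_left_coregular by (rule qfun_eqI; simp)+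
    moreover have "homogeneous (int L) (left_regular 0 p k q)" "homogeneous (int L) (left_coregular 0 p k q)" if "int (p + k) = int L" for p k q
      using homogeneous_basis(1,2)[of 0 p k q] that by simp_all
    moreover have "homogeneous (int L) (left_regular 1 p k q)" if "int (p + k) = int L - 2" for p k q
      using homogeneous_basis(1)[of 1 p k q] that by simp
    ultimately show "?S \<subseteq> {f \<in> laurent2. left_op f = 0 \<and> homogeneous (int L) f}"
      by (intro Un_least family_subset CollectI conjI laurent2_basis) simp_all
    fix x assume x: "x \<in> left_basis" "x \<noteq> 0" "degree_op (int L) x = 0" "left_op x = 0"
    from x(1) show "x \<in> ?S"
    proof (cases rule: left_basis_cases)
      case (1 b p k q)
      have d: "int L = 2 * b + int (p + k)"
        using x(2,3) degree_op_zero_iff[OF laurent2_basis(1) homogeneous_basis(1)] unfolding 1 by blast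
      have q: "0 \<le> q" "q \<le> int (p + k) + 1" using left_regular_zero x(2) unfolding 1 by (meson not_le)+
      have "2 * b * (b + 1 + int (p + k)) * (b - 1) = 0"
        using x(4,2) unfolding 1 left_op_left_regular by (rule fscale_of_int_eq_0)
      then consider "b = 0" | "b = 1" using d by auto
      then show ?thesis
      proof cases
        assume b: "b = 0"
        then have "x \<in> left1 L" unfolding 1 b using d q b by (intro familyI) simp_all
        then show ?thesis by blast
      next
        assume b: "b = 1"
        then have "x \<in> left3 L" unfolding 1 b using d q b by (intro familyI) simp_all
        then show ?thesis by blast
      qed
    next
      case (2 b p k q)
      have d: "int L = 2 * b + int (p + k)"
        using x(2,3) degree_op_zero_iff[OF laurent2_basis(2) homogeneous_basis(2)] unfolding 2 by blast
      have q: "1 \<le> q" "q \<le> int (p + k)" using left_coregular_zero x(2) unfolding 2 by (meson not_le)+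
      have "2 * b * (b + 1 + int (p + k)) * (b + int (p + k)) = 0"
        using x(4,2) unfolding 2 left_op_left_coregular by (rule fscale_of_int_eq_0)
      then have b: "b = 0" using d by auto
      have "left_coregular 0 p k (q - 1 + 1) \<in> left2 L" using d q b
        by (intro familyI[where \<Phi> = "\<lambda>p k q. left_coregular 0 p k (q + 1)"]) simp_all
      then have "x \<in> left2 L" unfolding 2 b by simp
      then show ?thesis by blast
    qed
  qed
  finally show ?thesis .
qed

text \<open>
As before, but the degree is \<open>2b + p + k - 1\<close> for the regular pairs and \<open>2b + p + k + 1\<close> for the others.
\<close>

lemma \<U>'_deg_eq_span: "\<U>'_deg (int L) = qfun.span (right1 L \<union> right2 L \<union> right3 L)" (is "_ = qfun.span ?S")
proof -
  have "\<U>'_deg (int L) = {f \<in> laurent2. right_op f = 0 \<and> homogeneous (int L) f}"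
    unfolding \<U>'_deg_def \<U>'_eq by blast
  also have "\<dots> = qfun.span ?S"
  proof (rule homogeneous_kernel_eq_span[OF _ laurent2_span_right_basis _ right_op_add right_op_scale])
    show "right_basis \<subseteq> laurent2" by (rule subsetI, erule right_basis_cases) (simp_all only: laurent2_basis)
    show "\<exists>e. homogeneous e b" if "b \<in> right_basis" for b
      using that by (rule right_basis_cases) (simp_all only:, (rule exI, rule homogeneous_basis)+)
    show "\<exists>\<mu>. right_op b = fscale \<mu> b" if "b \<in> right_basis" for b
      using that by (rule right_basis_cases) (simp_all only:, (rule exI, rule right_op_right_regular right_op_right_coregular)+)
    have "right_op (right_regular 0 p k q) = 0" "right_op (right_regular 1 p k q) = 0" "right_op (right_coregular 0 p k q) = 0" for p k q
      unfolding right_op_right_regular right_op_right_coregular by (rule qfun_eqI; simp)+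
    moreover have "homogeneous (int L) (right_regular 0 p k q)" if "int (p + k) = int L + 1" for p k q
      using homogeneous_basis(3)[of 0 p k q] that by simp
    moreover have "homogeneous (int L) (right_coregular 0 p k q)" "homogeneous (int L) (right_regular 1 p k q)" if "int (p + k) = int L - 1" for p k q
      using homogeneous_basis(4)[of 0 p k q] homogeneous_basis(3)[of 1 p k q] that by simp_all
    ultimately show "?S \<subseteq> {f \<in> laurent2. right_op f = 0 \<and> homogeneous (int L) f}"
      by (intro Un_least family_subset CollectI conjI laurent2_basis) simp_all
    fix x assume x: "x \<in> right_basis" "x \<noteq> 0" "degree_op (int L) x = 0" "right_op x = 0"
    from x(1) show "x \<in> ?S"
    proof (cases rule: right_basis_cases)
      case (1 b p k q)
      have d: "int L = 2 * b + int (p + k) - 1"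
        using x(2,3) degree_op_zero_iff[OF laurent2_basis(3) homogeneous_basis(3)] unfolding 1 by blast
      have q: "0 \<le> q" "q < int (p + k)" using right_regular_zero x(2) unfolding 1 by (meson not_le)+
      have "2 * b * (b + int (p + k)) * (b - 1) = 0"
        using x(4,2) unfolding 1 right_op_right_regular by (rule fscale_of_int_eq_0)
      then consider "b = 0" | "b = 1" using d by auto
      then show ?thesis
      proof cases
        assume b: "b = 0"
        then have "x \<in> right1 L" unfolding 1 b using d q b by (intro familyI) simp_all
        then show ?thesis by blast
      next
        assume b: "b = 1"
        then have "x \<in> right3 L" unfolding 1 b using d q b by (intro familyI) simp_all
        then show ?thesis by blast
      qed
    next
      case (2 b p k q)
      have d: "int L = 2 * b + int (p + k) + 1"
        using x(2,3) degree_op_zero_iff[OF laurent2_basis(4) homogeneous_basis(4)] unfolding 2 by blast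
      have q: "0 \<le> q" "q \<le> int (p + k) + 1" using right_coregular_zero x(2) unfolding 2 by (meson not_le)+
      have "2 * b * (b + 2 + int (p + k)) * (b + 1 + int (p + k)) = 0"
        using x(4,2) unfolding 2 right_op_right_coregular by (rule fscale_of_int_eq_0)
      then have b: "b = 0" using d by auto
      have "x \<in> right2 L" unfolding 2 b using d q b by (intro familyI) simp_all
      then show ?thesis by blast
    qed
  qed
  finally show ?thesis .
qed

section \<open>Components of a direct sum\<close>

lemma span_Un3:
  "qfun.span (A \<union> B \<union> C) = {f + g + h | f g h. f \<in> qfun.span A \<and> g \<in> qfun.span B \<and> h \<in> qfun.span C}"
  unfolding qfun.span_Un by blast

text \<open>
Apply \<open>(Q - \<beta>)(Q - \<gamma>)\<close> to \<open>f + g + h = 0\<close>, where \<open>Q\<close> has the eigenvalues \<open>\<alpha>\<close>, \<open>\<beta>\<close>, \<open>\<gamma>\<close> on the summands.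
\<close>

lemma three_eigenvectors:
  fixes f g h :: qfun
  assumes "f + g + h = 0" "fscale \<alpha> f + fscale \<beta> g + fscale \<gamma> h = 0"
    "fscale \<alpha> (fscale \<alpha> f) + fscale \<beta> (fscale \<beta> g) + fscale \<gamma> (fscale \<gamma> h) = 0"
    and "\<alpha> \<noteq> \<beta>" "\<alpha> \<noteq> \<gamma>"
  shows "f = 0"
proof -
  have "fscale ((\<alpha> - \<beta>) * (\<alpha> - \<gamma>)) f =
      (fscale \<alpha> (fscale \<alpha> f) + fscale \<beta> (fscale \<beta> g) + fscale \<gamma> (fscale \<gamma> h))
      + fscale (- (\<beta> + \<gamma>)) (fscale \<alpha> f + fscale \<beta> g + fscale \<gamma> h) + fscale (\<beta> * \<gamma>) (f + g + h)"
    by (rule qfun_eqI; simp add: algebra_simps)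
  also have "\<dots> = 0" unfolding assms(1-3) by (simp only: qfun.scale_zero_right add_0_left)
  finally show ?thesis using assms(4,5) by (simp only: qfun.scale_eq_0_iff mult_eq_0_iff right_minus_eq simp_thms)
qed

lemma (in sl2_action) casimir_scale:
  assumes "f \<in> laurent2" shows "casimir \<rho> (fscale a f) = fscale a (casimir \<rho> f)"
  unfolding casimir_def
  by (simp only: scale closed sl2_HEF assms) (rule qfun_eqI; simp add: algebra_simps)

lemma (in sl2_action) components3_span_iff:
  assumes M: "M = qfun.span (S1 \<union> S2 \<union> S3)" and L: "M \<subseteq> laurent2"
    and S: "submodule \<rho> (qfun.span S1) \<and> iso_VV \<rho> (qfun.span S1) j1 k1"
      "submodule \<rho> (qfun.span S2) \<and> iso_VV \<rho> (qfun.span S2) j2 k2"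
      "submodule \<rho> (qfun.span S3) \<and> iso_VV \<rho> (qfun.span S3) j3 k3"
    and eig: "\<And>W f. iso_VV \<rho> W j1 k1 \<Longrightarrow> f \<in> W \<Longrightarrow> casimir \<rho> f = fscale \<alpha> f"
      "\<And>W f. iso_VV \<rho> W j2 k2 \<Longrightarrow> f \<in> W \<Longrightarrow> casimir \<rho> f = fscale \<beta> f"
      "\<And>W f. iso_VV \<rho> W j3 k3 \<Longrightarrow> f \<in> W \<Longrightarrow> casimir \<rho> f = fscale \<gamma> f"
    and dist: "\<alpha> \<noteq> \<beta>" "\<alpha> \<noteq> \<gamma>" "\<beta> \<noteq> \<gamma>"
  shows "components3 \<rho> M (j1, k1) (j2, k2) (j3, k3) W1 W2 W3 \<longleftrightarrow>
    W1 = qfun.span S1 \<and> W2 = qfun.span S2 \<and> W3 = qfun.span S3"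
proof -
  have SL: "f \<in> laurent2" if "f \<in> qfun.span S1 \<or> f \<in> qfun.span S2 \<or> f \<in> qfun.span S3" for f
  proof -
    have "qfun.span S1 \<subseteq> M" "qfun.span S2 \<subseteq> M" "qfun.span S3 \<subseteq> M"
      unfolding M by (intro qfun.span_mono; blast)+
    then show ?thesis using that L by blast
  qed
  have direct: "f = 0 \<and> g = 0 \<and> h = 0"
    if fgh: "f \<in> qfun.span S1" "g \<in> qfun.span S2" "h \<in> qfun.span S3" and s: "f + g + h = 0" for f g h
  proof -
    have l: "f \<in> laurent2" "g \<in> laurent2" "h \<in> laurent2" using SL fgh by blast+
    have e: "casimir \<rho> f = fscale \<alpha> f" "casimir \<rho> g = fscale \<beta> g" "casimir \<rho> h = fscale \<gamma> h"
      using eig S fgh by blast+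
    have cas: "casimir \<rho> (fscale a f + fscale b g + fscale c h) = fscale a (fscale \<alpha> f) + fscale b (fscale \<beta> g) + fscale c (fscale \<gamma> h)" for a b c
      by (simp only: casimir_add casimir_scale e l qfun.subspace_add[OF laurent2_subspace] qfun.subspace_scale[OF laurent2_subspace])
    have s1: "fscale \<alpha> f + fscale \<beta> g + fscale \<gamma> h = 0"
      using cas[of 1 1 1] unfolding qfun.scale_one s casimir_zero by simp
    have s2: "fscale \<alpha> (fscale \<alpha> f) + fscale \<beta> (fscale \<beta> g) + fscale \<gamma> (fscale \<gamma> h) = 0"
      using cas[of \<alpha> \<beta> \<gamma>] unfolding s1 casimir_zero by simp
    have "f = 0" using three_eigenvectors[OF s s1 s2] dist by blast
    moreover have "g = 0"
    proof (rule three_eigenvectors[of g f h \<beta> \<alpha> \<gamma>])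
      show "g + f + h = 0" "fscale \<beta> g + fscale \<alpha> f + fscale \<gamma> h = 0"
        "fscale \<beta> (fscale \<beta> g) + fscale \<alpha> (fscale \<alpha> f) + fscale \<gamma> (fscale \<gamma> h) = 0"
        unfolding add.commute[of g f] add.commute[of "fscale \<beta> g" "fscale \<alpha> f"]
          add.commute[of "fscale \<beta> (fscale \<beta> g)" "fscale \<alpha> (fscale \<alpha> f)"]
        by (rule s s1 s2)+
    qed (use dist in blast)+
    moreover from s have "h = 0" unfolding calculation by (simp only: add_0_left)
    ultimately show ?thesis by blast
  qed
  have comp: "components3 \<rho> M (j1, k1) (j2, k2) (j3, k3) (qfun.span S1) (qfun.span S2) (qfun.span S3)"
  proof -
    have "direct_sum3 M (qfun.span S1) (qfun.span S2) (qfun.span S3)"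
      unfolding direct_sum3_def M span_Un3 using direct by (intro conjI refl ballI impI) blast+
    then show ?thesis unfolding components3_def prod.case using S by simp
  qed
  show ?thesis
  proof
    assume W: "components3 \<rho> M (j1, k1) (j2, k2) (j3, k3) W1 W2 W3"
    show "W1 = qfun.span S1 \<and> W2 = qfun.span S2 \<and> W3 = qfun.span S3"
    proof -
      have "W1 \<subseteq> qfun.span S1 \<and> W2 \<subseteq> qfun.span S2 \<and> W3 \<subseteq> qfun.span S3"
        by (rule component_subset[OF W comp L _ _ _ dist]) (erule (1) eig)+
      moreover have "qfun.span S1 \<subseteq> W1 \<and> qfun.span S2 \<subseteq> W2 \<and> qfun.span S3 \<subseteq> W3"
        by (rule component_subset[OF comp W L _ _ _ dist]) (erule (1) eig)+
      ultimately show ?thesis by blast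
    qed
  next
    assume "W1 = qfun.span S1 \<and> W2 = qfun.span S2 \<and> W3 = qfun.span S3"
    then show "components3 \<rho> M (j1, k1) (j2, k2) (j3, k3) W1 W2 W3" using comp by blast
  qed
qed

text \<open>
For \<open>j < 0\<close> or \<open>k < 0\<close> the module is zero, so any \<open>c\<close> will do. This is used for \<open>l = 0\<close>, where the
eigenvalues attached to the last two components coincide.
\<close>

lemma casimir_eigenvalue:
  assumes \<rho>: "sl2_action \<rho>" and jk: "2 * j = of_int P" "2 * k = of_int K"
    and c: "c = of_real (2 * j * (j + 1) + 2 * k * (k + 1)) \<or> j < 0 \<or> k < 0"
    and W: "iso_VV \<rho> W j k" "f \<in> W"
  shows "casimir \<rho> f = fscale c f"
proof (cases "j < 0 \<or> k < 0")
  case True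
  then have "f = 0" using iso_zero W by blast
  then show ?thesis using sl2_action.casimir_zero[OF \<rho>] by (simp only: qfun.scale_zero_right)
next
  case False
  then show ?thesis using casimir_iso[OF W half_integer_cases[OF jk(1)] half_integer_cases[OF jk(2)]] c by blast
qed

section \<open>The six families in integral indices\<close>

text \<open>
The indices \<open>m\<close> are counted upwards from the lower end by \<open>k\<close>, the indices \<open>n\<close> downwards from the
upper end by \<open>q\<close>.
\<close>

lemma family_eq_steps:
  assumes m: "b1 - a1 = of_int K" and n: "b2 - a2 = of_int P"
    and f: "\<And>p k q. int (p + k) = K \<Longrightarrow> 0 \<le> q \<Longrightarrow> q \<le> P \<Longrightarrow> f (a1 + real k) (b2 - of_int q) = \<Phi> p k q"
  shows "{f m n | m n. m \<in> steps a1 b1 \<and> n \<in> steps a2 b2} = family P K \<Phi>"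
  unfolding steps_eq[OF m] steps_eq[OF n]
proof (intro equalityI subsetI)
  fix x assume "x \<in> {f m n | m n. m \<in> {a1 + real i | i. int i \<le> K} \<and> n \<in> {a2 + real i | i. int i \<le> P}}"
  then obtain k i where x: "x = f (a1 + real k) (a2 + real i)" "int k \<le> K" "int i \<le> P" by blast
  have "a2 + real i = b2 - of_int (P - int i)" using n by simp
  moreover have "int (nat (K - int k) + k) = K" using x by simp
  moreover have "f (a1 + real k) (b2 - of_int (P - int i)) = \<Phi> (nat (K - int k)) k (P - int i)"
    by (rule f) (use x in simp_all)
  ultimately have "x = \<Phi> (nat (K - int k)) k (P - int i)" using x(1) by (simp only:)
  then show "x \<in> family P K \<Phi>"
    using \<open>int (nat (K - int k) + k) = K\<close> x(3) by (simp only:) (intro familyI, simp_all)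
next
  fix x assume "x \<in> family P K \<Phi>"
  then obtain p k q where x: "x = \<Phi> p k q" "int (p + k) = K" "0 \<le> q" "q \<le> P" unfolding family_def by blast
  have "x = f (a1 + real k) (a2 + real (nat (P - q)))"
  proof -
    have "b2 - of_int q = a2 + real (nat (P - q))" using x(4) n by simp
    then show ?thesis using f[OF x(2-4)] x(1) by (simp only:)
  qed
  moreover have "int k \<le> K" "int (nat (P - q)) \<le> P" using x by simp_all
  ultimately show "x \<in> {f m n | m n. m \<in> {a1 + real i | i. int i \<le> K} \<and> n \<in> {a2 + real i | i. int i \<le> P}}"
    by blast
qed

lemma tcoef_tpoly:
  assumes "2 * l = real (p + k)" "n = l - of_int q" "m = real k - l"
  shows "tcoef l n m Z = tpoly p k q Z"
  using tcoef_eq_tpoly[OF assms(1), of k q Z] assms(2,3) by simp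

lemma f1_eq:
  assumes "2 * l = real (p + k)"
  shows "f1 l (- l + real k) (l + 1/2 - of_int q) = left_regular 0 p k q"
proof (rule qfun_eqI)
  fix Z
  have "tcoef l (l + 1/2 - of_int q - 1/2) (- l + real k) Z = tpoly p k q Z"
    "tcoef l (l + 1/2 - of_int q + 1/2) (- l + real k) Z = tpoly p k (q - 1) Z"
    by (rule tcoef_tpoly[OF assms]; simp)+
  then show "f1 l (- l + real k) (l + 1/2 - of_int q) Z $ 1 = left_regular 0 p k q Z $ 1"
    "f1 l (- l + real k) (l + 1/2 - of_int q) Z $ 2 = left_regular 0 p k q Z $ 2"
    by (simp_all add: f1_def left_regular_def on_inv_apply Ntpoly_apply)
qed

lemma f2_eq:
  assumes "2 * l = real (p + k)"
  shows "f2 l (- l + real k) (l - 1/2 - of_int q) = left_coregular 0 p k (q + 1)"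
proof (rule qfun_eqI)
  fix Z
  have t: "tcoef l (l - 1/2 - of_int q - 1/2) (- l + real k) Z = tpoly p k (q + 1) Z"
    "tcoef l (l - 1/2 - of_int q + 1/2) (- l + real k) Z = tpoly p k q Z"
    by (rule tcoef_tpoly[OF assms]; simp)+
  have c: "l - (l - 1/2 - of_int q) + 1/2 = of_int (q + 1)" "l + (l - 1/2 - of_int q) + 1/2 = of_int (int (p + k) + 1 - (q + 1))"
    using assms by simp_all
  show "f2 l (- l + real k) (l - 1/2 - of_int q) Z $ 1 = left_coregular 0 p k (q + 1) Z $ 1"
    "f2 l (- l + real k) (l - 1/2 - of_int q) Z $ 2 = left_coregular 0 p k (q + 1) Z $ 2"
    by (simp_all only: f2_def left_coregular_def on_inv_apply pair_component Ntpoly_apply t c) simp_all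
qed

lemma f3_eq:
  assumes "2 * (l - 1) = real (p + k)"
  shows "f3 l (- l + 1 + real k) (l - 1/2 - of_int q) = left_regular 1 p k q"
proof (rule qfun_eqI)
  fix Z
  have "tcoef (l - 1) (l - 1/2 - of_int q - 1/2) (- l + 1 + real k) Z = tpoly p k q Z"
    "tcoef (l - 1) (l - 1/2 - of_int q + 1/2) (- l + 1 + real k) Z = tpoly p k (q - 1) Z"
    by (rule tcoef_tpoly[OF assms]; simp)+
  then show "f3 l (- l + 1 + real k) (l - 1/2 - of_int q) Z $ 1 = left_regular 1 p k q Z $ 1"
    "f3 l (- l + 1 + real k) (l - 1/2 - of_int q) Z $ 2 = left_regular 1 p k q Z $ 2"
    by (simp_all add: f3_def left_regular_def on_inv_apply Ntpoly_apply)
qed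

text \<open>
For \<open>m = - l - 1/2\<close> and \<open>m = l + 1/2\<close> one of the two lower indices is out of range; the coefficient
\<open>k\<close> or \<open>p\<close> vanishes there.
\<close>

lemma g1_comp:
  assumes "2 * l = real (p + k) - 1"
  shows "of_real (l + (- l - 1/2 + real k) + 1/2) * tcoef l (l - of_int q) (- l - 1/2 + real k - 1/2) Z = of_nat k * tpoly p (k - 1) q Z"
    "of_real (l - (- l - 1/2 + real k) + 1/2) * tcoef l (l - of_int q) (- l - 1/2 + real k + 1/2) Z = of_nat p * tpoly (p - 1) k q Z"
proof -
  have c: "l + (- l - 1/2 + real k) + 1/2 = real k" "l - (- l - 1/2 + real k) + 1/2 = real p"
    using assms by simp_all
  show "of_real (l + (- l - 1/2 + real k) + 1/2) * tcoef l (l - of_int q) (- l - 1/2 + real k - 1/2) Z = of_nat k * tpoly p (k - 1) q Z"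
  proof (cases k)
    case (Suc k')
    have "tcoef l (l - of_int q) (- l - 1/2 + real k - 1/2) Z = tpoly p (k - 1) q Z"
      by (rule tcoef_tpoly) (use assms Suc in simp_all)
    then show ?thesis unfolding c by simp
  qed simp
  show "of_real (l - (- l - 1/2 + real k) + 1/2) * tcoef l (l - of_int q) (- l - 1/2 + real k + 1/2) Z = of_nat p * tpoly (p - 1) k q Z"
  proof (cases p)
    case 0 then show ?thesis unfolding c by simp
  next
    case (Suc p')
    have "tcoef l (l - of_int q) (- l - 1/2 + real k + 1/2) Z = tpoly (p - 1) k q Z"
      by (rule tcoef_tpoly) (use assms Suc in simp_all)
    then show ?thesis unfolding c by simp
  qed
qed

lemma g1_eq:
  assumes "2 * l = real (p + k) - 1"
  shows "g1 l (- l - 1/2 + real k) (l - of_int q) = right_regular 0 p k q"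
  by (rule qfun_eqI; simp only: g1_def right_regular_def g1_comp[OF assms]; simp add: on_inv_apply Ntpoly_apply)

lemma g2_eq:
  assumes "2 * l = real (p + k) + 1"
  shows "g2 l (- l + 1/2 + real k) (l - of_int q) = right_coregular 0 p k q"
proof (rule qfun_eqI)
  fix Z
  have "tcoef l (l - of_int q) (- l + 1/2 + real k - 1/2) Z = tpoly (Suc p) k q Z"
    "tcoef l (l - of_int q) (- l + 1/2 + real k + 1/2) Z = tpoly p (Suc k) q Z"
    by (rule tcoef_tpoly; use assms in simp)+
  then show "g2 l (- l + 1/2 + real k) (l - of_int q) Z $ 1 = right_coregular 0 p k q Z $ 1"
    "g2 l (- l + 1/2 + real k) (l - of_int q) Z $ 2 = right_coregular 0 p k q Z $ 2"
    by (simp_all add: g2_def right_coregular_def on_inv_apply Ntpoly_apply)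
qed

lemma g3_eq:
  assumes "2 * (l - 1) = real (p + k) - 1"
  shows "g3 l (- l + 1/2 + real k) (l - 1 - of_int q) = right_regular 1 p k q"
proof (rule qfun_eqI)
  fix Z
  have "l + (- l + 1/2 + real k) - 1/2 = (l - 1) + (- (l - 1) - 1/2 + real k) + 1/2"
    "l - (- l + 1/2 + real k) - 1/2 = (l - 1) - (- (l - 1) - 1/2 + real k) + 1/2"
    "- l + 1/2 + real k = - (l - 1) - 1/2 + real k" by simp_all
  then have "of_real (l + (- l + 1/2 + real k) - 1/2) * tcoef (l - 1) (l - 1 - of_int q) (- l + 1/2 + real k - 1/2) Z = of_nat k * tpoly p (k - 1) q Z"
    "of_real (l - (- l + 1/2 + real k) - 1/2) * tcoef (l - 1) (l - 1 - of_int q) (- l + 1/2 + real k + 1/2) Z = of_nat p * tpoly (p - 1) k q Z"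
    using g1_comp[OF assms, of q Z] by (simp_all only:)
  then show "g3 l (- l + 1/2 + real k) (l - 1 - of_int q) Z $ 1 = right_regular 1 p k q Z $ 1"
    "g3 l (- l + 1/2 + real k) (l - 1 - of_int q) Z $ 2 = right_regular 1 p k q Z $ 2"
    by (simp_all only: g3_def right_regular_def) (simp_all add: on_inv_apply Ntpoly_apply)
qed

lemma real_eq_of_int: "int n = K \<Longrightarrow> real n = of_int K"
  by (metis of_int_of_nat_eq)

theorem proposition29:
  fixes l :: real and W1 W2 W3 :: "qfun set"
  assumes "2 * l \<in> \<nat>"
  shows
    "(components3 (differentiated \<pi>\<^sub>l) (\<U>_deg \<lfloor>2 * l\<rfloor>)
        (l + 1/2, l) (l - 1/2, l) (l - 1/2, l - 1) W1 W2 W3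
      \<longleftrightarrow>
        W1 = qfun.span {f1 l m n | m n. m \<in> steps (- l) l \<and> n \<in> steps (- l - 1/2) (l + 1/2)} \<and>
        W2 = qfun.span {f2 l m n | m n. m \<in> steps (- l) l \<and> n \<in> steps (- l + 1/2) (l - 1/2)} \<and>
        W3 = qfun.span {f3 l m n | m n. m \<in> steps (- l + 1) (l - 1) \<and> n \<in> steps (- l + 1/2) (l - 1/2)})
    \<and>
    (components3 (differentiated \<pi>\<^sub>r) (\<U>'_deg \<lfloor>2 * l\<rfloor>)
        (l, l + 1/2) (l, l - 1/2) (l - 1, l - 1/2) W1 W2 W3
      \<longleftrightarrow>
        W1 = qfun.span {g1 l m n | m n. m \<in> steps (- l - 1/2) (l + 1/2) \<and> n \<in> steps (- l) l} \<and>
        W2 = qfun.span {g2 l m n | m n. m \<in> steps (- l + 1/2) (l - 1/2) \<and> n \<in> steps (- l) l} \<and>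
        W3 = qfun.span {g3 l m n | m n. m \<in> steps (- l + 1/2) (l - 1/2) \<and> n \<in> steps (- l + 1) (l - 1)})"
proof -
  obtain L where L: "2 * l = real L" using assms by (auto elim: Nats_cases)
  have floor: "\<lfloor>2 * l\<rfloor> = int L" unfolding L by simp
  have l0: "l \<ge> 0" using L by simp
  have f: "{f1 l m n | m n. m \<in> steps (- l) l \<and> n \<in> steps (- l - 1/2) (l + 1/2)} = left1 L"
    "{f2 l m n | m n. m \<in> steps (- l) l \<and> n \<in> steps (- l + 1/2) (l - 1/2)} = left2 L"
    "{f3 l m n | m n. m \<in> steps (- l + 1) (l - 1) \<and> n \<in> steps (- l + 1/2) (l - 1/2)} = left3 L"
    by (rule family_eq_steps, use L in simp, use L in simp,
        rule f1_eq f2_eq f3_eq, drule real_eq_of_int, use L in simp)+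
  have g: "{g1 l m n | m n. m \<in> steps (- l - 1/2) (l + 1/2) \<and> n \<in> steps (- l) l} = right1 L"
    "{g2 l m n | m n. m \<in> steps (- l + 1/2) (l - 1/2) \<and> n \<in> steps (- l) l} = right2 L"
    "{g3 l m n | m n. m \<in> steps (- l + 1/2) (l - 1/2) \<and> n \<in> steps (- l + 1) (l - 1)} = right3 L"
    by (rule family_eq_steps, use L in simp, use L in simp,
        rule g1_eq g2_eq g3_eq, drule real_eq_of_int, use L in simp)+
  have jk: "2 * (l + 1/2) = of_int (int L + 1)" "2 * l = of_int (int L)" "2 * (l - 1/2) = of_int (int L - 1)"
    "2 * (l - 1) = of_int (int L - 2)" using L by simp_all
  define \<alpha> \<beta> \<gamma> :: complex where "\<alpha> = of_real (2 * (l + 1/2) * (l + 1/2 + 1) + 2 * l * (l + 1))"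
    and "\<beta> = of_real (2 * (l - 1/2) * (l - 1/2 + 1) + 2 * l * (l + 1))"
    \<comment> \<open>for \<open>l = 0\<close> the third component is zero and \<open>- 1\<close> is a substitute different from \<open>\<alpha>\<close> and \<open>\<beta>\<close>\<close>
    and "\<gamma> = of_real (if l = 0 then - 1 else 2 * (l - 1/2) * (l - 1/2 + 1) + 2 * (l - 1) * (l - 1 + 1))"
  have gaps: "2 * (l + 1/2) * (l + 1/2 + 1) + 2 * l * (l + 1) = 2 * (l - 1/2) * (l - 1/2 + 1) + 2 * l * (l + 1) + (4 * l + 2)"
    "2 * (l - 1/2) * (l - 1/2 + 1) + 2 * l * (l + 1) = 2 * (l - 1/2) * (l - 1/2 + 1) + 2 * (l - 1) * (l - 1 + 1) + 4 * l"
    by (simp_all add: field_simps)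
  have "\<alpha> \<noteq> \<beta> \<and> \<alpha> \<noteq> \<gamma> \<and> \<beta> \<noteq> \<gamma>"
  proof (cases "l = 0")
    case True
    then show ?thesis
      unfolding \<alpha>_def \<beta>_def \<gamma>_def of_real_eq_iff by simp_all
  next
    case False
    then have "l > 0" using l0 by simp
    then have "4 * l + 2 > 0" "4 * l > 0" by simp_all
    moreover have "a \<noteq> b \<and> a \<noteq> c \<and> b \<noteq> c" if "a = b + s" "b = c + t" "s > 0" "t > 0" for a b c s t :: real
      using that by auto
    ultimately show ?thesis
      unfolding \<alpha>_def \<beta>_def \<gamma>_def of_real_eq_iff if_not_P[OF False] using gaps by blast
  qed
  then have dist: "\<alpha> \<noteq> \<beta>" "\<alpha> \<noteq> \<gamma>" "\<beta> \<noteq> \<gamma>" by blast+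
  have left: "components3 (differentiated \<pi>\<^sub>l) (\<U>_deg (int L)) (l + 1/2, l) (l - 1/2, l) (l - 1/2, l - 1) W1 W2 W3
      \<longleftrightarrow> W1 = qfun.span (left1 L) \<and> W2 = qfun.span (left2 L) \<and> W3 = qfun.span (left3 L)"
  proof (rule left.components3_span_iff[OF \<U>_deg_eq_span, where \<alpha> = \<alpha> and \<beta> = \<beta> and \<gamma> = \<gamma>])
    show "\<U>_deg (int L) \<subseteq> laurent2" unfolding \<U>_deg_def \<U>_eq by blast
    show "submodule (differentiated \<pi>\<^sub>l) (qfun.span (left1 L)) \<and> iso_VV (differentiated \<pi>\<^sub>l) (qfun.span (left1 L)) (l + 1/2) l"
      by (rule left.family_iso_VV[OF jk(1,2) laurent2_basis(1) _ _ _ ladder_law_left_regular])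
        (simp_all only: of_nat_eq_iff, auto intro!: left_regular_zero simp: left_regular_nonzero)
    show "submodule (differentiated \<pi>\<^sub>l) (qfun.span (left2 L)) \<and> iso_VV (differentiated \<pi>\<^sub>l) (qfun.span (left2 L)) (l - 1/2) l"
      by (rule left.family_iso_VV[OF jk(3,2) laurent2_basis(2) _ _ _ ladder_law_left_coregular])
        (auto intro!: left_coregular_zero simp: left_coregular_nonzero)
    show "submodule (differentiated \<pi>\<^sub>l) (qfun.span (left3 L)) \<and> iso_VV (differentiated \<pi>\<^sub>l) (qfun.span (left3 L)) (l - 1/2) (l - 1)"
      by (rule left.family_iso_VV[OF _ jk(4) laurent2_basis(1) _ _ _ ladder_law_left_regular])
        (use jk(3) in \<open>auto intro!: left_regular_zero simp: left_regular_nonzero\<close>)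
    show "casimir (differentiated \<pi>\<^sub>l) f = fscale \<alpha> f" if "iso_VV (differentiated \<pi>\<^sub>l) W (l + 1/2) l" "f \<in> W" for W f
      by (rule casimir_eigenvalue[OF left.sl2_action_axioms jk(1,2) _ that]) (simp add: \<alpha>_def)
    show "casimir (differentiated \<pi>\<^sub>l) f = fscale \<beta> f" if "iso_VV (differentiated \<pi>\<^sub>l) W (l - 1/2) l" "f \<in> W" for W f
      by (rule casimir_eigenvalue[OF left.sl2_action_axioms jk(3,2) _ that]) (simp add: \<beta>_def)
    show "casimir (differentiated \<pi>\<^sub>l) f = fscale \<gamma> f" if "iso_VV (differentiated \<pi>\<^sub>l) W (l - 1/2) (l - 1)" "f \<in> W" for W f
      by (rule casimir_eigenvalue[OF left.sl2_action_axioms jk(3,4) _ that]) (simp add: \<gamma>_def)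
  qed (rule dist)+
  have right: "components3 (differentiated \<pi>\<^sub>r) (\<U>'_deg (int L)) (l, l + 1/2) (l, l - 1/2) (l - 1, l - 1/2) W1 W2 W3
      \<longleftrightarrow> W1 = qfun.span (right1 L) \<and> W2 = qfun.span (right2 L) \<and> W3 = qfun.span (right3 L)"
  proof (rule right.components3_span_iff[OF \<U>'_deg_eq_span, where \<alpha> = \<alpha> and \<beta> = \<beta> and \<gamma> = \<gamma>])
    show "\<U>'_deg (int L) \<subseteq> laurent2" unfolding \<U>'_deg_def \<U>'_eq by blast
    show "submodule (differentiated \<pi>\<^sub>r) (qfun.span (right1 L)) \<and> iso_VV (differentiated \<pi>\<^sub>r) (qfun.span (right1 L)) l (l + 1/2)"
      by (rule right.family_iso_VV[OF _ jk(1) laurent2_basis(3) _ _ _ ladder_law_right_regular])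
        (use jk(2) in \<open>auto intro!: right_regular_zero simp: right_regular_nonzero\<close>)
    show "submodule (differentiated \<pi>\<^sub>r) (qfun.span (right2 L)) \<and> iso_VV (differentiated \<pi>\<^sub>r) (qfun.span (right2 L)) l (l - 1/2)"
      by (rule right.family_iso_VV[OF _ jk(3) laurent2_basis(4) _ _ _ ladder_law_right_coregular])
        (use jk(2) in \<open>auto intro!: right_coregular_zero simp: right_coregular_nonzero\<close>)
    show "submodule (differentiated \<pi>\<^sub>r) (qfun.span (right3 L)) \<and> iso_VV (differentiated \<pi>\<^sub>r) (qfun.span (right3 L)) (l - 1) (l - 1/2)"
      by (rule right.family_iso_VV[OF _ jk(3) laurent2_basis(3) _ _ _ ladder_law_right_regular])
        (use jk(4) in \<open>auto intro!: right_regular_zero simp: right_regular_nonzero\<close>)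
    show "casimir (differentiated \<pi>\<^sub>r) f = fscale \<alpha> f" if "iso_VV (differentiated \<pi>\<^sub>r) W l (l + 1/2)" "f \<in> W" for W f
      by (rule casimir_eigenvalue[OF right.sl2_action_axioms jk(2,1) _ that]) (simp add: \<alpha>_def)
    show "casimir (differentiated \<pi>\<^sub>r) f = fscale \<beta> f" if "iso_VV (differentiated \<pi>\<^sub>r) W l (l - 1/2)" "f \<in> W" for W f
      by (rule casimir_eigenvalue[OF right.sl2_action_axioms jk(2,3) _ that]) (simp add: \<beta>_def)
    show "casimir (differentiated \<pi>\<^sub>r) f = fscale \<gamma> f" if "iso_VV (differentiated \<pi>\<^sub>r) W (l - 1) (l - 1/2)" "f \<in> W" for W f
      by (rule casimir_eigenvalue[OF right.sl2_action_axioms jk(4,3) _ that]) (simp add: \<gamma>_def)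
  qed (rule dist)+
  show ?thesis unfolding floor f g using left right by blast
qed

end
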